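(* Let $q\ge 2$ and let $\{n_j\}_{j=0}^\infty$ be a sequence in $\mathbb{N}$ such that $n_0=1$ and $n_{j+1}/n_j\ge q$ for all $j\in\mathbb{Z}^+$. Let $\{\delta_j\}_{j\in\mathbb{Z}^+}\in\ell^2(\mathbb{Z}^+)$ be a sequence of complex numbers with $\|\{\delta_j\}\|_{\ell^\infty(\mathbb{Z}^+)}<1$. Let $\sigma$ be the probability measure on $\mathbb{T}$ (with infinite support) whose recurrence coefficients $\{\gamma_n(\sigma)\}_{n\ge0}$ satisfy $\gamma_{n_j}=\delta_j$ for all $j\in\mathbb{N}$ and $\gamma_n=0$ for all other $n\in\mathbb{Z}^+$. Then $\sigma$ is absolutely continuous, $d\sigma=w\,dm$, with $w\in L^p(\mathbb{T},m)$ for every $p\in[2,\infty)$. Moreover, for every $p\in[2,\infty)$, the sequences $\{\phi_n^*(\cdot,\sigma)\}$ and $\{\Phi_n^*(\cdot,\sigma)\}$ converge in $L^p(\mathbb{T},m)$ as $n\to\infty$.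
   Context: $\mathbb{N}=\{1,2,\ldots\}$, $\mathbb{Z}^+=\{0,1,2,\ldots\}$, $\mathbb{T}$ is the unit circle, $\mathbb{D}$ the open unit disc, and $m$ is the normalized Lebesgue measure on $\mathbb{T}$ ($dm=(2\pi)^{-1}d\theta$). Let $\sigma$ be a probability measure on $\mathbb{T}$ whose support is an infinite set. Its monic orthogonal polynomials $\Phi_n(z,\sigma)$ and orthonormal polynomials $\phi_n(z,\sigma)$, $n\in\mathbb{Z}^+$, are determined by: $\deg\Phi_n=\deg\phi_n=n$; $\Phi_n$ has leading coefficient $1$ and $\phi_n$ has positive leading coefficient; $\int_{\mathbb{T}}\Phi_n(z,\sigma)z^{-j}d\sigma=\int_{\mathbb{T}}\phi_n(z,\sigma)z^{-j}d\sigma=0$ for all $j\in\{0,\ldots,n-1\}$; and $\int_{\mathbb{T}}|\phi_n|^2d\sigma=1$. For the polynomials of index $n$ one sets $\Phi_n^*(z):=z^n\overline{\Phi_n(\bar z^{-1})}$ and $\phi_n^*(z):=z^n\overline{\phi_n(\bar z^{-1})}$. The monic polynomials satisfy $$\Phi_{n+1}=z\Phi_n-\overline{\gamma_n}\,\Phi_n^*,\qquad \Phi_0=1,\quad n\in\mathbb{Z}^+,$$ where $\gamma_n=\gamma_n(\sigma)\in\mathbb{D}$ are called the recurrence (Schur, Verblunsky) coefficients of $\sigma$. The map $\sigma\mapsto\{\gamma_n\}_{n\ge0}$ is a bijection between probability measures on $\mathbb{T}$ with infinite support and sequences in $\mathbb{D}^\infty$. *)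

theory Defs
  imports "HOL-Probability.Probability" "HOL-Computational_Algebra.Polynomial"
begin

text \<open>
  Measures on the unit circle are encoded as Borel measures on the complex plane
  that are concentrated on \<^term>\<open>sphere (0::complex) 1\<close>.
\<close>

definition circle_measure :: "complex measure" where
  "circle_measure = distr (uniform_measure lborel {0..<2*pi}) borel cis"

definition measure_support :: "'a::topological_space measure \<Rightarrow> 'a set" where
  "measure_support M = {x. \<forall>U. open U \<longrightarrow> x \<in> U \<longrightarrow> emeasure M U > 0}"

definition circle_prob_infinite_support :: "complex measure \<Rightarrow> bool" where
  "circle_prob_infinite_support \<sigma> \<longleftrightarrow>
     prob_space \<sigma> \<and> sets \<sigma> = sets borel \<and> emeasure \<sigma> (- sphere 0 1) = 0 \<and>
     infinite (measure_support \<sigma>)"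

definition monic_OP :: "complex measure \<Rightarrow> nat \<Rightarrow> complex poly" where
  "monic_OP \<sigma> n = (THE p. degree p = n \<and> lead_coeff p = 1 \<and>
     (\<forall>j<n. (LINT z|\<sigma>. poly p z * z powi (- int j)) = 0))"

definition orthonormal_OP :: "complex measure \<Rightarrow> nat \<Rightarrow> complex poly" where
  "orthonormal_OP \<sigma> n = (THE p. degree p = n \<and> lead_coeff p \<in> \<real> \<and> Re (lead_coeff p) > 0 \<and>
     (\<forall>j<n. (LINT z|\<sigma>. poly p z * z powi (- int j)) = 0) \<and>
     (LINT z|\<sigma>. (cmod (poly p z))\<^sup>2) = 1)"

text \<open>
  The reversed polynomial of index \<open>n\<close>, given by its coefficients so that it is a polynomial
  also at the origin; lemma \<open>poly_star_poly\<close> below is the usual formula.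
\<close>

definition star_poly :: "nat \<Rightarrow> complex poly \<Rightarrow> complex poly" where
  "star_poly n p = (\<Sum>k\<le>n. monom (cnj (coeff p (n - k))) k)"

lemma poly_star_poly:
  assumes "degree p \<le> n" "z \<noteq> 0"
  shows "poly (star_poly n p) z = z ^ n * cnj (poly p (inverse (cnj z)))"
proof -
  have p: "poly p x = (\<Sum>k\<le>n. coeff p k * x ^ k)" for x
    by (subst poly_as_sum_of_monoms'[OF assms(1), symmetric]) (simp add: poly_sum poly_monom)
  have "poly (star_poly n p) z = (\<Sum>k\<le>n. cnj (coeff p (n - k)) * z ^ k)"
    by (simp add: star_poly_def poly_sum poly_monom)
  also have "\<dots> = (\<Sum>k\<le>n. cnj (coeff p k) * z ^ (n - k))"
    by (rule sum.reindex_bij_witness[of _ "\<lambda>k. n - k" "\<lambda>k. n - k"]) auto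
  also have "\<dots> = (\<Sum>k\<le>n. z ^ n * (cnj (coeff p k) * inverse z ^ k))"
    by (rule sum.cong) (use assms(2) in \<open>auto simp: power_diff field_simps power_inverse\<close>)
  finally show ?thesis
    by (simp add: p sum_distrib_left)
qed

text \<open>The recurrence (Schur, Verblunsky) coefficients are read off from the Szego recurrence.\<close>

definition recurrence_coeff :: "complex measure \<Rightarrow> nat \<Rightarrow> complex" where
  "recurrence_coeff \<sigma> n = (THE g. monic_OP \<sigma> (Suc n) =
     pCons 0 (monic_OP \<sigma> n) - smult (cnj g) (star_poly n (monic_OP \<sigma> n)))"

definition in_Lp :: "'a measure \<Rightarrow> real \<Rightarrow> ('a \<Rightarrow> 'b::{banach, second_countable_topology}) \<Rightarrow> bool" where
  "in_Lp M p f \<longleftrightarrow> f \<in> borel_measurable M \<and> integrable M (\<lambda>x. norm (f x) powr p)"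

definition Lp_norm :: "'a measure \<Rightarrow> real \<Rightarrow> ('a \<Rightarrow> 'b::{banach, second_countable_topology}) \<Rightarrow> real" where
  "Lp_norm M p f = (LINT x|M. norm (f x) powr p) powr (1 / p)"

definition converges_in_Lp ::
  "'a measure \<Rightarrow> real \<Rightarrow> (nat \<Rightarrow> 'a \<Rightarrow> 'b::{banach, second_countable_topology}) \<Rightarrow> bool" where
  "converges_in_Lp M p F \<longleftrightarrow> (\<forall>n. in_Lp M p (F n)) \<and>
     (\<exists>g. in_Lp M p g \<and> (\<lambda>n. Lp_norm M p (\<lambda>x. F n x - g x)) \<longlonglongrightarrow> 0)"

end

theory Submission
  imports Defs "HOL-Complex_Analysis.Cauchy_Integral_Formula"
begin

text \<open>
  On the circle the reversed polynomials obey \<open>F\<^sub>k\<^sub>+\<^sub>1 = F\<^sub>k - \<gamma>\<^sub>k z\<^sup>k\<^sup>+\<^sup>1 cnj F\<^sub>k\<close>. Hence the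
  logarithmic derivative of \<open>F\<^sub>k\<close> in the angle is bounded pointwise by a number \<open>L k\<close> given by a simple
  recursion, and lacunarity makes \<open>L k / (k + 1)\<close>, at the indices with \<open>\<gamma>\<^sub>k \<noteq> 0\<close>, square summable
  together with the coefficients. Expanding \<open>|F\<^sub>k\<^sub>+\<^sub>1|\<^sup>2\<^sup>m\<close> to second order in \<open>\<gamma>\<^sub>k\<close>, the linear term
  carries the factor \<open>z\<^sup>k\<^sup>+\<^sup>1\<close>; integration by parts bounds it by a multiple of
  \<open>|\<gamma>\<^sub>k| L k / (k + 1)\<close>, which is summable. So all moments of \<open>F\<^sub>k\<close> and of \<open>1 / F\<^sub>k\<close> are bounded, and
  the same mechanism makes \<open>F\<^sub>k\<close> a Cauchy sequence in \<open>L\<^sup>2\<close>, hence in every \<open>L\<^sup>p\<close> by interpolation.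
  The Bernstein--Szego measures \<open>dm / |\<phi>\<^sub>k|\<^sup>2\<close> share their first moments with \<open>\<sigma>\<close>, so the limit of their
  densities is the density of \<open>\<sigma>\<close>.
\<close>

section \<open>Orthogonal polynomials on the unit circle\<close>

text \<open>Each step multiplies \<open>F k\<close> on the circle by 1 - \<gamma> u with u
  unimodular, so estimating by absolute values would need summable coefficients, while they are only
  square summable. The first-order terms must cancel, as for a Riesz product, and the cancellation
  has to survive multiplication by powers of \<open>F k\<close>, which are no trigonometric
  polynomials once the exponent is negative. A pointwise bound on the logarithmic derivative passes
  to products, conjugates and inverses alike; this is why it, rather than a degree, measures
  smoothness. Even exponents 2m, with m an integer of either sign, keep the expansion algebraic.
  Lacunarity enters only through consecutive frequencies: for N' >= 2N >= 2 one has (N + 1) / (N' +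
  1) <= 2/3, and this beats the growth factor (1 + |\<gamma>|) / (1 - |\<gamma>|) of the logarithmic
  derivative as soon as |\<gamma>| is small. Negative moments are what turns closeness of the
  \<open>F k\<close> into closeness of the densities 1 / |F|^2.\<close>

lemma borel_measurable_poly[measurable (raw)]:
  "f \<in> borel_measurable M \<Longrightarrow> (\<lambda>x. poly (p :: complex poly) (f x)) \<in> borel_measurable M"
  by (rule measurable_compose[OF _ borel_measurable_continuous_onI[OF continuous_on_poly[OF continuous_on_id]]])

lemma borel_measurable_cnj[measurable (raw)]:
  "f \<in> borel_measurable M \<Longrightarrow> (\<lambda>x. cnj (f x)) \<in> borel_measurable M"
  by (rule measurable_compose[OF _ borel_measurable_continuous_onI[OF continuous_on_cnj[OF continuous_on_id]]])

lemma coeff_star_poly: "coeff (star_poly n p) k = (if k \<le> n then cnj (coeff p (n - k)) else 0)"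
  by (simp add: star_poly_def coeff_sum)

lemma degree_star_poly_le: "degree (star_poly n p) \<le> n"
  by (rule degree_le) (simp add: coeff_star_poly)

lemma poly_star_poly_circle:
  assumes "degree p \<le> n" "cmod z = 1"
  shows "poly (star_poly n p) z = z ^ n * cnj (poly p z)"
proof -
  have z: "z \<noteq> 0" using assms(2) by auto
  have "z * cnj z = 1" using assms(2) by (simp add: complex_norm_square[symmetric])
  then have "inverse (cnj z) = z" by (metis inverse_unique mult.commute)
  then show ?thesis using poly_star_poly[OF assms(1) z] by simp
qed

lemma norm_poly_star_poly_circle:
  assumes "degree p \<le> n" "cmod z = 1"
  shows "cmod (poly (star_poly n p) z) = cmod (poly p z)"
  using poly_star_poly_circle[OF assms] assms(2) by (simp add: norm_mult norm_power)

text \<open>The recurrence is run on an arbitrary sequence, so that one family of polynomials can be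
  tested against both \<sigma> and the Bernstein--Szego measures.\<close>

primrec szego :: "(nat \<Rightarrow> complex) \<Rightarrow> nat \<Rightarrow> complex poly" where
  "szego \<gamma> 0 = 1"
| "szego \<gamma> (Suc n) = pCons 0 (szego \<gamma> n) - smult (cnj (\<gamma> n)) (star_poly n (szego \<gamma> n))"

definition szego_star :: "(nat \<Rightarrow> complex) \<Rightarrow> nat \<Rightarrow> complex poly" where
  "szego_star \<gamma> n = star_poly n (szego \<gamma> n)"

text \<open>Reversal at index \<open>Suc n\<close> exchanges \<open>pCons 0 p\<close> and
  \<open>star_poly n p\<close> and conjugates scalars.\<close>

lemma star_poly_step:
  assumes "degree p \<le> n"
  shows "star_poly (Suc n) (pCons 0 p - smult (cnj g) (star_poly n p)) =
    star_poly n p - smult g (pCons 0 p)"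
proof (rule poly_eqI)
  fix k
  have z: "coeff p j = 0" if "j > n" for j using assms that by (simp add: coeff_eq_0)
  show "coeff (star_poly (Suc n) (pCons 0 p - smult (cnj g) (star_poly n p))) k =
    coeff (star_poly n p - smult g (pCons 0 p)) k"
  proof (cases k)
    case 0
    then show ?thesis by (simp add: coeff_star_poly coeff_pCons)
  next
    case (Suc i)
    then show ?thesis using z
      by (auto simp: coeff_star_poly coeff_pCons split: nat.split)
         (metis Suc_diff_Suc diff_Suc_1' not_less_eq_eq order_le_less  nat.distinct(1) not_le)+
  qed
qed

lemma degree_lead_step:
  fixes p :: "complex poly" and g :: complex
  assumes "degree p = n" "lead_coeff p = (1::complex)"
  defines "p' \<equiv> pCons 0 p - smult g (star_poly n p)"
  shows "degree p' = Suc n" "lead_coeff p' = 1"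
proof -
  have c: "coeff p' (Suc n) = 1"
    using assms(1,2) by (simp add: p'_def coeff_star_poly)
  have "degree p' \<le> Suc n"
    unfolding p'_def using assms(1)
    by (intro degree_diff_le) (auto intro: order.trans[OF degree_pCons_le]
      order.trans[OF degree_smult_le] order.trans[OF degree_star_poly_le])
  moreover have "Suc n \<le> degree p'" using c by (intro le_degree) auto
  ultimately show d: "degree p' = Suc n" by simp
  show "lead_coeff p' = 1" using c d by simp
qed

lemma degree_szego: "degree (szego \<gamma> n) = n"
  and lead_coeff_szego: "lead_coeff (szego \<gamma> n) = 1"
  by (induction n) (use degree_lead_step in auto)

lemma coeff_szego: "coeff (szego \<gamma> n) n = 1"
  using lead_coeff_szego[of \<gamma> n] by (simp add: degree_szego)

lemma szego_star_0: "szego_star \<gamma> 0 = 1"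
  by (simp add: szego_star_def star_poly_def one_pCons monom_0)

lemma szego_star_Suc:
  "szego_star \<gamma> (Suc n) = szego_star \<gamma> n - smult (\<gamma> n) (pCons 0 (szego \<gamma> n))"
  unfolding szego_star_def by (simp add: star_poly_step degree_szego)

lemma szego_star_nonzero: "szego_star \<gamma> n \<noteq> 0"
proof
  assume "szego_star \<gamma> n = 0"
  then have "coeff (szego_star \<gamma> n) 0 = 0" by simp
  then show False using lead_coeff_szego[of \<gamma> n] degree_szego[of \<gamma> n]
    by (simp add: szego_star_def coeff_star_poly)
qed

text \<open>The quotient \<open>\<Phi>\<^sub>n / \<Phi>\<^sub>n\<^sup>*\<close> runs through the Schur algorithm, so it stays in the closed unit disc.\<close>

lemma szego_star_disc:
  assumes "\<And>k. cmod (\<gamma> k) < 1" "cmod z \<le> 1"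
  shows "poly (szego_star \<gamma> n) z \<noteq> 0 \<and> cmod (poly (szego \<gamma> n) z) \<le> cmod (poly (szego_star \<gamma> n) z)"
proof (induction n)
  case 0
  then show ?case by (simp add: szego_star_0)
next
  case (Suc n)
  define a where "a = z * poly (szego \<gamma> n) z"
  define b where "b = poly (szego_star \<gamma> n) z"
  define g where "g = \<gamma> n"
  have g: "cmod g < 1" using assms(1) g_def by simp
  have b0: "b \<noteq> 0" using Suc b_def by simp
  have ab: "cmod a \<le> cmod b"
  proof -
    have "cmod a \<le> 1 * cmod (poly (szego \<gamma> n) z)"
      unfolding a_def norm_mult using assms(2) by (intro mult_right_mono) auto
    then show ?thesis using Suc b_def by simp
  qed
  have e1: "poly (szego_star \<gamma> (Suc n)) z = b - g * a"
    by (simp add: szego_star_Suc a_def b_def g_def)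
  have e2: "poly (szego \<gamma> (Suc n)) z = a - cnj g * b"
    by (simp add: a_def b_def g_def szego_star_def)
  have "cmod (g * a) < cmod b"
  proof -
    have "cmod (g * a) \<le> cmod g * cmod b" unfolding norm_mult using ab by (intro mult_left_mono) auto
    also have "\<dots> < 1 * cmod b" using g b0 by (intro mult_strict_right_mono) auto
    finally show ?thesis by simp
  qed
  then have n0: "b - g * a \<noteq> 0" by auto
  \<comment> \<open>The indefinite form |b|^2 - |a|^2 is only rescaled, by 1 - |g|^2, in one step;
    this is the invariance behind the Schur algorithm.\<close>
  have "(cmod (b - g * a))\<^sup>2 - (cmod (a - cnj g * b))\<^sup>2 = (1 - (cmod g)\<^sup>2) * ((cmod b)\<^sup>2 - (cmod a)\<^sup>2)"
    unfolding cmod_power2 by (simp add: algebra_simps power2_eq_square)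
  also have "\<dots> \<ge> 0"
  proof (rule mult_nonneg_nonneg)
    show "0 \<le> 1 - (cmod g)\<^sup>2" using g by (simp add: abs_square_le_1)
    show "0 \<le> (cmod b)\<^sup>2 - (cmod a)\<^sup>2" using ab by simp
  qed
  finally have "(cmod (a - cnj g * b))\<^sup>2 \<le> (cmod (b - g * a))\<^sup>2" by simp
  then have "cmod (a - cnj g * b) \<le> cmod (b - g * a)" by (rule power2_le_imp_le) simp
  then show ?case using e1 e2 n0 by simp
qed

section \<open>Inner products on the circle and the two directions of the recurrence\<close>

definition circle_ip :: "complex measure \<Rightarrow> complex poly \<Rightarrow> complex poly \<Rightarrow> complex" where
  "circle_ip M p q = (LINT z|M. poly p z * cnj (poly q z))"

definition circle_orth :: "complex measure \<Rightarrow> complex poly \<Rightarrow> nat \<Rightarrow> bool" where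
  "circle_orth M p n \<longleftrightarrow> (\<forall>j<n. circle_ip M p (monom 1 j) = 0)"

text \<open>Only finiteness is asked, because the densities \<open>szego_density\<close> have total
  mass 1 / \<open>szego_energy\<close> and are normalised late.\<close>

locale measure_on_circle = finite_measure M for M :: "complex measure" +
  assumes sets_M[simp, measurable_cong]: "sets M = sets borel"
    and null_off_circle: "emeasure M (- sphere 0 1) = 0"
begin

lemma space_M[simp]: "space M = UNIV"
  using sets_eq_imp_space_eq[OF sets_M] by simp

lemma AE_circle: "AE z in M. cmod z = 1"
  by (rule AE_I[OF _ null_off_circle]) auto

lemma integrable_continuous:
  fixes f :: "complex \<Rightarrow> 'b::{banach, second_countable_topology}"
  assumes "f \<in> borel_measurable borel" "continuous_on (sphere 0 1) f"
  shows "integrable M f"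
proof -
  have "compact (f ` sphere 0 1)" using assms(2) by (intro compact_continuous_image) auto
  then obtain B where B: "\<And>z. z \<in> sphere 0 1 \<Longrightarrow> norm (f z) \<le> B"
    using compact_imp_bounded bounded_iff by (metis imageI)
  have "AE z in M. norm (f z) \<le> B" using AE_circle by eventually_elim (use B in auto)
  then show ?thesis using assms(1) by (intro integrable_const_bound) (auto simp: measurable_cong_sets[OF sets_M refl])
qed

lemma integrable_cont_UNIV:
  fixes f :: "complex \<Rightarrow> 'b::{banach, second_countable_topology}"
  assumes "continuous_on UNIV f"
  shows "integrable M f"
  by (intro integrable_continuous borel_measurable_continuous_onI assms continuous_on_subset[OF assms]) auto

lemma integral_circle_cong:
  assumes "f \<in> borel_measurable borel" "g \<in> borel_measurable borel"
    "\<And>z. cmod z = 1 \<Longrightarrow> f z = g z"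
  shows "integral\<^sup>L M f = integral\<^sup>L M g"
  by (rule integral_cong_AE)
     (use assms AE_circle in \<open>auto simp: measurable_cong_sets[OF sets_M refl]\<close>)

lemma ip_integrable: "integrable M (\<lambda>z. poly p z * cnj (poly q z))"
  by (intro integrable_cont_UNIV continuous_on_mult continuous_on_cnj continuous_on_poly continuous_on_id)

lemma ip_add_left: "circle_ip M (p + q) r = circle_ip M p r + circle_ip M q r"
  unfolding circle_ip_def by (simp add: distrib_right ip_integrable)

lemma ip_diff_left: "circle_ip M (p - q) r = circle_ip M p r - circle_ip M q r"
  unfolding circle_ip_def by (simp add: left_diff_distrib ip_integrable)

lemma ip_add_right: "circle_ip M r (p + q) = circle_ip M r p + circle_ip M r q"
  unfolding circle_ip_def by (simp add: distrib_left ip_integrable)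

lemma ip_diff_right: "circle_ip M r (p - q) = circle_ip M r p - circle_ip M r q"
  unfolding circle_ip_def by (simp add: right_diff_distrib ip_integrable)

lemma ip_smult_left: "circle_ip M (smult c p) r = c * circle_ip M p r"
  unfolding circle_ip_def by (simp add: mult.assoc ip_integrable)

lemma ip_smult_right: "circle_ip M r (smult c p) = cnj c * circle_ip M r p"
  unfolding circle_ip_def by (simp add: mult.left_commute ip_integrable)

lemma ip_cnj: "cnj (circle_ip M p q) = circle_ip M q p"
  unfolding circle_ip_def
  using Bochner_Integration.integral_cnj[of M "\<lambda>z. poly p z * cnj (poly q z)"]
  by (simp add: mult.commute)

lemma ip_pCons: "circle_ip M (pCons 0 p) (pCons 0 q) = circle_ip M p q"
  unfolding circle_ip_def
proof (rule integral_circle_cong)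
  fix z :: complex assume z: "cmod z = 1"
  have "z * cnj z = 1" using z by (simp add: complex_norm_square[symmetric])
  then show "poly (pCons 0 p) z * cnj (poly (pCons 0 q) z) = poly p z * cnj (poly q z)"
    by simp
qed measurable

lemma ip_star:
  assumes "degree p \<le> n" "degree q \<le> n"
  shows "circle_ip M (star_poly n p) (star_poly n q) = circle_ip M q p"
  unfolding circle_ip_def
proof (rule integral_circle_cong)
  fix z :: complex assume z: "cmod z = 1"
  have "z ^ n * cnj z ^ n = 1" using z
    by (metis complex_norm_square mult_1 of_real_1 power_mult_distrib power_one power2_eq_square)
  then have "z ^ n * cnj (poly p z) * (cnj z ^ n * poly q z) = poly q z * cnj (poly p z)"
    by (metis (no_types, opaque_lifting) mult.assoc mult.commute mult_1)
  then show "poly (star_poly n p) z * cnj (poly (star_poly n q) z) = poly q z * cnj (poly p z)"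
    using z assms by (simp add: poly_star_poly_circle)
qed measurable

lemma orth_lower:
  assumes "circle_orth M p n" "degree q < n"
  shows "circle_ip M p q = 0"
proof -
  have "circle_ip M p (\<Sum>i\<le>k. monom (coeff q i) i) = 0" if "k < n" for k
    using that
  proof (induction k)
    case 0
    have "circle_ip M p (monom 1 0) = 0" using assms(1) 0 unfolding circle_orth_def by blast
    then have "circle_ip M p (smult (coeff q 0) (monom 1 0)) = 0"
      unfolding ip_smult_right by (simp del: monom_0)
    then show ?case unfolding smult_monom by simp
  next
    case (Suc k)
    have "circle_ip M p (smult (coeff q (Suc k)) (monom 1 (Suc k))) = 0"
      unfolding ip_smult_right using assms(1) Suc by (simp add: circle_orth_def)
    then show ?case using Suc by (simp add: smult_monom ip_add_right)
  qed
  from this[OF assms(2)] show ?thesis by (simp add: poly_as_sum_of_monoms)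
qed

text \<open>Reversal acts on the circle as f -> z^n \<open>cnj\<close> f, which conjugates inner
  products, and \<open>monom 1 j\<close> is the reversal of \<open>monom 1 (n - j)\<close>; from 1
  <= j the latter has degree below n.\<close>

lemma orth_star:
  assumes "degree p \<le> n" "circle_orth M p n" "1 \<le> j" "j \<le> n"
  shows "circle_ip M (star_poly n p) (monom 1 j) = 0"
proof -
  have e: "monom 1 j = star_poly n (monom 1 (n - j))"
    by (rule poly_eqI) (use assms in \<open>auto simp: coeff_star_poly\<close>)
  have d: "degree (monom (1::complex) (n - j)) \<le> n" by (rule order.trans[OF degree_monom_le]) simp
  have "circle_ip M (star_poly n p) (monom 1 j) = circle_ip M (monom 1 (n - j)) p"
    unfolding e by (rule ip_star[OF assms(1) d])
  also have "\<dots> = cnj (circle_ip M p (monom 1 (n - j)))" by (simp add: ip_cnj)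
  also have "\<dots> = 0" using assms by (simp add: circle_orth_def)
  finally show ?thesis .
qed

lemma monom_Suc_pCons: "monom 1 (Suc j) = pCons 0 (monom (1::complex) j)"
  by (simp add: monom_Suc)

text \<open>Orthogonality to z, ..., z^n is automatic, by \<open>ip_pCons\<close> for the shifted
  part and by \<open>orth_star\<close> for the reversed part; only the inner product with 1 depends
  on g.\<close>

lemma orth_step_up:
  assumes "degree p \<le> n" "circle_orth M p n"
    and "circle_ip M (pCons 0 p - smult g (star_poly n p)) 1 = 0"
  shows "circle_orth M (pCons 0 p - smult g (star_poly n p)) (Suc n)"
  unfolding circle_orth_def
proof (intro allI impI)
  fix j assume j: "j < Suc n"
  show "circle_ip M (pCons 0 p - smult g (star_poly n p)) (monom 1 j) = 0"
  proof (cases j)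
    case 0
    then show ?thesis using assms(3) by (simp add: one_pCons monom_0)
  next
    case (Suc i)
    have "circle_ip M (pCons 0 p) (monom 1 j) = 0"
      unfolding Suc monom_Suc_pCons ip_pCons using assms(2) j Suc by (simp add: circle_orth_def)
    moreover have "circle_ip M (star_poly n p) (monom 1 j) = 0"
      using orth_star[OF assms(1,2)] j Suc by simp
    ultimately show ?thesis by (simp add: ip_diff_left ip_smult_left)
  qed
qed

text \<open>The recurrence is inverted: adding \<open>cnj g\<close> times the reversal of
  \<open>p'\<close> to \<open>p'\<close> cancels \<open>star_poly n p\<close> and leaves (1 - |g|^2)
  z p. Both summands are orthogonal to z^(j+1), and one factor z drops out of the inner
  product.\<close>

lemma orth_step_down:
  fixes g :: complex
  assumes "degree p \<le> n" "cmod g < 1"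
  defines "p' \<equiv> pCons 0 p - smult (cnj g) (star_poly n p)"
  assumes "circle_orth M p' (Suc n)"
  shows "circle_orth M p n"
  unfolding circle_orth_def
proof (intro allI impI)
  fix j assume j: "j < n"
  have dp': "degree p' \<le> Suc n" unfolding p'_def using assms(1)
    by (intro degree_diff_le) (auto intro: order.trans[OF degree_pCons_le]
      order.trans[OF degree_smult_le] order.trans[OF degree_star_poly_le])
  have s: "star_poly (Suc n) p' = star_poly n p - smult g (pCons 0 p)"
    unfolding p'_def by (rule star_poly_step[OF assms(1)])
  have e: "p' + smult (cnj g) (star_poly (Suc n) p') = smult (1 - cnj g * g) (pCons 0 p)"
    unfolding s by (simp add: p'_def smult_diff_left smult_diff_right algebra_simps)
  have "circle_ip M p' (monom 1 (Suc j)) = 0" using assms(4) j by (simp add: circle_orth_def)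
  moreover have "circle_ip M (star_poly (Suc n) p') (monom 1 (Suc j)) = 0"
    using orth_star[OF dp' assms(4)] j by simp
  ultimately have "circle_ip M (p' + smult (cnj g) (star_poly (Suc n) p')) (monom 1 (Suc j)) = 0"
    by (simp add: ip_add_left ip_smult_left)
  then have "(1 - cnj g * g) * circle_ip M p (monom 1 j) = 0"
    unfolding e ip_smult_left monom_Suc_pCons ip_pCons .
  moreover have "1 - cnj g * g \<noteq> 0"
  proof
    assume "1 - cnj g * g = 0"
    then have "cmod (g * cnj g) = 1" by (simp add: mult.commute)
    then show False using assms(2) by (simp add: norm_mult) (metis abs_norm_cancel abs_square_less_1 less_irrefl power2_eq_square)
  qed
  ultimately show "circle_ip M p (monom 1 j) = 0" by simp
qed

text \<open>Pythagoras for z p = \<open>p'\<close> + \<open>cnj g\<close> times the reversal of p: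
  the reversal has degree at most n, so it is orthogonal to \<open>p'\<close>, and both z p and the
  reversal have the norm of p.\<close>

lemma norm_step:
  fixes g :: complex
  assumes "degree p \<le> n"
  defines "p' \<equiv> pCons 0 p - smult (cnj g) (star_poly n p)"
  assumes "circle_orth M p' (Suc n)"
  shows "circle_ip M p' p' = (1 - (cmod g)\<^sup>2) * circle_ip M p p"
proof -
  have z: "pCons 0 p = p' + smult (cnj g) (star_poly n p)" by (simp add: p'_def)
  have o: "circle_ip M p' (star_poly n p) = 0"
    by (rule orth_lower[OF assms(3)]) (use degree_star_poly_le[of n p] in simp)
  have o': "circle_ip M (star_poly n p) p' = 0" using ip_cnj[of p' "star_poly n p"] o by simp
  have "circle_ip M p p = circle_ip M (pCons 0 p) (pCons 0 p)" by (simp add: ip_pCons)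
  also have "\<dots> = circle_ip M p' p' + cnj g * g * circle_ip M (star_poly n p) (star_poly n p)"
    unfolding z by (simp add: ip_add_left ip_add_right ip_smult_left ip_smult_right o o')
  also have "circle_ip M (star_poly n p) (star_poly n p) = circle_ip M p p" by (rule ip_star[OF assms(1) assms(1)])
  also have "cnj g * g = (cmod g)\<^sup>2" by (simp add: complex_norm_square mult.commute del: of_real_power)
  finally show ?thesis by (simp add: algebra_simps)
qed

text \<open>This serves the Bernstein--Szego measure of index n, for which a direct computation
  yields orthogonality of \<open>szego \<gamma> n\<close> alone.\<close>

lemma szego_orth_downward:
  assumes "\<And>k. cmod (\<gamma> k) < 1" "circle_orth M (szego \<gamma> n) n" "k \<le> n"
  shows "circle_orth M (szego \<gamma> k) k"
  using assms(3,2)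
proof (induction rule: inc_induct)
  case base
  then show ?case .
next
  case (step m)
  from step.IH[OF step.prems] show ?case
    using orth_step_down[of "szego \<gamma> m" m "\<gamma> m"] assms(1) by (simp add: degree_szego)
qed

lemma szego_norm:
  assumes "\<And>k. k \<le> n \<Longrightarrow> circle_orth M (szego \<gamma> k) k"
  shows "circle_ip M (szego \<gamma> n) (szego \<gamma> n) = (\<Prod>i<n. 1 - (cmod (\<gamma> i))\<^sup>2) * circle_ip M 1 1"
  using assms
proof (induction n)
  case (Suc n)
  have "circle_ip M (szego \<gamma> (Suc n)) (szego \<gamma> (Suc n)) =
    (1 - (cmod (\<gamma> n))\<^sup>2) * circle_ip M (szego \<gamma> n) (szego \<gamma> n)"
    using norm_step[of "szego \<gamma> n" n "\<gamma> n"] Suc.prems[of "Suc n"] by (simp add: degree_szego)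
  then show ?case using Suc by (simp add: mult.commute mult.left_commute)
qed simp

lemma ip_monom:
  "b \<le> a \<Longrightarrow> circle_ip M (monom 1 a) (monom 1 b) = circle_ip M (monom 1 (a - b)) 1"
proof (induction b arbitrary: a)
  case 0
  then show ?case by (simp add: one_pCons monom_0)
next
  case (Suc b)
  then obtain a' where a: "a = Suc a'" by (cases a) auto
  show ?case unfolding a monom_Suc_pCons ip_pCons using Suc a by simp
qed

end

text \<open>Expanding q in the polynomials \<open>szego \<gamma> k\<close>, only the constant one
  has a nonzero integral against either measure, so the integrals of q differ by the ratio c of the
  total masses.\<close>

lemma moments_proportional:
  assumes "measure_on_circle M" "measure_on_circle M'"
    and "circle_ip M 1 1 = c * circle_ip M' 1 1"
    and "\<And>k. k \<le> n \<Longrightarrow> circle_orth M (szego \<gamma> k) k"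
    and "\<And>k. k \<le> n \<Longrightarrow> circle_orth M' (szego \<gamma> k) k"
    and "degree q \<le> n"
  shows "circle_ip M q 1 = c * circle_ip M' q 1"
  using assms(6)
proof (induction "degree q" arbitrary: q rule: less_induct)
  case less
  interpret M: measure_on_circle M by fact
  interpret M': measure_on_circle M' by fact
  show ?case
  proof (cases "degree q = 0")
    case True
    then obtain a where q: "q = smult a 1" by (metis degree_eq_zeroE smult_one)
    show ?thesis unfolding q M.ip_smult_left M'.ip_smult_left using assms(3) by simp
  next
    case False
    define k where "k = degree q"
    define a where "a = lead_coeff q"
    define r where "r = q - smult a (szego \<gamma> k)"
    have "coeff r k = 0" using degree_szego[of \<gamma> k] lead_coeff_szego[of \<gamma> k]
      by (simp add: r_def a_def k_def)
    moreover have "degree r \<le> k" unfolding r_def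
      by (intro degree_diff_le order.trans[OF degree_smult_le]) (auto simp: k_def degree_szego)
    ultimately have dr: "degree r < k" using False k_def
      by (metis degree_0 eq_zero_or_degree_less gr0I)
    have IH: "circle_ip M r 1 = c * circle_ip M' r 1"
      using less.hyps[of r] dr less.prems k_def by simp
    have k: "k \<le> n" "0 < k" using less.prems False k_def by auto
    have "circle_ip M (szego \<gamma> k) 1 = 0" "circle_ip M' (szego \<gamma> k) 1 = 0"
      using assms(4,5)[OF k(1)] k(2) by (auto simp: circle_orth_def one_pCons monom_0 dest!: spec[of _ 0])
    moreover have "q = r + smult a (szego \<gamma> k)" by (simp add: r_def)
    ultimately show ?thesis using IH
      by (simp add: M.ip_add_left M'.ip_add_left M.ip_smult_left M'.ip_smult_left)
  qed
qed

text \<open>The case a < b follows from the case b <= a by conjugation, which a real factor c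
  survives.\<close>

lemma moments_proportional':
  assumes "measure_on_circle M" "measure_on_circle M'"
    and "circle_ip M 1 1 = c * circle_ip M' 1 1" "c \<in> \<real>"
    and "\<And>k. k \<le> n \<Longrightarrow> circle_orth M (szego \<gamma> k) k"
    and "\<And>k. k \<le> n \<Longrightarrow> circle_orth M' (szego \<gamma> k) k"
    and "a \<le> n" "b \<le> n"
  shows "circle_ip M (monom 1 a) (monom 1 b) = c * circle_ip M' (monom 1 a) (monom 1 b)"
proof -
  interpret M: measure_on_circle M by fact
  interpret M': measure_on_circle M' by fact
  have *: "circle_ip M (monom 1 a) (monom 1 b) = c * circle_ip M' (monom 1 a) (monom 1 b)"
    if "b \<le> a" "a \<le> n" for a b
    unfolding M.ip_monom[OF that(1)] M'.ip_monom[OF that(1)]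
    by (rule moments_proportional[OF assms(1-3,5,6)])
       (use that in \<open>auto intro!: order.trans[OF degree_monom_le]\<close>)
  show ?thesis
  proof (cases "b \<le> a")
    case False
    then have "cnj (circle_ip M (monom 1 b) (monom 1 a)) = cnj (c * circle_ip M' (monom 1 b) (monom 1 a))"
      using *[of a b] assms(8) by simp
    then show ?thesis using assms(4) by (simp add: M.ip_cnj M'.ip_cnj Reals_cnj_iff)
  qed (use * assms in auto)
qed

section \<open>Bernstein--Szego approximation\<close>

lemma measurable_cis[measurable]: "cis \<in> borel_measurable borel"
  by (intro borel_measurable_continuous_onI continuous_intros)

lemma prob_space_circle_measure: "prob_space circle_measure"
proof -
  interpret U: prob_space "uniform_measure lborel {0..<2*pi}"
    by (rule prob_space_uniform_measure) auto
  show ?thesis unfolding circle_measure_def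
    by (rule U.prob_space_distr) measurable
qed

interpretation circ: prob_space circle_measure by (rule prob_space_circle_measure)

lemma sets_circle_measure[simp, measurable_cong]: "sets circle_measure = sets borel"
  by (simp add: circle_measure_def)

lemma space_circle_measure[simp]: "space circle_measure = UNIV"
  by (simp add: circle_measure_def)

interpretation circ: measure_on_circle circle_measure
proof
  have "emeasure circle_measure (- sphere 0 1) =
    emeasure (uniform_measure lborel {0..<2*pi}) (cis -` (- sphere 0 1) \<inter> space (uniform_measure lborel {0..<2*pi}))"
    unfolding circle_measure_def by (rule emeasure_distr) auto
  also have "cis -` (- sphere 0 1) = {}" by auto
  finally show "emeasure circle_measure (- sphere 0 1) = 0" by simp
qed simp

lemma integral_circle_measure:
  fixes f :: "complex \<Rightarrow> 'b::{banach, second_countable_topology}"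
  assumes [measurable]: "f \<in> borel_measurable borel"
  shows "(LINT z|circle_measure. f z) =
    (LINT t|lborel. indicator {0..2*pi} t *\<^sub>R f (cis t)) /\<^sub>R (2*pi)"
proof -
  have d: "uniform_measure lborel {0..<2*pi} = density lborel (\<lambda>t. ennreal (indicator {0..<2*pi} t / (2*pi)))"
    unfolding uniform_measure_def
    by (intro arg_cong2[where f=density] ext refl) (auto simp: indicator_def divide_ennreal[symmetric] simp flip: ennreal_1)
  have "(LINT z|circle_measure. f z) = (LINT t|uniform_measure lborel {0..<2*pi}. f (cis t))"
    unfolding circle_measure_def by (rule integral_distr) auto
  also have "\<dots> = (LINT t|lborel. (indicator {0..<2*pi} t / (2*pi)) *\<^sub>R f (cis t))"
    unfolding d by (rule integral_density) auto
  also have "\<dots> = (LINT t|lborel. inverse (2*pi) *\<^sub>R (indicator {0..2*pi} t *\<^sub>R f (cis t)))"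
  proof (rule integral_cong_AE)
    have "AE t in lborel. t \<noteq> 2*pi" by (rule AE_lborel_singleton)
    then show "AE t in lborel. (indicator {0..<2*pi} t / (2*pi)) *\<^sub>R f (cis t) =
      inverse (2*pi) *\<^sub>R (indicator {0..2*pi} t *\<^sub>R f (cis t))"
      by eventually_elim (auto simp: indicator_def inverse_eq_divide)
  qed measurable
  finally show ?thesis unfolding integral_scaleR_right .
qed

lemma integral_circle_derivative:
  assumes "g \<in> borel_measurable borel"
    and "\<And>t. ((\<lambda>t. h (cis t)) has_vector_derivative g (cis t)) (at t)"
    and "continuous_on UNIV (\<lambda>t. g (cis t))"
  shows "(LINT z|circle_measure. g z) = (0::complex)"
proof -
  have "(LINT t|lborel. indicator {0..2*pi} t *\<^sub>R g (cis t)) = h (cis (2*pi)) - h (cis 0)"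
    by (rule integral_FTC_Icc)
       (use assms in \<open>auto intro: has_vector_derivative_at_within continuous_on_subset\<close>)
  then show ?thesis using assms(1) by (simp add: integral_circle_measure)
qed

text \<open>In Cauchy's formula at the centre, du / u is \<i> dt.\<close>

lemma integral_circle_holomorphic:
  assumes "f holomorphic_on cball 0 1" "f \<in> borel_measurable borel"
  shows "(LINT z|circle_measure. f z) = f 0"
proof -
  have c: "continuous_on (sphere 0 1) f"
    using holomorphic_on_imp_continuous_on[OF assms(1)] by (rule continuous_on_subset) auto
  have ct: "continuous_on {0..2*pi} (\<lambda>t. f (cis t))"
    by (rule continuous_on_compose2[OF c]) (auto intro!: continuous_intros)
  have "((\<lambda>u. f u / (u - 0)) has_contour_integral 2 * of_real pi * \<i> * f 0) (circlepath 0 1)"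
    by (rule Cauchy_integral_circlepath_simple) (use assms in auto)
  then have "((\<lambda>t. f (cis t) / cis t * \<i> * cis t) has_integral 2 * of_real pi * \<i> * f 0) {0..2*pi}"
    unfolding circlepath_def by (subst (asm) has_contour_integral_part_circlepath_iff) auto
  then have "((\<lambda>t. \<i> * f (cis t)) has_integral \<i> * (2 * of_real pi * f 0)) {0..2*pi}"
    by (simp add: mult.commute mult.left_commute)
  from has_integral_mult_right[OF this, of "-\<i>"]
  have "((\<lambda>t. f (cis t)) has_integral (2 * of_real pi * f 0)) {0..2*pi}"
    by (simp add: mult.assoc[symmetric])
  then have "integral {0..2*pi} (\<lambda>t. f (cis t)) = 2 * of_real pi * f 0" by (rule integral_unique)
  moreover have "(LINT t:{0..2*pi}|lborel. f (cis t)) = integral {0..2*pi} (\<lambda>t. f (cis t))"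
    by (rule set_borel_integral_eq_integral(2)[OF borel_integrable_atLeastAtMost'[OF ct]])
  ultimately show ?thesis
    by (simp add: integral_circle_measure[OF assms(2)] set_lebesgue_integral_def scaleR_conv_of_real)
qed

lemma measure_on_circle_densityI:
  assumes w[measurable]: "w \<in> borel_measurable borel" and i: "integrable circle_measure w"
    and pos: "\<And>z. 0 \<le> (w z :: real)"
  shows "measure_on_circle (density circle_measure w)"
proof -
  have "finite_measure (density circle_measure w)"
  proof
    show "emeasure (density circle_measure w) (space (density circle_measure w)) \<noteq> \<infinity>"
      using i pos by (simp add: emeasure_density nn_integral_eq_integral)
  qed
  moreover have "emeasure (density circle_measure w) (- sphere 0 1) = 0"
  proof -
    have "absolutely_continuous circle_measure (density circle_measure w)"
      by (rule absolutely_continuousI_density) simp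
    moreover have "- sphere 0 1 \<in> null_sets circle_measure"
      using circ.null_off_circle by (auto simp: null_sets_def)
    ultimately show ?thesis unfolding absolutely_continuous_def by auto
  qed
  ultimately show ?thesis by (simp add: measure_on_circle_def measure_on_circle_axioms_def)
qed

text \<open>The squared norm of the monic polynomial of index n, see
  \<open>szego_norm_sigma\<close>.\<close>

definition szego_energy :: "(nat \<Rightarrow> complex) \<Rightarrow> nat \<Rightarrow> real" where
  "szego_energy \<gamma> n = (\<Prod>i<n. 1 - (cmod (\<gamma> i))\<^sup>2)"

text \<open>The Bernstein--Szego density before normalisation. The reversed polynomial is used
  because its zeros lie outside the closed disc; on the circle it has the modulus of
  \<open>szego \<gamma> n\<close>.\<close>

definition szego_density :: "(nat \<Rightarrow> complex) \<Rightarrow> nat \<Rightarrow> complex \<Rightarrow> real" where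
  "szego_density \<gamma> n z = 1 / (cmod (poly (szego_star \<gamma> n) z))\<^sup>2"

lemma szego_density_borel[measurable]: "szego_density \<gamma> n \<in> borel_measurable borel"
  unfolding szego_density_def by measurable

context
  fixes \<gamma> :: "nat \<Rightarrow> complex"
  assumes \<gamma>: "\<And>k. cmod (\<gamma> k) < 1"
begin

lemma continuous_szego_density: "continuous_on (sphere 0 1) (szego_density \<gamma> n)"
proof -
  have "poly (szego_star \<gamma> n) z \<noteq> 0" if "z \<in> sphere 0 1" for z
    using szego_star_disc[of \<gamma> z n, OF \<gamma>] that by simp
  then show ?thesis unfolding szego_density_def
    by (intro continuous_on_divide continuous_on_const continuous_on_power continuous_on_norm
      continuous_on_poly continuous_on_id ballI) simp
qed

lemma measure_on_circle_density: "measure_on_circle (density circle_measure (szego_density \<gamma> n))"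
proof (rule measure_on_circle_densityI)
  show "integrable circle_measure (szego_density \<gamma> n)"
    by (rule circ.integrable_continuous[OF szego_density_borel continuous_szego_density])
  show "0 \<le> szego_density \<gamma> n z" for z by (simp add: szego_density_def)
qed (rule szego_density_borel)

lemma circle_ip_density:
  "circle_ip (density circle_measure (szego_density \<gamma> n)) p q =
    (LINT z|circle_measure. szego_density \<gamma> n z *\<^sub>R (poly p z * cnj (poly q z)))"
  unfolding circle_ip_def
proof (rule integral_density)
  show "AE z in circle_measure. 0 \<le> szego_density \<gamma> n z" by (simp add: szego_density_def)
qed measurable

text \<open>On the circle the integrand is z^(n-j) divided by the reversed polynomial. This quotient
  is holomorphic on the closed disc, and it vanishes at 0 because j < n.\<close>

lemma szego_orth_density:
  "circle_orth (density circle_measure (szego_density \<gamma> n)) (szego \<gamma> n) n"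
  unfolding circle_orth_def circle_ip_density
proof (intro allI impI)
  fix j assume j: "j < n"
  have "(LINT z|circle_measure. szego_density \<gamma> n z *\<^sub>R (poly (szego \<gamma> n) z * cnj (poly (monom 1 j) z)))
      = (LINT z|circle_measure. z ^ (n - j) / poly (szego_star \<gamma> n) z)"
  proof (rule circ.integral_circle_cong)
    fix z :: complex assume z: "cmod z = 1"
    define a where "a = poly (szego \<gamma> n) z"
    have s: "poly (szego_star \<gamma> n) z = z ^ n * cnj a"
      using poly_star_poly_circle[of "szego \<gamma> n" n z] z by (simp add: szego_star_def a_def degree_szego)
    have a0: "a \<noteq> 0" using s szego_star_disc[of \<gamma> z n, OF \<gamma>] z by auto
    have z0: "z \<noteq> 0" using z by auto
    have zz: "z ^ j * cnj z ^ j = 1" using z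
      by (metis complex_norm_square mult_1 of_real_1 power_mult_distrib power_one power2_eq_square)
    have "szego_density \<gamma> n z = 1 / (cmod a)\<^sup>2"
      using z by (simp add: szego_density_def s norm_mult norm_power)
    then have "szego_density \<gamma> n z *\<^sub>R (a * cnj z ^ j) = (a * cnj z ^ j) / (a * cnj a)"
      by (simp add: scaleR_conv_of_real complex_norm_square[symmetric])
    also have "\<dots> = cnj z ^ j / cnj a" using a0 by simp
    also have "\<dots> = z ^ (n - j) / (z ^ n * cnj a)"
      using z0 a0 zz j by (simp add: field_simps power_diff)
    finally show "szego_density \<gamma> n z *\<^sub>R (poly (szego \<gamma> n) z * cnj (poly (monom 1 j) z)) =
       z ^ (n - j) / poly (szego_star \<gamma> n) z"
      by (simp add: a_def[symmetric] s poly_monom)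
  qed measurable
  also have "\<dots> = 0 ^ (n - j) / poly (szego_star \<gamma> n) 0"
  proof (rule integral_circle_holomorphic)
    have "poly (szego_star \<gamma> n) z \<noteq> 0" if "z \<in> cball 0 1" for z
      using szego_star_disc[of \<gamma> z n, OF \<gamma>] that by simp
    then show "(\<lambda>z. z ^ (n - j) / poly (szego_star \<gamma> n) z) holomorphic_on cball 0 1"
      by (intro holomorphic_intros) simp
  qed measurable
  also have "\<dots> = 0" using j by simp
  finally show "(LINT z|circle_measure. szego_density \<gamma> n z *\<^sub>R (poly (szego \<gamma> n) z * cnj (poly (monom 1 j) z))) = 0" .
qed

lemma szego_norm_density:
  "circle_ip (density circle_measure (szego_density \<gamma> n)) (szego \<gamma> n) (szego \<gamma> n) = 1"
proof -
  have "circle_ip (density circle_measure (szego_density \<gamma> n)) (szego \<gamma> n) (szego \<gamma> n) =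
    (LINT z|circle_measure. 1)"
    unfolding circle_ip_density
  proof (rule circ.integral_circle_cong)
    fix z :: complex assume z: "cmod z = 1"
    have n: "cmod (poly (szego_star \<gamma> n) z) = cmod (poly (szego \<gamma> n) z)"
      unfolding szego_star_def by (rule norm_poly_star_poly_circle) (auto simp: degree_szego z)
    then have "poly (szego \<gamma> n) z \<noteq> 0" using szego_star_disc[of \<gamma> z n, OF \<gamma>] z by auto
    then show "szego_density \<gamma> n z *\<^sub>R (poly (szego \<gamma> n) z * cnj (poly (szego \<gamma> n) z)) = 1"
      unfolding szego_density_def n
      by (simp add: scaleR_conv_of_real complex_norm_square[symmetric])
  qed measurable
  then show ?thesis using circ.prob_space by simp
qed

lemma szego_energy_pos: "szego_energy \<gamma> n > 0"
  unfolding szego_energy_def using \<gamma> by (intro prod_pos) (auto simp: abs_square_less_1)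

lemma szego_energy_antimono: "decseq (szego_energy \<gamma>)"
  unfolding decseq_Suc_iff szego_energy_def
  using szego_energy_pos by (auto simp: szego_energy_def mult_le_cancel_left1)

text \<open>The norm of \<open>szego \<gamma> n\<close> under this density is 1 pointwise by
  construction, and by the product formula it is the energy times the total mass.\<close>

lemma integral_szego_density: "szego_energy \<gamma> n * (LINT z|circle_measure. szego_density \<gamma> n z) = 1"
proof -
  interpret measure_on_circle "density circle_measure (szego_density \<gamma> n)"
    by (rule measure_on_circle_density)
  have "1 = szego_energy \<gamma> n * circle_ip (density circle_measure (szego_density \<gamma> n)) 1 1"
    using szego_norm[of n \<gamma>] szego_orth_downward[of \<gamma>, OF \<gamma> szego_orth_density]
    by (simp add: szego_norm_density szego_energy_def)
  also have "\<dots> = of_real (szego_energy \<gamma> n * (LINT z|circle_measure. szego_density \<gamma> n z))"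
    unfolding circle_ip_density by (simp add: scaleR_conv_of_real)
  finally show ?thesis by (metis of_real_eq_1_iff)
qed

text \<open>Both measures make \<open>szego \<gamma> 0\<close>, ..., \<open>szego \<gamma> n\<close>
  orthogonal; the energy is the factor that equalises their masses.\<close>

lemma bernstein_szego:
  assumes "measure_on_circle M" "measure M (space M) = 1"
    and "\<And>k. circle_orth M (szego \<gamma> k) k" "a \<le> n" "b \<le> n"
  shows "(LINT z|M. z ^ a * cnj z ^ b) =
    (LINT z|circle_measure. (szego_energy \<gamma> n * szego_density \<gamma> n z) *\<^sub>R (z ^ a * cnj z ^ b))"
proof -
  interpret M: measure_on_circle M by fact
  let ?D = "density circle_measure (szego_density \<gamma> n)"
  have m: "circle_ip M 1 1 = 1" using assms(2) by (simp add: circle_ip_def)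
  have "circle_ip ?D 1 1 = of_real (LINT z|circle_measure. szego_density \<gamma> n z)"
    unfolding circle_ip_density by (simp add: scaleR_conv_of_real)
  then have c: "circle_ip M 1 1 = of_real (szego_energy \<gamma> n) * circle_ip ?D 1 1"
    unfolding m by (metis integral_szego_density of_real_1 of_real_mult)
  interpret D: measure_on_circle ?D by (rule measure_on_circle_density)
  have "circle_ip M (monom 1 a) (monom 1 b) = of_real (szego_energy \<gamma> n) * circle_ip ?D (monom 1 a) (monom 1 b)"
    by (rule moments_proportional'[OF assms(1) measure_on_circle_density c _ assms(3)
      D.szego_orth_downward[of \<gamma>, OF \<gamma> szego_orth_density]]) (use assms in auto)
  then show ?thesis unfolding circle_ip_density
    by (simp add: circle_ip_def poly_monom scaleR_conv_of_real mult.assoc)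
qed

end

section \<open>The orthogonal polynomials of \<sigma> expressed by its recurrence
  coefficients\<close>

locale circle_prob_infinite =
  fixes \<sigma> :: "complex measure"
  assumes inf: "circle_prob_infinite_support \<sigma>"
begin

sublocale prob_space \<sigma> using inf by (simp add: circle_prob_infinite_support_def)

sublocale measure_on_circle \<sigma>
  using inf by unfold_locales (auto simp: circle_prob_infinite_support_def)

lemma ip_self: "circle_ip \<sigma> p p = of_real (LINT z|\<sigma>. (cmod (poly p z))\<^sup>2)"
  unfolding circle_ip_def complex_norm_square[symmetric] by (simp del: of_real_power)

text \<open>If the integral vanished, \<sigma> would live on the finitely many roots of p, against
  the infinite support.\<close>

lemma ip_self_pos:
  assumes "p \<noteq> 0"
  shows "0 < (LINT z|\<sigma>. (cmod (poly p z))\<^sup>2)"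
proof (rule ccontr)
  assume "\<not> ?thesis"
  moreover have "0 \<le> (LINT z|\<sigma>. (cmod (poly p z))\<^sup>2)" by simp
  ultimately have "(LINT z|\<sigma>. (cmod (poly p z))\<^sup>2) = 0" by linarith
  moreover have "integrable \<sigma> (\<lambda>z. (cmod (poly p z))\<^sup>2)" by (intro integrable_cont_UNIV continuous_on_power continuous_on_norm continuous_on_poly continuous_on_id)
  ultimately have ae: "AE z in \<sigma>. poly p z = 0" by (subst (asm) integral_nonneg_eq_0_iff_AE) auto
  define Z where "Z = {z. poly p z = 0}"
  have finZ: "finite Z" unfolding Z_def by (rule poly_roots_finite[OF assms])
  have op: "open (- Z)" using finite_imp_closed[OF finZ] by blast
  have "emeasure \<sigma> (- Z) = 0" using ae op
    by (subst (asm) AE_iff_measurable[of "-Z"]) (auto simp: Z_def)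
  then have "measure_support \<sigma> \<subseteq> Z" using op unfolding measure_support_def by fastforce
  then show False using finite_subset[OF _ finZ] inf by (auto simp: circle_prob_infinite_support_def)
qed

lemma integral_powi:
  "(LINT z|\<sigma>. poly p z * z powi (- int j)) = circle_ip \<sigma> p (monom 1 j)"
  unfolding circle_ip_def
proof (rule integral_circle_cong)
  fix z :: complex assume z: "cmod z = 1"
  have "z * cnj z = 1" using z by (simp add: complex_norm_square[symmetric])
  then have "inverse z = cnj z" by (metis inverse_unique)
  then show "poly p z * z powi (- int j) = poly p z * cnj (poly (monom 1 j) z)"
    by (simp add: power_int_minus poly_monom power_inverse[symmetric])
qed (simp_all add: power_int_minus)

lemma orth_iff: "(\<forall>j<n. (LINT z|\<sigma>. poly p z * z powi (- int j)) = 0) \<longleftrightarrow> circle_orth \<sigma> p n"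
  by (simp add: integral_powi circle_orth_def)

lemma monic_orth_unique:
  assumes "degree p = n" "lead_coeff p = 1" "circle_orth \<sigma> p n"
    and "degree q = n" "lead_coeff q = 1" "circle_orth \<sigma> q n"
  shows "p = q"
proof (rule ccontr)
  assume "p \<noteq> q"
  then have n: "p - q \<noteq> 0" by simp
  have "coeff (p - q) n = 0" using assms by simp
  moreover have "degree (p - q) \<le> n" using assms by (intro degree_diff_le) auto
  ultimately have d: "degree (p - q) < n" using n
    by (metis leading_coeff_0_iff order_le_imp_less_or_eq)
  have "circle_ip \<sigma> (p - q) (p - q) = 0"
    using orth_lower[OF assms(3) d] orth_lower[OF assms(6) d] by (simp add: ip_diff_left)
  then show False using ip_self_pos[OF n] by (simp add: ip_self)
qed

lemma monic_OP_eqI: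
  assumes "degree p = n" "lead_coeff p = 1" "circle_orth \<sigma> p n"
  shows "monic_OP \<sigma> n = p"
  unfolding monic_OP_def orth_iff by (rule the_equality) (use assms monic_orth_unique in auto)

abbreviation "\<gamma> \<equiv> recurrence_coeff \<sigma>"

text \<open>As \<open>recurrence_coeff\<close> is a definite description, existence and uniqueness
  of the coefficient are settled inside the induction: the g that makes the next polynomial
  orthogonal to 1 satisfies the recurrence, and no other does because the reversed polynomial is
  nonzero.\<close>

lemma szego_orth: "circle_orth \<sigma> (szego \<gamma> n) n"
proof (induction n)
  case 0
  show ?case by (simp add: circle_orth_def)
next
  case (Suc n)
  define P where "P = szego \<gamma> n"
  have d: "degree P = n" and l: "lead_coeff P = 1" and o: "circle_orth \<sigma> P n"
    using Suc by (auto simp: P_def degree_szego coeff_szego)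
  have P0: "P \<noteq> 0" using l by auto
  \<comment> \<open>Modulo lower degrees \<open>P\<close> is z^n, the reversal of 1; so the
    denominator of \<open>g\<close> below is the squared norm of \<open>P\<close> and cannot
    vanish.\<close>
  have s: "circle_ip \<sigma> (star_poly n P) 1 = circle_ip \<sigma> P P"
  proof -
    have "star_poly n (monom 1 n) = (1 :: complex poly)"
      by (rule poly_eqI) (auto simp: coeff_star_poly)
    then have "circle_ip \<sigma> (star_poly n P) 1 = circle_ip \<sigma> (monom 1 n) P"
      using ip_star[of P n "monom 1 n"] d degree_monom_le[of "1::complex" n] by simp
    also have "\<dots> = cnj (circle_ip \<sigma> P (monom 1 n))" by (simp add: ip_cnj)
    also have "circle_ip \<sigma> P (monom 1 n) = circle_ip \<sigma> P P"
    proof (cases "n = 0")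
      case True
      then have "P = monom 1 n" using d l by (metis P_def monom_eq_1 szego.simps(1))
      then show ?thesis by simp
    next
      case False
      have "coeff (P - monom 1 n) n = 0" using d l by simp
      moreover have "degree (P - monom 1 n) \<le> n" using d
        by (intro degree_diff_le degree_monom_le) auto
      ultimately have "degree (P - monom 1 n) < n" using False
        by (metis degree_0 gr0I leading_coeff_0_iff order_le_imp_less_or_eq)
      from orth_lower[OF o this] show ?thesis by (simp add: ip_diff_right)
    qed
    finally show ?thesis by (simp add: ip_cnj)
  qed
  have s0: "circle_ip \<sigma> (star_poly n P) 1 \<noteq> 0" unfolding s ip_self using ip_self_pos[OF P0] by simp
  define g where "g = cnj (circle_ip \<sigma> (pCons 0 P) 1 / circle_ip \<sigma> (star_poly n P) 1)"
  define P' where "P' = pCons 0 P - smult (cnj g) (star_poly n P)"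
  have o': "circle_orth \<sigma> P' (Suc n)" unfolding P'_def
    by (rule orth_step_up) (use d o s0 in \<open>auto simp: g_def ip_diff_left ip_smult_left\<close>)
  have 1: "monic_OP \<sigma> (Suc n) = P'"
    using degree_lead_step[OF d l] o' unfolding P'_def by (intro monic_OP_eqI) auto
  have 2: "monic_OP \<sigma> n = P" using d l o by (intro monic_OP_eqI) auto
  have nz: "star_poly n P \<noteq> 0"
    using szego_star_nonzero[of \<gamma> n] by (simp add: szego_star_def P_def)
  have "\<gamma> n = g" unfolding recurrence_coeff_def 1 2
  proof (rule the_equality)
    fix h assume "P' = pCons 0 P - smult (cnj h) (star_poly n P)"
    then have "smult (cnj g - cnj h) (star_poly n P) = 0" by (simp add: P'_def smult_diff_left)
    then have "cnj g = cnj h" using nz by simp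
    then show "h = g" by simp
  qed (simp add: P'_def)
  then have "szego \<gamma> (Suc n) = P'" by (simp add: P'_def P_def)
  then show ?case using o' by simp
qed

lemma monic_OP_szego: "monic_OP \<sigma> n = szego \<gamma> n"
  by (rule monic_OP_eqI) (simp_all add: degree_szego coeff_szego szego_orth)

lemma szego_norm_sigma: "(LINT z|\<sigma>. (cmod (poly (szego \<gamma> n) z))\<^sup>2) = szego_energy \<gamma> n"
proof -
  have "complex_of_real (LINT z|\<sigma>. (cmod (poly (szego \<gamma> n) z))\<^sup>2) = of_real (szego_energy \<gamma> n) * circle_ip \<sigma> 1 1"
    unfolding ip_self[symmetric] using szego_norm[of n \<gamma>] szego_orth by (simp add: szego_energy_def)
  also have "circle_ip \<sigma> 1 1 = 1" using prob_space by (simp add: circle_ip_def)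
  finally show ?thesis by (metis mult.right_neutral of_real_eq_iff)
qed

lemma orthonormal_OP_szego:
  "orthonormal_OP \<sigma> n = smult (1 / sqrt (szego_energy \<gamma> n)) (szego \<gamma> n)"
  unfolding orthonormal_OP_def orth_iff
proof (rule the_equality)
  define E where "E = szego_energy \<gamma> n"
  have "szego \<gamma> n \<noteq> 0" using lead_coeff_szego[of \<gamma> n] by auto
  \<comment> \<open>Positivity is read off from the norm of a nonzero polynomial, since |\<gamma>| <
    1 is not an assumption of this locale.\<close>
  then have E: "E > 0" using ip_self_pos[of "szego \<gamma> n"] by (simp add: szego_norm_sigma E_def)
  have o: "circle_orth \<sigma> (smult c (szego \<gamma> n)) n" for c
    using szego_orth[of n] by (simp add: circle_orth_def ip_smult_left)
  have nrm: "(LINT z|\<sigma>. (cmod (poly (smult c (szego \<gamma> n)) z))\<^sup>2) = (cmod c)\<^sup>2 * E" for c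
    by (simp add: norm_mult power_mult_distrib szego_norm_sigma E_def)
  let ?c = "complex_of_real (1 / sqrt E)"
  have "Re (lead_coeff (smult ?c (szego \<gamma> n))) > 0" "lead_coeff (smult ?c (szego \<gamma> n)) \<in> \<real>"
    using E lead_coeff_szego[of \<gamma> n] by (auto simp del: of_real_divide)
  moreover have "(cmod ?c)\<^sup>2 * E = 1" using E by (simp add: norm_divide power_divide)
  ultimately show "degree (smult (1 / sqrt (szego_energy \<gamma> n)) (szego \<gamma> n)) = n \<and>
    lead_coeff (smult (1 / sqrt (szego_energy \<gamma> n)) (szego \<gamma> n)) \<in> \<real> \<and>
    0 < Re (lead_coeff (smult (1 / sqrt (szego_energy \<gamma> n)) (szego \<gamma> n))) \<and>
    circle_orth \<sigma> (smult (1 / sqrt (szego_energy \<gamma> n)) (szego \<gamma> n)) n \<and>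
    (LINT z|\<sigma>. (cmod (poly (smult (1 / sqrt (szego_energy \<gamma> n)) (szego \<gamma> n)) z))\<^sup>2) = 1"
    unfolding E_def[symmetric] using E o nrm[of ?c] by (simp add: degree_szego)
  fix p
  assume p: "degree p = n \<and> lead_coeff p \<in> \<real> \<and> 0 < Re (lead_coeff p) \<and> circle_orth \<sigma> p n \<and>
    (LINT z|\<sigma>. (cmod (poly p z))\<^sup>2) = 1"
  define a where "a = lead_coeff p"
  have a: "a \<in> \<real>" "Re a > 0" using p a_def by auto
  then have a0: "a \<noteq> 0" by auto
  have "monic_OP \<sigma> n = smult (1 / a) p"
    by (rule monic_OP_eqI) (use p a0 in \<open>auto simp: a_def circle_orth_def ip_smult_left\<close>)
  then have pe: "p = smult a (szego \<gamma> n)" using a0 by (simp add: monic_OP_szego[symmetric])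
  have ar: "a = of_real (Re a)" using a(1) by (simp add: complex_is_Real_iff complex_eq_iff)
  have "(cmod a)\<^sup>2 * E = 1" using nrm[of a] pe p by simp
  moreover have "cmod a = Re a" using a(2) ar by (metis abs_of_pos norm_of_real)
  ultimately have "(Re a)\<^sup>2 = (1 / sqrt E)\<^sup>2" using E
    by (simp add: power_divide eq_divide_eq)
  then have "Re a = 1 / sqrt E"
    by (rule power2_eq_imp_eq) (use a(2) E in simp_all)
  then show "p = smult (1 / sqrt (szego_energy \<gamma> n)) (szego \<gamma> n)"
    using pe ar by (simp add: E_def)
qed

lemma star_monic_OP: "star_poly n (monic_OP \<sigma> n) = szego_star \<gamma> n"
  by (simp add: monic_OP_szego szego_star_def)

lemma star_orthonormal_OP:
  "star_poly n (orthonormal_OP \<sigma> n) = smult (1 / sqrt (szego_energy \<gamma> n)) (szego_star \<gamma> n)"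
  by (rule poly_eqI) (simp add: orthonormal_OP_szego szego_star_def coeff_star_poly)

end

section \<open>Logarithmic derivatives and oscillation\<close>

text \<open>Continuity is asked only along the angle, because the derivatives occurring in
  \<open>logder_le\<close> are known only there; \<open>Arg\<close> covers the circle by a compact
  interval.\<close>

lemma integrable_circle:
  fixes f :: "complex \<Rightarrow> 'b::{banach, second_countable_topology}"
  assumes "f \<in> borel_measurable borel" "continuous_on UNIV (\<lambda>t. f (cis t))"
  shows "integrable circle_measure f"
proof -
  have "compact ((\<lambda>t. f (cis t)) ` {-pi..pi})"
    by (intro compact_continuous_image continuous_on_subset[OF assms(2)]) auto
  then obtain B where B: "\<And>t. t \<in> {-pi..pi} \<Longrightarrow> norm (f (cis t)) \<le> B"
    using compact_imp_bounded bounded_iff by (metis (no_types, lifting) imageI)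
  have "norm (f z) \<le> B" if "cmod z = 1" for z
  proof -
    have "z \<noteq> 0" using that by auto
    then have "cis (Arg z) = z" using that cis_Arg[of z] by (simp add: sgn_eq)
    then show ?thesis using B[of "Arg z"] Arg_bounded[of z] by simp
  qed
  then have "AE z in circle_measure. norm (f z) \<le> B"
    using circ.AE_circle by (auto elim: eventually_mono)
  then show ?thesis using assms(1) by (intro circ.integrable_const_bound) auto
qed

text \<open>Only the circle matters here: \<open>g\<close> is the derivative of \<open>h\<close> in the angle, read as a function on the plane.\<close>

definition logder_le :: "real \<Rightarrow> (complex \<Rightarrow> complex) \<Rightarrow> bool" where
  "logder_le L h \<longleftrightarrow> h \<in> borel_measurable borel \<and> (\<forall>z. cmod z = 1 \<longrightarrow> h z \<noteq> 0) \<and>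
    (\<exists>g. g \<in> borel_measurable borel \<and> continuous_on UNIV (\<lambda>t. g (cis t)) \<and>
      (\<forall>t. ((\<lambda>t. h (cis t)) has_vector_derivative g (cis t)) (at t)) \<and>
      (\<forall>z. cmod z = 1 \<longrightarrow> cmod (g z) \<le> L * cmod (h z)))"

lemma logder_leI:
  assumes "h \<in> borel_measurable borel" "\<And>z. cmod z = 1 \<Longrightarrow> h z \<noteq> 0"
    "g \<in> borel_measurable borel" "continuous_on UNIV (\<lambda>t. g (cis t))"
    "\<And>t. ((\<lambda>t. h (cis t)) has_vector_derivative g (cis t)) (at t)"
    "\<And>z. cmod z = 1 \<Longrightarrow> cmod (g z) \<le> L * cmod (h z)"
  shows "logder_le L h"
  unfolding logder_le_def using assms by blast

lemma logder_leE:
  assumes "logder_le L h"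
  obtains g where "h \<in> borel_measurable borel" "\<And>z. cmod z = 1 \<Longrightarrow> h z \<noteq> 0"
    "continuous_on UNIV (\<lambda>t. h (cis t))"
    "g \<in> borel_measurable borel" "continuous_on UNIV (\<lambda>t. g (cis t))"
    "\<And>t. ((\<lambda>t. h (cis t)) has_vector_derivative g (cis t)) (at t)"
    "\<And>z. cmod z = 1 \<Longrightarrow> cmod (g z) \<le> L * cmod (h z)"
proof -
  from assms obtain g where g: "g \<in> borel_measurable borel" "continuous_on UNIV (\<lambda>t. g (cis t))"
    "\<And>t. ((\<lambda>t. h (cis t)) has_vector_derivative g (cis t)) (at t)"
    "\<And>z. cmod z = 1 \<Longrightarrow> cmod (g z) \<le> L * cmod (h z)" and h: "h \<in> borel_measurable borel" "\<And>z. cmod z = 1 \<Longrightarrow> h z \<noteq> 0"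
    unfolding logder_le_def by blast
  have "continuous_on UNIV (\<lambda>t. h (cis t))"
    using g(3) by (auto intro!: continuous_at_imp_continuous_on has_vector_derivative_continuous)
  then show ?thesis using that g h by blast
qed

lemma logder_le_borel: "logder_le L h \<Longrightarrow> h \<in> borel_measurable borel"
  by (simp add: logder_le_def)

lemma logder_le_integrable:
  assumes "logder_le L h" shows "integrable circle_measure h"
  by (rule logder_leE[OF assms]) (rule integrable_circle)

lemma logder_le_const: "c \<noteq> 0 \<Longrightarrow> logder_le 0 (\<lambda>z. c)"
  by (rule logder_leI[where g="\<lambda>z. 0"]) auto

text \<open>Required for \<open>F_Suc\<close>, which describes the next polynomial on the circle
  only.\<close>

lemma logder_le_cong:
  assumes "logder_le L h" "k \<in> borel_measurable borel" "\<And>z. cmod z = 1 \<Longrightarrow> k z = h z"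
  shows "logder_le L k"
proof -
  have "(\<lambda>t. k (cis t)) = (\<lambda>t. h (cis t))" using assms(3) by auto
  then show ?thesis using assms unfolding logder_le_def by auto
qed

lemma logder_le_cnj:
  assumes "logder_le L h" shows "logder_le L (\<lambda>z. cnj (h z))"
proof (rule logder_leE[OF assms])
  fix g
  assume h: "h \<in> borel_measurable borel" "\<And>z. cmod z = 1 \<Longrightarrow> h z \<noteq> 0"
    and g: "g \<in> borel_measurable borel" "continuous_on UNIV (\<lambda>t. g (cis t))"
    "\<And>t. ((\<lambda>t. h (cis t)) has_vector_derivative g (cis t)) (at t)"
    "\<And>z. cmod z = 1 \<Longrightarrow> cmod (g z) \<le> L * cmod (h z)"
  note [measurable] = h(1) g(1)
  show ?thesis
    by (rule logder_leI[where g="\<lambda>z. cnj (g z)"])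
       (use h g in \<open>simp_all add: has_vector_derivative_cnj continuous_on_cnj\<close>)
qed

lemma logder_le_mult:
  assumes "logder_le L h" "logder_le K k" shows "logder_le (L + K) (\<lambda>z. h z * k z)"
proof (rule logder_leE[OF assms(1)], rule logder_leE[OF assms(2)])
  fix g l
  assume h: "h \<in> borel_measurable borel" "\<And>z. cmod z = 1 \<Longrightarrow> h z \<noteq> 0" "continuous_on UNIV (\<lambda>t. h (cis t))"
    and g: "g \<in> borel_measurable borel" "continuous_on UNIV (\<lambda>t. g (cis t))"
    "\<And>t. ((\<lambda>t. h (cis t)) has_vector_derivative g (cis t)) (at t)"
    "\<And>z. cmod z = 1 \<Longrightarrow> cmod (g z) \<le> L * cmod (h z)"
    and k: "k \<in> borel_measurable borel" "\<And>z. cmod z = 1 \<Longrightarrow> k z \<noteq> 0" "continuous_on UNIV (\<lambda>t. k (cis t))"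
    and l: "l \<in> borel_measurable borel" "continuous_on UNIV (\<lambda>t. l (cis t))"
    "\<And>t. ((\<lambda>t. k (cis t)) has_vector_derivative l (cis t)) (at t)"
    "\<And>z. cmod z = 1 \<Longrightarrow> cmod (l z) \<le> K * cmod (k z)"
  note [measurable] = h(1) g(1) k(1) l(1)
  show ?thesis
  proof (rule logder_leI[where g="\<lambda>z. h z * l z + g z * k z"])
    show "continuous_on UNIV (\<lambda>t. h (cis t) * l (cis t) + g (cis t) * k (cis t))"
      by (intro continuous_on_add continuous_on_mult h g k l)
    show "((\<lambda>t. h (cis t) * k (cis t)) has_vector_derivative
      h (cis t) * l (cis t) + g (cis t) * k (cis t)) (at t)" for t
      by (rule has_vector_derivative_mult[OF g(3) l(3)])
    fix z :: complex assume z: "cmod z = 1"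
    have "cmod (h z * l z + g z * k z) \<le> cmod (h z) * cmod (l z) + cmod (g z) * cmod (k z)"
      using norm_triangle_ineq[of "h z * l z" "g z * k z"] by (simp add: norm_mult)
    also have "\<dots> \<le> cmod (h z) * (K * cmod (k z)) + (L * cmod (h z)) * cmod (k z)"
      by (intro add_mono mult_left_mono mult_right_mono g l z) auto
    finally show "cmod (h z * l z + g z * k z) \<le> (L + K) * cmod (h z * k z)"
      by (simp add: norm_mult algebra_simps)
  qed (use h k in auto)
qed

text \<open>Since |(1/h)'| / |1/h| = |h'| / |h|, negative powers cost no more than positive
  ones.\<close>

lemma logder_le_inverse:
  assumes "logder_le L h" shows "logder_le L (\<lambda>z. inverse (h z))"
proof (rule logder_leE[OF assms])
  fix g
  assume h: "h \<in> borel_measurable borel" "\<And>z. cmod z = 1 \<Longrightarrow> h z \<noteq> 0" "continuous_on UNIV (\<lambda>t. h (cis t))"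
    and g: "g \<in> borel_measurable borel" "continuous_on UNIV (\<lambda>t. g (cis t))"
    "\<And>t. ((\<lambda>t. h (cis t)) has_vector_derivative g (cis t)) (at t)"
    "\<And>z. cmod z = 1 \<Longrightarrow> cmod (g z) \<le> L * cmod (h z)"
  note [measurable] = h(1) g(1)
  show ?thesis
  proof (rule logder_leI[where g="\<lambda>z. g z * (- (inverse (h z) ^ Suc (Suc 0)))"])
    show "continuous_on UNIV (\<lambda>t. g (cis t) * (- (inverse (h (cis t)) ^ Suc (Suc 0))))"
      by (intro continuous_on_mult continuous_on_minus continuous_on_power continuous_on_inverse h g ballI) simp
    show "((\<lambda>t. inverse (h (cis t))) has_vector_derivative
      g (cis t) * (- (inverse (h (cis t)) ^ Suc (Suc 0)))) (at t)" for t
      using field_vector_diff_chain_at[OF g(3)[of t] DERIV_inverse[of "h (cis t)"]] h(2)[of "cis t"]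
      by (simp add: o_def)
    fix z :: complex assume z: "cmod z = 1"
    then have pos: "cmod (h z) > 0" using h(2) by simp
    have "cmod (g z * (- (inverse (h z) ^ Suc (Suc 0)))) = cmod (g z) * inverse (cmod (h z)) * inverse (cmod (h z))"
      by (simp add: norm_mult norm_inverse norm_power)
    also have "\<dots> \<le> (L * cmod (h z)) * inverse (cmod (h z)) * inverse (cmod (h z))"
      by (intro mult_right_mono g z) auto
    also have "\<dots> = L * cmod (inverse (h z))" using pos by (simp add: norm_inverse)
    finally show "cmod (g z * (- (inverse (h z) ^ Suc (Suc 0)))) \<le> L * cmod (inverse (h z))" .
  qed (use h in auto)
qed

lemma logder_le_power:
  assumes "logder_le L h" shows "logder_le (real n * L) (\<lambda>z. h z ^ n)"
proof (induction n)
  case 0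
  then show ?case using logder_le_const[of 1] by simp
next
  case (Suc n)
  then show ?case using logder_le_mult[OF assms Suc] by (simp add: algebra_simps)
qed

lemma logder_le_power_int:
  assumes "logder_le L h" shows "logder_le (\<bar>real_of_int m\<bar> * L) (\<lambda>z. h z powi m)"
proof (cases "m \<ge> 0")
  case True
  then show ?thesis using logder_le_power[OF assms, of "nat m"] by (simp add: power_int_def)
next
  case False
  then show ?thesis using logder_le_power[OF logder_le_inverse[OF assms], of "nat (-m)"]
    by (simp add: power_int_def)
qed

lemma has_vector_derivative_cis_power:
  "((\<lambda>t. cis t ^ N) has_vector_derivative (\<i> * of_nat N * cis t ^ N)) (at t)"
proof -
  have "((\<lambda>t. cis (real N * t)) has_derivative (\<lambda>s. (real N * s) *\<^sub>R (\<i> * cis (real N * t)))) (at t)"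
    by (rule has_derivative_cis) (auto intro!: derivative_eq_intros)
  moreover have "(\<lambda>t. cis (real N * t)) = (\<lambda>t. cis t ^ N)" by (simp add: Complex.DeMoivre)
  moreover have "(\<lambda>s. (real N * s) *\<^sub>R (\<i> * cis (real N * t))) = (\<lambda>s. s *\<^sub>R (\<i> * of_nat N * cis t ^ N))"
    by (rule ext) (simp add: Complex.DeMoivre scaleR_conv_of_real)
  ultimately show ?thesis unfolding has_vector_derivative_def by simp
qed

text \<open>Integration by parts in the angle.\<close>

lemma oscillation:
  assumes "logder_le L h" "N > 0"
  shows "cmod (LINT z|circle_measure. z ^ N * h z) \<le> L / real N * (LINT z|circle_measure. cmod (h z))"
proof (rule logder_leE[OF assms(1)])
  fix g
  assume h: "h \<in> borel_measurable borel" "continuous_on UNIV (\<lambda>t. h (cis t))"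
    and g: "g \<in> borel_measurable borel" "continuous_on UNIV (\<lambda>t. g (cis t))"
    "\<And>t. ((\<lambda>t. h (cis t)) has_vector_derivative g (cis t)) (at t)"
    "\<And>z. cmod z = 1 \<Longrightarrow> cmod (g z) \<le> L * cmod (h z)"
  note [measurable] = h(1) g(1)
  have cc: "continuous_on UNIV (\<lambda>t. cis t ^ N)"
    by (intro continuous_on_power continuous_on_cis continuous_on_id)
  have i1: "integrable circle_measure (\<lambda>z. z ^ N * h z)"
    and i2: "integrable circle_measure (\<lambda>z. z ^ N * g z)"
    and i3: "integrable circle_measure h" and i4: "integrable circle_measure g"
    by (intro integrable_circle continuous_on_mult cc h g, measurable)+
  have "(LINT z|circle_measure. z ^ N * g z + (\<i> * of_nat N * z ^ N) * h z) = 0"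
  proof (rule integral_circle_derivative[where h="\<lambda>z. z ^ N * h z"])
    show "((\<lambda>t. cis t ^ N * h (cis t)) has_vector_derivative
       cis t ^ N * g (cis t) + \<i> * of_nat N * cis t ^ N * h (cis t)) (at t)" for t
      by (rule has_vector_derivative_mult[OF has_vector_derivative_cis_power g(3)])
    show "continuous_on UNIV (\<lambda>t. cis t ^ N * g (cis t) + \<i> * of_nat N * cis t ^ N * h (cis t))"
      by (intro continuous_on_add continuous_on_mult continuous_on_const cc h g)
  qed measurable
  then have "(LINT z|circle_measure. z ^ N * g z) + \<i> * of_nat N * (LINT z|circle_measure. z ^ N * h z) = 0"
    using i1 i2 by (simp add: mult.assoc)
  then have "\<i> * of_nat N * (LINT z|circle_measure. z ^ N * h z) = - (LINT z|circle_measure. z ^ N * g z)"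
    by (simp add: add_eq_0_iff)
  then have "cmod (\<i> * of_nat N * (LINT z|circle_measure. z ^ N * h z)) = cmod (LINT z|circle_measure. z ^ N * g z)"
    by simp
  then have "real N * cmod (LINT z|circle_measure. z ^ N * h z) = cmod (LINT z|circle_measure. z ^ N * g z)"
    by (simp add: norm_mult)
  also have "\<dots> \<le> (LINT z|circle_measure. cmod (z ^ N * g z))" by (rule integral_norm_bound)
  also have "\<dots> \<le> (LINT z|circle_measure. L * cmod (h z))"
  proof (rule integral_mono_AE)
    show "AE z in circle_measure. cmod (z ^ N * g z) \<le> L * cmod (h z)"
      using circ.AE_circle by eventually_elim (use g(4) in \<open>simp add: norm_mult norm_power\<close>)
  qed (use i2 i3 in auto)
  finally show ?thesis using assms(2) by (simp add: field_simps)
qed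

section \<open>Second-order expansions of powers\<close>

lemma power_second_order:
  fixes k :: nat
  shows "\<exists>C\<ge>0. \<forall>y::real. -1 \<le> y \<and> y \<le> 3 \<longrightarrow> (1 + y) ^ k \<le> 1 + real k * y + C * y\<^sup>2"
proof (induction k)
  case 0
  show ?case by (intro exI[of _ 0]) auto
next
  case (Suc k)
  then obtain C where C: "C \<ge> 0" "\<And>y. -1 \<le> y \<Longrightarrow> y \<le> 3 \<Longrightarrow> (1 + y) ^ k \<le> 1 + real k * y + C * y\<^sup>2"
    by blast
  \<comment> \<open>The factor 4 bounds 1 + y; the interval from -1 to 3 is the range of |1 - x|^2 -
    1 for |x| <= 1, where the estimate is applied.\<close>
  have "(1 + y) ^ Suc k \<le> 1 + real (Suc k) * y + (real k + 4 * C) * y\<^sup>2" if y: "-1 \<le> y" "y \<le> 3" for y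
  proof -
    have "(1 + y) ^ Suc k \<le> (1 + y) * (1 + real k * y + C * y\<^sup>2)"
      using C(2)[OF y] y by (simp add: mult_left_mono)
    also have "\<dots> = 1 + real (Suc k) * y + (real k + C * (1 + y)) * y\<^sup>2"
      by (simp add: algebra_simps power2_eq_square)
    also have "\<dots> \<le> 1 + real (Suc k) * y + (real k + C * 4) * y\<^sup>2"
      using C(1) y by (intro add_left_mono mult_right_mono mult_left_mono) auto
    finally show ?thesis by (simp add: mult.commute)
  qed
  then show ?case using C(1) by (intro exI[of _ "real k + 4 * C"]) auto
qed

text \<open>A lower bound c for 1 + y replaces the interval: it keeps 1 / (1 + y) below 1 / c, which
  is all that the remainder requires.\<close>

lemma inverse_power_second_order:
  fixes k :: nat and c :: real
  assumes "c > 0"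
  shows "\<exists>C\<ge>0. \<forall>y. c \<le> 1 + y \<longrightarrow> inverse (1 + y) ^ k \<le> 1 - real k * y + C * y\<^sup>2"
proof (induction k)
  case 0
  show ?case by (intro exI[of _ 0]) auto
next
  case (Suc k)
  then obtain C where C: "C \<ge> 0" "\<And>y. c \<le> 1 + y \<Longrightarrow> inverse (1 + y) ^ k \<le> 1 - real k * y + C * y\<^sup>2"
    by blast
  define V where "V = inverse c"
  have "inverse (1 + y) ^ Suc k \<le> 1 - real (Suc k) * y + (1 + real k + C) * V * y\<^sup>2" if y: "c \<le> 1 + y" for y
  proof -
    define v where "v = inverse (1 + y)"
    have v: "0 \<le> v" "v \<le> V" using assms y by (auto simp: v_def V_def le_imp_inverse_le)
    have vy: "v * (1 + y) = 1" using assms y by (simp add: v_def)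
    \<comment> \<open>The geometric series for 1 / (1 + y) with its exact second-order
      remainder.\<close>
    have ve: "v = 1 - y + v * y\<^sup>2" using vy by (simp add: power2_eq_square) algebra
    have "v ^ Suc k \<le> v * (1 - real k * y + C * y\<^sup>2)"
      using C(2)[OF y] v by (simp add: mult_left_mono v_def)
    also have "\<dots> = 1 - real (Suc k) * y + (1 + real k + C) * v * y\<^sup>2"
    proof -
      have "v * y = y - v * y\<^sup>2" using vy by (simp add: power2_eq_square) algebra
      then have "v * (real k * y) = real k * (y - v * y\<^sup>2)" by (metis mult.left_commute)
      then show ?thesis using ve by (simp add: algebra_simps)
    qed
    also have "\<dots> \<le> 1 - real (Suc k) * y + (1 + real k + C) * V * y\<^sup>2"
      using v C(1) by (intro add_left_mono mult_right_mono mult_left_mono) auto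
    finally show ?thesis by (simp add: v_def)
  qed
  moreover have "(1 + real k + C) * V \<ge> 0" using C assms by (simp add: V_def)
  ultimately show ?case by (intro exI[of _ "(1 + real k + C) * V"]) auto
qed

text \<open>With y = |x|^2 - 2 Re x the left side is (1 + y)^m, so the integer case applies. The
  bound on |x| keeps 1 + y at least (1 - \<kappa>)^2, which matters for negative m; the term m |x|^2
  and the estimate |y| <= 3 |x| yield the new constant |m| + 9 C.\<close>

lemma power_int_second_order:
  fixes m :: int and \<kappa> :: real
  assumes "\<kappa> < 1"
  shows "\<exists>C\<ge>0. \<forall>x::complex. cmod x \<le> \<kappa> \<longrightarrow>
    cmod (1 - x) powi (2 * m) \<le> 1 - 2 * real_of_int m * Re x + C * (cmod x)\<^sup>2"
proof -
  define c where "c = (1 - \<kappa>)\<^sup>2"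
  have c: "c > 0" using assms by (simp add: c_def)
  define k where "k = nat \<bar>m\<bar>"
  obtain C where C: "C \<ge> 0" "\<And>y. c \<le> 1 + y \<Longrightarrow> y \<le> 3 \<Longrightarrow> (1 + y) powi m \<le> 1 + real_of_int m * y + C * y\<^sup>2"
  proof (cases "m \<ge> 0")
    case True
    obtain C where "C \<ge> 0" "\<And>y::real. -1 \<le> y \<Longrightarrow> y \<le> 3 \<Longrightarrow> (1 + y) ^ k \<le> 1 + real k * y + C * y\<^sup>2"
      using power_second_order[of k] by blast
    then show ?thesis using that[of C] True c by (simp add: power_int_def k_def)
  next
    case False
    obtain C where "C \<ge> 0" "\<And>y. c \<le> 1 + y \<Longrightarrow> inverse (1 + y) ^ k \<le> 1 - real k * y + C * y\<^sup>2"
      using inverse_power_second_order[OF c, of k] by blast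
    then show ?thesis using that[of C] False by (simp add: power_int_def k_def)
  qed
  have "cmod (1 - x) powi (2 * m) \<le> 1 - 2 * real_of_int m * Re x + (\<bar>real_of_int m\<bar> + 9 * C) * (cmod x)\<^sup>2"
    if x: "cmod x \<le> \<kappa>" for x
  proof -
    define y where "y = (cmod x)\<^sup>2 - 2 * Re x"
    have y1: "1 + y = (cmod (1 - x))\<^sup>2"
      unfolding y_def cmod_power2 by (simp add: power2_eq_square algebra_simps)
    have x1: "cmod x \<le> 1" using x assms by simp
    have sq: "(cmod x)\<^sup>2 \<le> cmod x" using x1 by (simp add: power2_eq_square mult_left_le)
    have y3: "\<bar>y\<bar> \<le> 3 * cmod x" 
      using abs_Re_le_cmod[of x] sq zero_le_power2[of "cmod x"] unfolding y_def by linarith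
    then have "\<bar>y\<bar>\<^sup>2 \<le> (3 * cmod x)\<^sup>2" by (rule power_mono) simp
    then have ysq: "y\<^sup>2 \<le> 9 * (cmod x)\<^sup>2" by (simp add: power_mult_distrib)
    have "1 - \<kappa> \<le> cmod (1 - x)" using norm_triangle_ineq2[of 1 x] x by simp
    then have "c \<le> 1 + y" unfolding y1 c_def using assms by (intro power_mono) auto
    moreover have "y \<le> 3" using y3 x1 by linarith
    ultimately have "(1 + y) powi m \<le> 1 + real_of_int m * y + C * y\<^sup>2" by (rule C(2))
    also have "\<dots> \<le> 1 - 2 * real_of_int m * Re x + \<bar>real_of_int m\<bar> * (cmod x)\<^sup>2 + C * (9 * (cmod x)\<^sup>2)"
    proof -
      have "real_of_int m * (cmod x)\<^sup>2 \<le> \<bar>real_of_int m\<bar> * (cmod x)\<^sup>2" by (intro mult_right_mono) auto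
      moreover have "C * y\<^sup>2 \<le> C * (9 * (cmod x)\<^sup>2)" using ysq C(1) by (rule mult_left_mono)
      moreover have "real_of_int m * y = real_of_int m * (cmod x)\<^sup>2 - 2 * real_of_int m * Re x"
        by (simp add: y_def algebra_simps)
      ultimately show ?thesis by linarith
    qed
    finally have "(1 + y) powi m \<le> 1 - 2 * real_of_int m * Re x + (\<bar>real_of_int m\<bar> + 9 * C) * (cmod x)\<^sup>2"
      by (simp add: algebra_simps)
    moreover have "cmod (1 - x) powi (2 * m) = (1 + y) powi m"
      unfolding y1 using power_int_mult[of "cmod (1 - x)" 2 m] by simp
    ultimately show ?thesis by metis
  qed
  then show ?thesis using C(1) by (intro exI[of _ "\<bar>real_of_int m\<bar> + 9 * C"]) auto
qed

section \<open>Moments of the reversed polynomials\<close>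

text \<open>Differentiating F - \<gamma> z^(k+1) \<open>cnj\<close> F in the angle produces the
  numerator: (1 + |\<gamma>|) L from the derivatives of F and |\<gamma>| (k + 1) from that of
  z^(k+1), each times |F|. The denominator comes from the modulus of the new polynomial being at
  least (1 - |\<gamma>|) |F|.\<close>

primrec logder_bound :: "(nat \<Rightarrow> complex) \<Rightarrow> nat \<Rightarrow> real" where
  "logder_bound \<gamma> 0 = 0"
| "logder_bound \<gamma> (Suc k) = (logder_bound \<gamma> k * (1 + cmod (\<gamma> k)) + cmod (\<gamma> k) * real (Suc k)) / (1 - cmod (\<gamma> k))"

text \<open>A discrete Gronwall inequality, resting on 1 + b <= exp b.\<close>

lemma recursive_bound:
  fixes x b :: "nat \<Rightarrow> real"
  assumes "\<And>k. 0 \<le> x k" "\<And>k. 0 \<le> b k" "summable b" "\<And>k. x (Suc k) \<le> x k * (1 + b k)"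
  shows "x k \<le> x 0 * exp (suminf b)"
proof -
  have "x k \<le> x 0 * (\<Prod>i<k. 1 + b i)" for k
  proof (induction k)
    case (Suc k)
    have "x (Suc k) \<le> x k * (1 + b k)" by fact
    also have "\<dots> \<le> (x 0 * (\<Prod>i<k. 1 + b i)) * (1 + b k)"
      using Suc assms(2)[of k] by (intro mult_right_mono) auto
    finally show ?case by (simp add: mult.assoc)
  qed simp
  also have "x 0 * (\<Prod>i<k. 1 + b i) \<le> x 0 * exp (suminf b)"
  proof (rule mult_left_mono)
    have "(\<Prod>i<k. 1 + b i) \<le> exp (\<Sum>i<k. b i)" using assms(2) by (intro prod_le_exp_sum) auto
    also have "\<dots> \<le> exp (suminf b)" using sum_le_suminf[OF assms(3), of "{..<k}"] assms(2) by simp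
    finally show "(\<Prod>i<k. 1 + b i) \<le> exp (suminf b)" .
  qed (rule assms(1))
  finally show ?thesis .
qed

text \<open>These conditions isolate what the analysis uses; lacunarity is needed only to establish
  \<open>weighted\<close>, in \<open>smooth_szego_lacunary\<close>.\<close>

locale smooth_szego =
  fixes \<gamma> :: "nat \<Rightarrow> complex" and \<kappa> :: real
  assumes le: "\<And>k. cmod (\<gamma> k) \<le> \<kappa>" and less1: "\<kappa> < 1"
    and sq: "summable (\<lambda>k. (cmod (\<gamma> k))\<^sup>2)"
    and weighted: "summable (\<lambda>k. cmod (\<gamma> k) * (logder_bound \<gamma> k / real (Suc k)))"
begin

abbreviation "F k \<equiv> poly (szego_star \<gamma> k)"
abbreviation "L k \<equiv> logder_bound \<gamma> k"

lemma \<gamma>_less: "cmod (\<gamma> k) < 1"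
  using le[of k] less1 by simp

lemma F_Suc:
  assumes "cmod z = 1"
  shows "F (Suc k) z = F k z - \<gamma> k * z ^ Suc k * cnj (F k z)"
proof -
  have "F k z = z ^ k * cnj (poly (szego \<gamma> k) z)"
    unfolding szego_star_def using assms by (intro poly_star_poly_circle) (auto simp: degree_szego)
  moreover have "z ^ k * cnj z ^ k = 1" using assms
    by (metis complex_norm_square mult_1 of_real_1 power_mult_distrib power_one power2_eq_square)
  ultimately have "z ^ k * cnj (F k z) = poly (szego \<gamma> k) z"
    by (simp add: mult.assoc[symmetric])
  then have "\<gamma> k * z ^ Suc k * cnj (F k z) = \<gamma> k * (z * poly (szego \<gamma> k) z)"
    by (metis mult.assoc power_Suc)
  moreover have "F (Suc k) z = F k z - \<gamma> k * (z * poly (szego \<gamma> k) z)" by (simp add: szego_star_Suc)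
  ultimately show ?thesis by metis
qed

lemma F_nonzero: "cmod z = 1 \<Longrightarrow> F k z \<noteq> 0"
  using szego_star_disc[of \<gamma> z k, OF \<gamma>_less] by simp

lemma L_nonneg: "L k \<ge> 0"
proof (induction k)
  case (Suc k)
  then show ?case using \<gamma>_less[of k] by simp
qed simp

lemma L_mono: "k \<le> l \<Longrightarrow> L k \<le> L l"
proof (rule lift_Suc_mono_le)
  fix k
  have "L k * (1 - cmod (\<gamma> k)) \<le> L k * (1 + cmod (\<gamma> k)) + cmod (\<gamma> k) * real (Suc k)"
    using L_nonneg[of k] by (simp add: algebra_simps)
  then show "L k \<le> L (Suc k)" using \<gamma>_less[of k] by (simp add: le_divide_eq)
qed

lemma logder_le_F: "logder_le (L k) (F k)"
proof (induction k)
  case 0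
  show ?case using logder_le_const[of 1] by (simp add: szego_star_0)
next
  case (Suc k)
  define f where "f = F k"
  define c where "c = \<gamma> k"
  have c: "cmod c < 1" using \<gamma>_less c_def by simp
  have [measurable]: "f \<in> borel_measurable borel" by (simp add: f_def)
  have "logder_le (L k) f" using Suc f_def by simp
  then have "logder_le (L (Suc k)) (\<lambda>z. f z - c * (z ^ Suc k * cnj (f z)))"
  proof (rule logder_leE)
    fix g
    assume h: "\<And>z. cmod z = 1 \<Longrightarrow> f z \<noteq> 0" "continuous_on UNIV (\<lambda>t. f (cis t))"
      and g: "g \<in> borel_measurable borel" "continuous_on UNIV (\<lambda>t. g (cis t))"
      "\<And>t. ((\<lambda>t. f (cis t)) has_vector_derivative g (cis t)) (at t)"
      "\<And>z. cmod z = 1 \<Longrightarrow> cmod (g z) \<le> L k * cmod (f z)"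
    note [measurable] = g(1)
    have cc: "continuous_on UNIV (\<lambda>t. cis t ^ Suc k)"
      by (intro continuous_on_power continuous_on_cis continuous_on_id)
    show ?thesis
    proof (rule logder_leI[where g="\<lambda>z. g z - c * (z ^ Suc k * cnj (g z) + (\<i> * of_nat (Suc k) * z ^ Suc k) * cnj (f z))"])
      show "continuous_on UNIV (\<lambda>t. g (cis t) - c * (cis t ^ Suc k * cnj (g (cis t)) + (\<i> * of_nat (Suc k) * cis t ^ Suc k) * cnj (f (cis t))))"
        by (intro continuous_on_add continuous_on_diff continuous_on_mult continuous_on_const continuous_on_cnj cc h g)
      show "((\<lambda>t. f (cis t) - c * (cis t ^ Suc k * cnj (f (cis t)))) has_vector_derivative
        g (cis t) - c * (cis t ^ Suc k * cnj (g (cis t)) + (\<i> * of_nat (Suc k) * cis t ^ Suc k) * cnj (f (cis t)))) (at t)" for t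
        by (intro has_vector_derivative_diff g(3) has_vector_derivative_mult_right
          has_vector_derivative_mult[OF has_vector_derivative_cis_power] has_vector_derivative_cnj)
      fix z :: complex assume z: "cmod z = 1"
      have t: "cmod (c * (z ^ Suc k * cnj (f z))) = cmod c * cmod (f z)"
        using z by (simp only: norm_mult norm_power complex_mod_cnj) simp
      have "cmod (c * (z ^ Suc k * cnj (f z))) < 1 * cmod (f z)"
        unfolding t using c h(1)[OF z] by (intro mult_strict_right_mono) auto
      then show "f z - c * (z ^ Suc k * cnj (f z)) \<noteq> 0" by auto
      have low: "(1 - cmod c) * cmod (f z) \<le> cmod (f z - c * (z ^ Suc k * cnj (f z)))"
        using norm_triangle_ineq2[of "f z" "c * (z ^ Suc k * cnj (f z))"] unfolding t
        by (simp add: algebra_simps)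
      have "cmod (g z - c * (z ^ Suc k * cnj (g z) + (\<i> * of_nat (Suc k) * z ^ Suc k) * cnj (f z)))
        \<le> cmod (g z) + cmod (c * (z ^ Suc k * cnj (g z) + (\<i> * of_nat (Suc k) * z ^ Suc k) * cnj (f z)))"
        by (rule norm_triangle_ineq4)
      also have "cmod (c * (z ^ Suc k * cnj (g z) + (\<i> * of_nat (Suc k) * z ^ Suc k) * cnj (f z)))
        \<le> cmod c * (cmod (z ^ Suc k * cnj (g z)) + cmod ((\<i> * of_nat (Suc k) * z ^ Suc k) * cnj (f z)))"
        unfolding norm_mult[of c] by (intro mult_left_mono norm_triangle_ineq) auto
      also have "\<dots> = cmod c * (cmod (g z) + real (Suc k) * cmod (f z))"
        using z by (simp only: norm_mult norm_power complex_mod_cnj norm_of_nat norm_ii) simp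
      also have "cmod (g z) + cmod c * (cmod (g z) + real (Suc k) * cmod (f z)) \<le>
         L k * cmod (f z) + cmod c * (L k * cmod (f z) + real (Suc k) * cmod (f z))"
        by (intro add_mono mult_left_mono order.refl g(4) z) auto
      also have "\<dots> = L (Suc k) * ((1 - cmod c) * cmod (f z))"
        using c by (simp add: c_def[symmetric] field_simps)
      also have "\<dots> \<le> L (Suc k) * cmod (f z - c * (z ^ Suc k * cnj (f z)))"
        by (rule mult_left_mono[OF low L_nonneg])
      finally show "cmod (g z - c * (z ^ Suc k * cnj (g z) + (\<i> * of_nat (Suc k) * z ^ Suc k) * cnj (f z)))
        \<le> L (Suc k) * cmod (f z - c * (z ^ Suc k * cnj (f z)))" by simp
    qed measurable
  qed
  then show ?case
    by (rule logder_le_cong) (auto simp: F_Suc f_def c_def mult.assoc)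
qed

lemma moment_integrable: "integrable circle_measure (\<lambda>z. cmod (F k z) powi m)"
  using integrable_norm[OF logder_le_integrable[OF logder_le_power_int[OF logder_le_F]]]
  by (simp add: norm_power_int)

text \<open>
  On the circle \<open>F\<^sub>k\<^sub>+\<^sub>1 = F\<^sub>k (1 - \<gamma>\<^sub>k u)\<close> with \<open>u\<close> unimodular. The term linear in \<open>\<gamma>\<^sub>k\<close> is
  oscillatory of frequency \<open>k + 1\<close>, so it only costs the factor \<open>L k / (k + 1)\<close>.
\<close>

lemma moment_step:
  fixes m :: int
  assumes C: "\<And>x. cmod x \<le> \<kappa> \<Longrightarrow> cmod (1 - x) powi (2 * m) \<le> 1 - 2 * real_of_int m * Re x + C * (cmod x)\<^sup>2"
  shows "(LINT z|circle_measure. cmod (F (Suc k) z) powi (2 * m)) \<le>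
    (LINT z|circle_measure. cmod (F k z) powi (2 * m)) *
      (1 + (4 * \<bar>real_of_int m\<bar> * (\<bar>real_of_int m\<bar> + 1) * (cmod (\<gamma> k) * (L k / real (Suc k))) + C * (cmod (\<gamma> k))\<^sup>2))"
proof -
  \<comment> \<open>On the circle this is |F|^(2m) \<open>cnj\<close> F / F, the amplitude of the
    oscillatory linear term. Written with integer powers it falls under the product, conjugation and
    power rules for \<open>logder_le\<close>.\<close>
  define H where "H z = F k z powi (m - 1) * cnj (F k z) powi (m + 1)" for z
  define M where "M = (LINT z|circle_measure. cmod (F k z) powi (2 * m))"
  define J where "J = (LINT z|circle_measure. z ^ Suc k * H z)"
  have M0: "M \<ge> 0" unfolding M_def by (intro integral_nonneg_AE) simp
  have H: "logder_le ((2 * \<bar>real_of_int m\<bar> + 2) * L k) H"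
  proof -
    have "logder_le (\<bar>real_of_int (m - 1)\<bar> * L k + \<bar>real_of_int (m + 1)\<bar> * L k) H"
      unfolding H_def by (intro logder_le_mult logder_le_power_int logder_le_cnj logder_le_F)
    moreover have "\<bar>real_of_int (m - 1)\<bar> * L k + \<bar>real_of_int (m + 1)\<bar> * L k \<le> (2 * \<bar>real_of_int m\<bar> + 2) * L k"
      unfolding distrib_right[symmetric] by (intro mult_right_mono L_nonneg) linarith
    ultimately show ?thesis unfolding logder_le_def by (meson mult_right_mono norm_ge_zero order_trans)
  qed
  have [measurable]: "H \<in> borel_measurable borel" using H by (rule logder_le_borel)
  have Hn: "cmod (H z) = cmod (F k z) powi (2 * m)" if "cmod z = 1" for z
  proof -
    have "cmod (F k z) powi (m - 1) * cmod (F k z) powi (m + 1) = cmod (F k z) powi (m - 1 + (m + 1))"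
      using F_nonzero[OF that] by (intro power_int_add[symmetric]) auto
    then show ?thesis by (simp add: H_def norm_mult norm_power_int)
  qed
  \<comment> \<open>As |H| integrates to the moment itself, the oscillation error is proportional to
    \<open>M\<close>, and the step takes the multiplicative form required by
    \<open>recursive_bound\<close>.\<close>
  have MH: "(LINT z|circle_measure. cmod (H z)) = M"
    unfolding M_def
  proof (rule circ.integral_circle_cong)
    show "(\<lambda>z. cmod (F k z) powi (2 * m)) \<in> borel_measurable borel"
      using borel_measurable_integrable[OF moment_integrable, of k "2 * m"]
      by (simp add: measurable_cong_sets[OF sets_circle_measure refl])
  qed (use Hn in auto)
  have J: "cmod J \<le> (2 * \<bar>real_of_int m\<bar> + 2) * (L k / real (Suc k)) * M"
    using oscillation[OF H, of "Suc k"] unfolding J_def MH by simp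
  have iH: "integrable circle_measure (\<lambda>z. z ^ Suc k * H z)"
    by (rule Bochner_Integration.integrable_bound[OF integrable_norm[OF logder_le_integrable[OF H]]])
       (use circ.AE_circle in \<open>auto simp: norm_mult norm_power elim!: eventually_mono\<close>)
  have pw: "cmod (F (Suc k) z) powi (2 * m) \<le>
      (1 + C * (cmod (\<gamma> k))\<^sup>2) * cmod (F k z) powi (2 * m) - 2 * real_of_int m * Re (\<gamma> k * (z ^ Suc k * H z))"
    if z: "cmod z = 1" for z
  proof -
    define a where "a = F k z"
    have a: "a \<noteq> 0" using F_nonzero[OF z] a_def by simp
    define u where "u = z ^ Suc k * (cnj a / a)"
    have u: "cmod u = 1" using a z by (simp add: u_def norm_mult norm_power norm_divide)
    have "a * (\<gamma> k * u) = \<gamma> k * z ^ Suc k * cnj a" using a by (simp add: u_def)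
    moreover have "F (Suc k) z = a - \<gamma> k * z ^ Suc k * cnj a" unfolding a_def by (rule F_Suc[OF z])
    ultimately have e: "F (Suc k) z = a * (1 - \<gamma> k * u)" by (simp only: right_diff_distrib mult_1_right)
    have Hu: "z ^ Suc k * H z = cmod a powi (2 * m) *\<^sub>R u"
    proof -
      have "H z = (a powi m * cnj a powi m) * (cnj a / a)"
        using a by (simp add: H_def a_def[symmetric] power_int_diff power_int_add field_simps)
      also have "a powi m * cnj a powi m = (a * cnj a) powi m" by (simp add: power_int_mult_distrib)
      also have "\<dots> = of_real (cmod a powi (2 * m))"
        by (simp add: complex_norm_square[symmetric] power_int_mult)
      finally show ?thesis by (simp add: u_def scaleR_conv_of_real)
    qed
    have "cmod (F (Suc k) z) powi (2 * m) = cmod a powi (2 * m) * cmod (1 - \<gamma> k * u) powi (2 * m)"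
      unfolding e by (simp add: norm_mult power_int_mult_distrib)
    also have "\<dots> \<le> cmod a powi (2 * m) * (1 - 2 * real_of_int m * Re (\<gamma> k * u) + C * (cmod (\<gamma> k))\<^sup>2)"
      using C[of "\<gamma> k * u"] le[of k] u by (intro mult_left_mono) (auto simp: norm_mult)
    also have "\<dots> = (1 + C * (cmod (\<gamma> k))\<^sup>2) * cmod a powi (2 * m) - 2 * real_of_int m * Re (\<gamma> k * (z ^ Suc k * H z))"
      unfolding Hu by (simp add: algebra_simps)
    finally show ?thesis by (simp add: a_def)
  qed
  have i1: "integrable circle_measure (\<lambda>z. Re (\<gamma> k * (z ^ Suc k * H z)))"
    by (intro integrable_Re integrable_mult_right iH)
  have J2: "- (2 * real_of_int m * Re (\<gamma> k * J)) \<le> 2 * \<bar>real_of_int m\<bar> * (cmod (\<gamma> k) * ((2 * \<bar>real_of_int m\<bar> + 2) * (L k / real (Suc k)) * M))"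
  proof -
    have "- (2 * real_of_int m * Re (\<gamma> k * J)) \<le> \<bar>2 * real_of_int m * Re (\<gamma> k * J)\<bar>" by linarith
    also have "\<dots> = 2 * \<bar>real_of_int m\<bar> * \<bar>Re (\<gamma> k * J)\<bar>" by (simp add: abs_mult)
    also have "\<dots> \<le> 2 * \<bar>real_of_int m\<bar> * (cmod (\<gamma> k) * cmod J)"
      using abs_Re_le_cmod[of "\<gamma> k * J"] by (intro mult_left_mono) (auto simp: norm_mult)
    also have "\<dots> \<le> 2 * \<bar>real_of_int m\<bar> * (cmod (\<gamma> k) * ((2 * \<bar>real_of_int m\<bar> + 2) * (L k / real (Suc k)) * M))"
      by (intro mult_left_mono J) auto
    finally show ?thesis .
  qed
  have "(LINT z|circle_measure. cmod (F (Suc k) z) powi (2 * m)) \<le>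
    (LINT z|circle_measure. (1 + C * (cmod (\<gamma> k))\<^sup>2) * cmod (F k z) powi (2 * m) - 2 * real_of_int m * Re (\<gamma> k * (z ^ Suc k * H z)))"
  proof (rule integral_mono_AE)
    show "AE z in circle_measure. cmod (F (Suc k) z) powi (2 * m) \<le>
      (1 + C * (cmod (\<gamma> k))\<^sup>2) * cmod (F k z) powi (2 * m) - 2 * real_of_int m * Re (\<gamma> k * (z ^ Suc k * H z))"
      using circ.AE_circle by eventually_elim (rule pw)
  qed (intro moment_integrable Bochner_Integration.integrable_diff integrable_mult_right i1)+
  also have "\<dots> = (1 + C * (cmod (\<gamma> k))\<^sup>2) * M - 2 * real_of_int m * Re (\<gamma> k * J)"
  proof -
    have "(LINT z|circle_measure. Re (\<gamma> k * (z ^ Suc k * H z))) = Re (\<gamma> k * J)"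
      unfolding J_def using integral_Re[OF integrable_mult_right[OF iH, of "\<gamma> k"]] by simp
    then show ?thesis
      by (simp only: M_def Bochner_Integration.integral_diff[OF integrable_mult_right[OF moment_integrable] integrable_mult_right[OF i1]]
         integral_mult_right_zero)
  qed
  also have "\<dots> \<le> (1 + C * (cmod (\<gamma> k))\<^sup>2) * M + 2 * \<bar>real_of_int m\<bar> * (cmod (\<gamma> k) * ((2 * \<bar>real_of_int m\<bar> + 2) * (L k / real (Suc k)) * M))"
    using J2 by linarith
  finally show ?thesis unfolding M_def[symmetric] by (simp add: algebra_simps)
qed

lemma moment_bound:
  obtains B where "\<And>k. (LINT z|circle_measure. cmod (F k z) powi (2 * m)) \<le> B"
proof -
  obtain C where C: "C \<ge> 0" "\<And>x. cmod x \<le> \<kappa> \<Longrightarrow> cmod (1 - x) powi (2 * m) \<le> 1 - 2 * real_of_int m * Re x + C * (cmod x)\<^sup>2"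
    using power_int_second_order[OF less1, of m] by blast
  define b where "b k = 4 * \<bar>real_of_int m\<bar> * (\<bar>real_of_int m\<bar> + 1) * (cmod (\<gamma> k) * (L k / real (Suc k))) + C * (cmod (\<gamma> k))\<^sup>2" for k
  have "(LINT z|circle_measure. cmod (F k z) powi (2 * m)) \<le>
     (LINT z|circle_measure. cmod (F 0 z) powi (2 * m)) * exp (suminf b)" for k
  proof (rule recursive_bound)
    show "0 \<le> (LINT z|circle_measure. cmod (F k z) powi (2 * m))" for k
      by (intro integral_nonneg_AE) simp
    show "0 \<le> b k" for k unfolding b_def using L_nonneg C(1)
      by (intro add_nonneg_nonneg mult_nonneg_nonneg divide_nonneg_nonneg) auto
    show "summable b" unfolding b_def by (intro summable_add summable_mult sq weighted)
    show "(LINT z|circle_measure. cmod (F (Suc k) z) powi (2 * m)) \<le> (LINT z|circle_measure. cmod (F k z) powi (2 * m)) * (1 + b k)" for k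
      unfolding b_def by (rule moment_step[OF C(2)])
  qed
  then show ?thesis by (rule that)
qed

lemma square_integrable: "integrable circle_measure (\<lambda>z. (cmod (F k z))\<^sup>2)"
  using moment_integrable[of k 2] by simp

text \<open>Expanding |F (l+1) - F k|^2 for l >= k, the cross terms carry z^(l+1) times
  \<open>cnj (F l)\<close> times \<open>cnj (F l)\<close> or \<open>cnj (F k)\<close>. Monotonicity
  of \<open>L\<close> bounds both logarithmic derivatives by 2 \<open>L l\<close>, so each step adds
  at most a summable term that does not depend on k; \<open>T\<close> is the tail of the
  series.\<close>

lemma F_L2_Cauchy:
  obtains T where "T \<longlonglongrightarrow> 0" "\<And>k l. k \<le> l \<Longrightarrow> (LINT z|circle_measure. (cmod (F l z - F k z))\<^sup>2) \<le> T k"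
proof -
  obtain M where M: "\<And>k. (LINT z|circle_measure. (cmod (F k z))\<^sup>2) \<le> M"
    using moment_bound[of 1] by auto
  \<comment> \<open>The 8 is 2 (2 + 2): the factor 2 in front of the real part, and the bound
    \<open>osc\<close> with its factor 2 for each of \<open>P\<close> and \<open>Q\<close>
    below.\<close>
  define b where "b i = 8 * (cmod (\<gamma> i) * (L i / real (Suc i))) + (cmod (\<gamma> i))\<^sup>2" for i
  have b0: "b i \<ge> 0" for i unfolding b_def using L_nonneg
    by (intro add_nonneg_nonneg mult_nonneg_nonneg divide_nonneg_nonneg) auto
  have sb: "summable b" unfolding b_def by (intro summable_add summable_mult sq weighted)
  have M0: "M \<ge> 0" using order.trans[OF _ M[of 0]] by simp
  have icont: "integrable circle_measure f" if "continuous_on UNIV f" for f :: "complex \<Rightarrow> complex"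
    using circ.integrable_cont_UNIV[OF that] .
  have cF: "continuous_on UNIV (F k)" for k by (rule continuous_on_poly[OF continuous_on_id])
  have osc: "cmod (LINT z|circle_measure. z ^ Suc l * (cnj (F l z) * cnj (F k z))) \<le> 2 * (L l / real (Suc l)) * M"
    if "k \<le> l" for k l
  proof -
    have "logder_le (L l + L k) (\<lambda>z. cnj (F l z) * cnj (F k z))"
      by (intro logder_le_mult logder_le_cnj logder_le_F)
    then have "cmod (LINT z|circle_measure. z ^ Suc l * (cnj (F l z) * cnj (F k z))) \<le>
      (L l + L k) / real (Suc l) * (LINT z|circle_measure. cmod (cnj (F l z) * cnj (F k z)))"
      by (rule oscillation) simp
    also have "\<dots> \<le> (2 * L l) / real (Suc l) * M"
    proof (rule mult_mono)
      have "(LINT z|circle_measure. cmod (cnj (F l z) * cnj (F k z))) \<le>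
        (LINT z|circle_measure. ((cmod (F l z))\<^sup>2 + (cmod (F k z))\<^sup>2) / 2)"
      proof (rule integral_mono)
        show "integrable circle_measure (\<lambda>z. cmod (cnj (F l z) * cnj (F k z)))"
          by (intro integrable_norm icont continuous_on_mult continuous_on_cnj cF)
        show "integrable circle_measure (\<lambda>z. ((cmod (F l z))\<^sup>2 + (cmod (F k z))\<^sup>2) / 2)"
          by (intro integrable_divide Bochner_Integration.integrable_add square_integrable)
        show "cmod (cnj (F l z) * cnj (F k z)) \<le> ((cmod (F l z))\<^sup>2 + (cmod (F k z))\<^sup>2) / 2" for z
          using sum_squares_bound[of "cmod (F l z)" "cmod (F k z)"] by (simp add: norm_mult)
      qed
      also have "\<dots> = ((LINT z|circle_measure. (cmod (F l z))\<^sup>2) + (LINT z|circle_measure. (cmod (F k z))\<^sup>2)) / 2"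
        by (simp add: square_integrable)
      also have "\<dots> \<le> M" using M[of l] M[of k] by simp
      finally show "(LINT z|circle_measure. cmod (cnj (F l z) * cnj (F k z))) \<le> M" .
    qed (use L_mono[OF that] L_nonneg[of l] in \<open>auto intro!: divide_right_mono\<close>)
    finally show ?thesis by simp
  qed
  have step: "(LINT z|circle_measure. (cmod (F (Suc l) z - F k z))\<^sup>2) \<le>
     (LINT z|circle_measure. (cmod (F l z - F k z))\<^sup>2) + M * b l" if kl: "k \<le> l" for k l
  proof -
    define P where "P z = z ^ Suc l * (cnj (F l z) * cnj (F l z))" for z
    define Q where "Q z = z ^ Suc l * (cnj (F l z) * cnj (F k z))" for z
    have iP: "integrable circle_measure P" and iQ: "integrable circle_measure Q" unfolding P_def Q_def
      by (intro icont continuous_on_mult continuous_on_cnj continuous_on_power continuous_on_id cF)+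
    have iD: "integrable circle_measure (\<lambda>z. (cmod (F l z - F k z))\<^sup>2)"
      by (intro circ.integrable_cont_UNIV continuous_on_power continuous_on_norm continuous_on_diff cF)
    have iD': "integrable circle_measure (\<lambda>z. (cmod (F (Suc l) z - F k z))\<^sup>2)"
      by (intro circ.integrable_cont_UNIV continuous_on_power continuous_on_norm continuous_on_diff cF)
    have [measurable]: "P \<in> borel_measurable borel" "Q \<in> borel_measurable borel"
      unfolding P_def Q_def by measurable
    have "(LINT z|circle_measure. (cmod (F (Suc l) z - F k z))\<^sup>2) =
      (LINT z|circle_measure. (cmod (F l z - F k z))\<^sup>2 - 2 * Re (\<gamma> l * (P z - Q z)) + (cmod (\<gamma> l))\<^sup>2 * (cmod (F l z))\<^sup>2)"
    proof (rule circ.integral_circle_cong)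
      fix z :: complex assume z: "cmod z = 1"
      define x where "x = F l z - F k z"
      define y where "y = \<gamma> l * z ^ Suc l * cnj (F l z)"
      have yn: "cmod y = cmod (\<gamma> l) * cmod (F l z)"
        using z by (simp only: y_def norm_mult norm_power complex_mod_cnj) simp
      have "F (Suc l) z - F k z = x - y" using F_Suc[OF z, of l] by (simp add: x_def y_def)
      moreover have "(cmod (x - y))\<^sup>2 = (cmod x)\<^sup>2 - 2 * Re (y * cnj x) + (cmod y)\<^sup>2"
        unfolding cmod_power2 by (simp add: power2_eq_square algebra_simps)
      moreover have "y * cnj x = \<gamma> l * (P z - Q z)"
        by (simp add: x_def y_def P_def Q_def algebra_simps)
      ultimately show "(cmod (F (Suc l) z - F k z))\<^sup>2 =
        (cmod (F l z - F k z))\<^sup>2 - 2 * Re (\<gamma> l * (P z - Q z)) + (cmod (\<gamma> l))\<^sup>2 * (cmod (F l z))\<^sup>2"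
        by (simp add: yn power_mult_distrib x_def[symmetric])
    qed measurable
    also have "\<dots> = (LINT z|circle_measure. (cmod (F l z - F k z))\<^sup>2) - 2 * Re (\<gamma> l * (integral\<^sup>L circle_measure P - integral\<^sup>L circle_measure Q))
       + (cmod (\<gamma> l))\<^sup>2 * (LINT z|circle_measure. (cmod (F l z))\<^sup>2)"
    proof -
      have iPQ: "integrable circle_measure (\<lambda>z. \<gamma> l * (P z - Q z))"
        by (intro integrable_mult_right Bochner_Integration.integrable_diff iP iQ)
      have "(LINT z|circle_measure. Re (\<gamma> l * (P z - Q z))) = Re (\<gamma> l * (integral\<^sup>L circle_measure P - integral\<^sup>L circle_measure Q))"
        using integral_Re[OF iPQ] iP iQ by simp
      then show ?thesis using iD square_integrable[of l] integrable_Re[OF iPQ]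
        by (simp only: Bochner_Integration.integral_add Bochner_Integration.integral_diff Bochner_Integration.integrable_diff
            integrable_mult_right integral_mult_right_zero)
    qed
    also have "\<dots> \<le> (LINT z|circle_measure. (cmod (F l z - F k z))\<^sup>2) + 2 * (cmod (\<gamma> l) * (4 * (L l / real (Suc l)) * M)) + (cmod (\<gamma> l))\<^sup>2 * M"
    proof -
      have "- Re (\<gamma> l * (integral\<^sup>L circle_measure P - integral\<^sup>L circle_measure Q)) \<le>
         cmod (\<gamma> l * (integral\<^sup>L circle_measure P - integral\<^sup>L circle_measure Q))"
        using abs_Re_le_cmod[of "\<gamma> l * (integral\<^sup>L circle_measure P - integral\<^sup>L circle_measure Q)"] by linarith
      also have "\<dots> = cmod (\<gamma> l) * cmod (integral\<^sup>L circle_measure P - integral\<^sup>L circle_measure Q)" by (simp add: norm_mult)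
      also have "\<dots> \<le> cmod (\<gamma> l) * (4 * (L l / real (Suc l)) * M)"
      proof (rule mult_left_mono)
        have "cmod (integral\<^sup>L circle_measure P - integral\<^sup>L circle_measure Q) \<le> cmod (integral\<^sup>L circle_measure P) + cmod (integral\<^sup>L circle_measure Q)"
          by (rule norm_triangle_ineq4)
        moreover have "cmod (integral\<^sup>L circle_measure P) \<le> 2 * (L l / real (Suc l)) * M"
          unfolding P_def by (rule osc) simp
        moreover have "cmod (integral\<^sup>L circle_measure Q) \<le> 2 * (L l / real (Suc l)) * M"
          unfolding Q_def by (rule osc[OF kl])
        moreover have "2 * R * M + 2 * R * M = 4 * R * M" for R by simp
        ultimately show "cmod (integral\<^sup>L circle_measure P - integral\<^sup>L circle_measure Q) \<le> 4 * (L l / real (Suc l)) * M"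
          by (smt (verit))
      qed simp
      finally have "- Re (\<gamma> l * (integral\<^sup>L circle_measure P - integral\<^sup>L circle_measure Q)) \<le> cmod (\<gamma> l) * (4 * (L l / real (Suc l)) * M)" .
      moreover have "(cmod (\<gamma> l))\<^sup>2 * (LINT z|circle_measure. (cmod (F l z))\<^sup>2) \<le> (cmod (\<gamma> l))\<^sup>2 * M"
        by (intro mult_left_mono M) simp
      ultimately show ?thesis by linarith
    qed
    also have "\<dots> = (LINT z|circle_measure. (cmod (F l z - F k z))\<^sup>2) + M * b l"
      by (simp add: b_def algebra_simps)
    finally show ?thesis .
  qed
  define T where "T k = M * (\<Sum>i. b (i + k))" for k
  have "(LINT z|circle_measure. (cmod (F (k + d) z - F k z))\<^sup>2) \<le> M * (\<Sum>i<d. b (i + k))" for k d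
  proof (induction d)
    case (Suc d)
    have "(LINT z|circle_measure. (cmod (F (Suc (k + d)) z - F k z))\<^sup>2) \<le>
      (LINT z|circle_measure. (cmod (F (k + d) z - F k z))\<^sup>2) + M * b (k + d)"
      by (rule step) simp
    then show ?case using Suc by (simp add: algebra_simps)
  qed simp
  moreover have "M * (\<Sum>i<d. b (i + k)) \<le> T k" for d k
    unfolding T_def using sum_le_suminf[OF summable_ignore_initial_segment[OF sb, of k], of "{..<d}"] b0 M0
    by (intro mult_left_mono) auto
  ultimately have "(LINT z|circle_measure. (cmod (F (k + d) z - F k z))\<^sup>2) \<le> T k" for k d
    by (meson order_trans)
  then have "(LINT z|circle_measure. (cmod (F l z - F k z))\<^sup>2) \<le> T k" if "k \<le> l" for k l
    using that by (metis le_add_diff_inverse)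
  moreover have "T \<longlonglongrightarrow> 0" unfolding T_def using tendsto_mult_left[OF suminf_exist_split2[OF sb], of M] by simp
  ultimately show ?thesis using that by blast
qed

end

section \<open>Convergence in mean\<close>

lemma fatou_integral:
  fixes h :: "nat \<Rightarrow> 'a \<Rightarrow> real"
  assumes h: "\<And>i. integrable M (h i)" "\<And>i x. 0 \<le> h i x"
    and H[measurable]: "H \<in> borel_measurable M"
    and lim: "AE x in M. (\<lambda>i. h i x) \<longlonglongrightarrow> H x"
    and B: "\<And>i. i \<ge> N \<Longrightarrow> (LINT x|M. h i x) \<le> B"
  shows "integrable M H" "(LINT x|M. H x) \<le> B"
proof -
  have B0: "B \<ge> 0"
    by (rule order.trans[OF _ B[of N]]) (auto intro!: integral_nonneg_AE h)
  have Hpos: "AE x in M. 0 \<le> H x"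
    using lim by eventually_elim (rule LIMSEQ_le_const, use h in auto)
  have [measurable]: "\<And>i. h i \<in> borel_measurable M" using h(1) by (rule borel_measurable_integrable)
  have "(\<integral>\<^sup>+x. ennreal (H x) \<partial>M) = (\<integral>\<^sup>+x. liminf (\<lambda>i. ennreal (h i x)) \<partial>M)"
  proof (rule nn_integral_cong_AE)
    show "AE x in M. ennreal (H x) = liminf (\<lambda>i. ennreal (h i x))"
      using lim by eventually_elim (rule lim_imp_Liminf[symmetric], simp_all add: tendsto_ennrealI)
  qed
  also have "\<dots> \<le> liminf (\<lambda>i. \<integral>\<^sup>+x. ennreal (h i x) \<partial>M)" by (rule nn_integral_liminf) simp
  also have "\<dots> \<le> ennreal B"
  proof (rule Liminf_le)
    show "\<forall>\<^sub>F i in sequentially. (\<integral>\<^sup>+x. ennreal (h i x) \<partial>M) \<le> ennreal B"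
      using eventually_ge_at_top[of N]
      by eventually_elim (use h B in \<open>simp add: nn_integral_eq_integral ennreal_leI\<close>)
  qed simp
  finally have *: "(\<integral>\<^sup>+x. ennreal (H x) \<partial>M) \<le> ennreal B" .
  show i: "integrable M H"
    by (rule integrableI_nonneg[OF H Hpos]) (use * in \<open>auto simp: top_unique intro: le_less_trans\<close>)
  show "(LINT x|M. H x) \<le> B"
    using * nn_integral_eq_integral[OF i Hpos] B0 by simp
qed

text \<open>Below the threshold A the first moment dominates; above it the power m has at least one
  exponent to spare, which pays for the factor 1/A. Bounded high moments and a small first moment
  then give a small p-th moment.\<close>

lemma powr_interpolation:
  fixes t A p :: real and m :: nat
  assumes "t \<ge> 0" "A \<ge> 1" "1 \<le> p" "p + 1 \<le> real m"
  shows "t powr p \<le> A powr (p - 1) * t + t ^ m / A"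
proof (cases "t \<le> A")
  case True
  show ?thesis
  proof (cases "t = 0")
    case False
    then have t: "t > 0" using assms by simp
    have "t powr p = t powr (p - 1) * t" using t by (simp add: powr_diff)
    also have "\<dots> \<le> A powr (p - 1) * t" using True t assms by (intro mult_right_mono powr_mono2) auto
    also have "\<dots> \<le> A powr (p - 1) * t + t ^ m / A" using assms by simp
    finally show ?thesis .
  qed (use assms in simp)
next
  case False
  then have t: "t > A" "t > 0" using assms by auto
  have "t powr p * A \<le> t powr p * t" using t by (intro mult_left_mono) auto
  also have "\<dots> = t powr (p + 1)" using t by (simp add: powr_add)
  also have "\<dots> \<le> t powr (real m)" using assms t by (intro powr_mono) auto
  also have "\<dots> = t ^ m" using t by (simp add: powr_realpow)
  finally have "t powr p \<le> t ^ m / A" using assms by (simp add: le_divide_eq)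
  moreover have "0 \<le> A powr (p - 1) * t" using t by simp
  ultimately show ?thesis by linarith
qed

lemma norm_diff_power_le:
  fixes a b :: "'a::real_normed_vector"
  shows "norm (a - b) ^ m \<le> 2 ^ m * (norm a ^ m + norm b ^ m)"
proof -
  have "norm (a - b) \<le> 2 * max (norm a) (norm b)" using norm_triangle_ineq4[of a b] by linarith
  then have "norm (a - b) ^ m \<le> (2 * max (norm a) (norm b)) ^ m" by (rule power_mono) simp
  also have "\<dots> = 2 ^ m * max (norm a) (norm b) ^ m" by (simp add: power_mult_distrib)
  also have "\<dots> \<le> 2 ^ m * (norm a ^ m + norm b ^ m)"
    by (intro mult_left_mono) (auto simp: max_def)
  finally show ?thesis .
qed

text \<open>An almost everywhere convergent subsequence supplies g. Fatou's lemma bounds the moments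
  of g and, for fixed k, yields L^1 convergence of the whole sequence;
  \<open>powr_interpolation\<close> raises this to every p with the same g.\<close>

lemma L1_Cauchy_bounded_moments:
  fixes f :: "nat \<Rightarrow> 'a \<Rightarrow> 'b::{banach, second_countable_topology}"
  assumes "prob_space M"
    and meas[measurable]: "\<And>k. f k \<in> borel_measurable M"
    and int: "\<And>k m. integrable M (\<lambda>x. norm (f k x) ^ m)"
    and bnd: "\<And>m. \<exists>B. \<forall>k. (LINT x|M. norm (f k x) ^ m) \<le> B"
    and cauchy: "\<And>e. e > 0 \<Longrightarrow> \<exists>N. \<forall>i\<ge>N. \<forall>j\<ge>N. (LINT x|M. norm (f i x - f j x)) < e"
  obtains g where "g \<in> borel_measurable M" "\<And>p k. p \<ge> 1 \<Longrightarrow> in_Lp M p (f k)"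
    "\<And>p. p \<ge> 1 \<Longrightarrow> in_Lp M p g"
    "\<And>p. p \<ge> 1 \<Longrightarrow> (\<lambda>k. LINT x|M. norm (f k x - g x) powr p) \<longlonglongrightarrow> 0"
proof -
  interpret prob_space M by fact
  have intf: "integrable M (f k)" for k using int[of k 1] by (simp add: integrable_norm_iff)
  have "\<exists>r. strict_mono r \<and> (AE x in M. Cauchy (\<lambda>i. f (r i) x))"
    by (rule cauchy_L1_AE_cauchy_subseq[of M f]) (use intf cauchy in blast)+
  then obtain r where r: "strict_mono r" and c: "AE x in M. Cauchy (\<lambda>i. f (r i) x)" by blast
  define g where "g = (\<lambda>x. lim (\<lambda>i. f (r i) x))"
  have [measurable]: "g \<in> borel_measurable M" unfolding g_def by (rule borel_measurable_lim_metric) simp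
  have lim: "AE x in M. (\<lambda>i. f (r i) x) \<longlonglongrightarrow> g x"
    using c by eventually_elim (metis g_def Cauchy_convergent convergent_LIMSEQ_iff)
  have gm: "integrable M (\<lambda>x. norm (g x) ^ m)" for m
  proof -
    obtain B where B: "\<And>k. (LINT x|M. norm (f k x) ^ m) \<le> B" using bnd[of m] by blast
    show ?thesis
    proof (rule fatou_integral(1)[where h="\<lambda>i x. norm (f (r i) x) ^ m" and N=0 and B=B])
      show "AE x in M. (\<lambda>i. norm (f (r i) x) ^ m) \<longlonglongrightarrow> norm (g x) ^ m"
        using lim by eventually_elim (rule tendsto_power[OF tendsto_norm])
    qed (simp_all add: int B)
  qed
  have intg: "integrable M g" using gm[of 1] by (simp add: integrable_norm_iff)
  have dm: "integrable M (\<lambda>x. norm (f k x - g x) ^ m)" for k m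
    by (rule Bochner_Integration.integrable_bound[OF integrable_mult_right[OF Bochner_Integration.integrable_add[OF int[of k m] gm[of m]], of "2 ^ m"]])
       (auto simp: norm_diff_power_le)
  have L1: "\<exists>N. \<forall>k\<ge>N. (LINT x|M. norm (f k x - g x)) \<le> e" if "e > 0" for e
  proof -
    obtain N where N: "\<And>i j. i \<ge> N \<Longrightarrow> j \<ge> N \<Longrightarrow> (LINT x|M. norm (f i x - f j x)) < e"
      using cauchy[OF \<open>e > 0\<close>] by blast
    have "(LINT x|M. norm (f k x - g x)) \<le> e" if k: "k \<ge> N" for k
    proof (rule fatou_integral(2)[where h="\<lambda>i x. norm (f k x - f (r i) x)" and N=N])
      show "AE x in M. (\<lambda>i. norm (f k x - f (r i) x)) \<longlonglongrightarrow> norm (f k x - g x)"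
        using lim by eventually_elim (rule tendsto_norm[OF tendsto_diff[OF tendsto_const]])
      show "(LINT x|M. norm (f k x - f (r i) x)) \<le> e" if "i \<ge> N" for i
        using N[OF k, of "r i"] strict_mono_imp_increasing[OF r, of i] that by simp
    qed (use intf in auto)
    then show ?thesis by blast
  qed
  have pow: "integrable M (\<lambda>x. norm (h x) powr p)"
    if [measurable]: "h \<in> borel_measurable M" and hm: "\<And>m. integrable M (\<lambda>x. norm (h x) ^ m)" and p: "p \<ge> 1"
    for h :: "'a \<Rightarrow> 'b" and p
  proof -
    obtain m where m: "p + 1 \<le> real m" using real_arch_simple by blast
    have "integrable M (\<lambda>x. norm (h x) + norm (h x) ^ m)"
      using hm[of 1] hm[of m] by simp
    then show ?thesis
      by (rule Bochner_Integration.integrable_bound)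
         (use powr_interpolation[OF norm_ge_zero, of 1 p m] p m in auto)
  qed
  have conv: "(\<lambda>k. LINT x|M. norm (f k x - g x) powr p) \<longlonglongrightarrow> 0" if p: "p \<ge> 1" for p
  proof (rule LIMSEQ_I)
    fix e :: real assume e: "e > 0"
    obtain m where m: "p + 1 \<le> real m" using real_arch_simple by blast
    obtain B where B: "\<And>k. (LINT x|M. norm (f k x) ^ m) \<le> B" using bnd[of m] by blast
    define K where "K = 2 ^ m * (B + (LINT x|M. norm (g x) ^ m))"
    have K: "(LINT x|M. norm (f k x - g x) ^ m) \<le> K" for k
    proof -
      have "(LINT x|M. norm (f k x - g x) ^ m) \<le> (LINT x|M. 2 ^ m * (norm (f k x) ^ m + norm (g x) ^ m))"
        by (rule integral_mono[OF dm]) (use int gm norm_diff_power_le in auto)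
      also have "\<dots> \<le> K" unfolding K_def using B[of k] int gm by simp
      finally show ?thesis .
    qed
    \<comment> \<open>The threshold is fixed first, so that the high-moment term is at most e/4;
      \<open>d\<close> may depend on it and makes the first-moment term e/4.\<close>
    define A where "A = max 1 (4 * K / e)"
    have A1: "A \<ge> 1" by (simp add: A_def)
    have "4 * K / e \<le> A" by (simp add: A_def)
    then have KA: "K / A \<le> e / 4" using A1 e by (simp add: field_simps)
    define d where "d = e / (4 * A powr (p - 1))"
    have d: "d > 0" using e A1 by (simp add: d_def)
    obtain N where N: "\<And>k. k \<ge> N \<Longrightarrow> (LINT x|M. norm (f k x - g x)) \<le> d" using L1[OF d] by blast
    have "norm ((LINT x|M. norm (f k x - g x) powr p) - 0) < e" if k: "k \<ge> N" for k
    proof -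
      have i1: "integrable M (\<lambda>x. norm (f k x - g x))" using intf intg by simp
      have "(LINT x|M. norm (f k x - g x) powr p) \<le>
        (LINT x|M. A powr (p - 1) * norm (f k x - g x) + norm (f k x - g x) ^ m / A)"
      proof (rule integral_mono)
        show "integrable M (\<lambda>x. norm (f k x - g x) powr p)" by (rule pow) (use dm p in auto)
        show "norm (f k x - g x) powr p \<le> A powr (p - 1) * norm (f k x - g x) + norm (f k x - g x) ^ m / A" for x
          by (rule powr_interpolation) (use A1 p m in auto)
      qed (use i1 dm in simp)
      also have "\<dots> = A powr (p - 1) * (LINT x|M. norm (f k x - g x)) + (LINT x|M. norm (f k x - g x) ^ m) / A"
        using i1 dm by simp
      also have "\<dots> \<le> A powr (p - 1) * d + K / A"
        using N[OF k] K[of k] A1 by (intro add_mono mult_left_mono divide_right_mono) auto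
      also have "A powr (p - 1) * d = e / 4" using A1 by (simp add: d_def)
      also have "e / 4 + K / A < e" using KA e by linarith
      finally show ?thesis by (simp add: integral_nonneg_AE)
    qed
    then show "\<exists>N. \<forall>k\<ge>N. norm ((LINT x|M. norm (f k x - g x) powr p) - 0) < e" by blast
  qed
  show ?thesis
    by (rule that[of g]) (use pow int gm conv in \<open>auto simp: in_Lp_def\<close>)
qed

lemma converges_in_LpI:
  assumes "p \<ge> 1" "\<And>k. in_Lp M p (f k)" "in_Lp M p g"
    "(\<lambda>k. LINT x|M. norm (f k x - g x) powr p) \<longlonglongrightarrow> 0"
  shows "converges_in_Lp M p f"
proof -
  have "(\<lambda>k. Lp_norm M p (\<lambda>x. f k x - g x)) \<longlonglongrightarrow> 0"
    unfolding Lp_norm_def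
    by (rule tendsto_zero_powrI[OF assms(4) tendsto_const]) (use assms(1) in \<open>auto intro!: integral_nonneg_AE\<close>)
  then show ?thesis using assms unfolding converges_in_Lp_def by blast
qed

text \<open>This carries convergence from the monic to the orthonormal polynomials, whose ratio is a
  convergent sequence of constants.\<close>

lemma converges_in_Lp_scale:
  fixes f :: "nat \<Rightarrow> 'a \<Rightarrow> complex" and c :: "nat \<Rightarrow> complex"
  assumes p: "p \<ge> 1" and f: "\<And>k. in_Lp M p (f k)" and g: "in_Lp M p g"
    and lim: "(\<lambda>k. LINT x|M. norm (f k x - g x) powr p) \<longlonglongrightarrow> 0" and c: "c \<longlonglongrightarrow> d"
  shows "converges_in_Lp M p (\<lambda>k x. c k * f k x)"
proof -
  have sc: "in_Lp M p (\<lambda>x. a * h x)" if "in_Lp M p h" for a and h :: "'a \<Rightarrow> complex"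
  proof -
    have [measurable]: "h \<in> borel_measurable M" using that by (simp add: in_Lp_def)
    show ?thesis using that unfolding in_Lp_def by (simp add: norm_mult powr_mult)
  qed
  have two: "norm (u + v) powr p \<le> 2 powr p * (norm u powr p + norm v powr p)" for u v :: complex
  proof -
    have "norm (u + v) powr p \<le> (2 * max (norm u) (norm v)) powr p"
      using norm_triangle_ineq[of u v] p by (intro powr_mono2) auto
    also have "\<dots> = 2 powr p * (max (norm u) (norm v)) powr p" by (simp add: powr_mult)
    also have "\<dots> \<le> 2 powr p * (norm u powr p + norm v powr p)"
      by (intro mult_left_mono) (auto simp: max_def)
    finally show ?thesis .
  qed
  have [measurable]: "f k \<in> borel_measurable M" "g \<in> borel_measurable M" for k
    using f g by (auto simp: in_Lp_def)
  have fg: "integrable M (\<lambda>x. norm (f k x - g x) powr p)" for k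
  proof (rule Bochner_Integration.integrable_bound)
    show "integrable M (\<lambda>x. 2 powr p * (norm (f k x) powr p + norm (g x) powr p))"
      using f[of k] g by (auto simp: in_Lp_def)
    show "AE x in M. norm (norm (f k x - g x) powr p) \<le> norm (2 powr p * (norm (f k x) powr p + norm (g x) powr p))"
      using two[of "f k _" "- g _"] by (intro AE_I2) simp
  qed measurable
  define G where "G = (LINT x|M. norm (g x) powr p)"
  have bound: "(LINT x|M. norm (c k * f k x - d * g x) powr p) \<le>
     2 powr p * (norm (c k) powr p * (LINT x|M. norm (f k x - g x) powr p) + norm (c k - d) powr p * G)" for k
  proof -
    have "(LINT x|M. norm (c k * f k x - d * g x) powr p) \<le>
      (LINT x|M. 2 powr p * (norm (c k) powr p * norm (f k x - g x) powr p + norm (c k - d) powr p * norm (g x) powr p))"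
    proof (rule integral_mono_AE')
      show "integrable M (\<lambda>x. 2 powr p * (norm (c k) powr p * norm (f k x - g x) powr p + norm (c k - d) powr p * norm (g x) powr p))"
        using fg[of k] g by (auto simp: in_Lp_def)
      show "AE x in M. norm (c k * f k x - d * g x) powr p \<le> 2 powr p * (norm (c k) powr p * norm (f k x - g x) powr p + norm (c k - d) powr p * norm (g x) powr p)"
      proof (rule AE_I2)
        fix x
        have "c k * f k x - d * g x = c k * (f k x - g x) + (c k - d) * g x" by (simp add: algebra_simps)
        then show "norm (c k * f k x - d * g x) powr p \<le> 2 powr p * (norm (c k) powr p * norm (f k x - g x) powr p + norm (c k - d) powr p * norm (g x) powr p)"
          using two[of "c k * (f k x - g x)" "(c k - d) * g x"] by (simp add: norm_mult powr_mult)
      qed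
    qed simp
    also have "\<dots> = 2 powr p * (norm (c k) powr p * (LINT x|M. norm (f k x - g x) powr p) + norm (c k - d) powr p * G)"
      using fg[of k] g by (simp add: in_Lp_def G_def)
    finally show ?thesis .
  qed
  have "(\<lambda>k. LINT x|M. norm (c k * f k x - d * g x) powr p) \<longlonglongrightarrow> 0"
  proof (rule tendsto_sandwich[OF _ _ tendsto_const])
    show "\<forall>\<^sub>F k in sequentially. 0 \<le> (LINT x|M. norm (c k * f k x - d * g x) powr p)"
      by (intro always_eventually allI integral_nonneg_AE) simp
    show "\<forall>\<^sub>F k in sequentially. (LINT x|M. norm (c k * f k x - d * g x) powr p) \<le>
       2 powr p * (norm (c k) powr p * (LINT x|M. norm (f k x - g x) powr p) + norm (c k - d) powr p * G)"
      using bound by simp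
    have "(\<lambda>k. norm (c k - d) powr p) \<longlonglongrightarrow> 0"
      using c p by (intro tendsto_zero_powrI[OF _ tendsto_const]) (auto simp: tendsto_norm_zero_iff LIM_zero_iff)
    moreover have "(\<lambda>k. norm (c k) powr p) \<longlonglongrightarrow> norm d powr p"
      using c p by (intro tendsto_powr2 tendsto_norm tendsto_const) auto
    ultimately have "(\<lambda>k. 2 powr p * (norm (c k) powr p * (LINT x|M. norm (f k x - g x) powr p) + norm (c k - d) powr p * G))
      \<longlonglongrightarrow> 2 powr p * (norm d powr p * 0 + 0 * G)"
      by (intro tendsto_mult tendsto_add tendsto_const lim)
    then show "(\<lambda>k. 2 powr p * (norm (c k) powr p * (LINT x|M. norm (f k x - g x) powr p) + norm (c k - d) powr p * G)) \<longlonglongrightarrow> 0"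
      by simp
  qed
  then show ?thesis by (rule converges_in_LpI[OF p sc[OF f] sc[OF g]])
qed

section \<open>Uniqueness of measures with given moments\<close>

text \<open>Stone--Weierstrass approximates by real polynomials in the coordinates, while the
  moments concern z^a \<open>cnj\<close> z^b. On the circle z \<open>cnj z\<close> = 1, so Re z = (1
  + z^2) \<open>cnj z\<close> / 2, likewise for Im z, and common powers of \<open>cnj z\<close> can
  be extracted from sums.\<close>

lemma real_polynomial_on_circle:
  fixes f :: "complex \<Rightarrow> real"
  assumes "real_polynomial_function f"
  shows "\<exists>P n. \<forall>z. cmod z = 1 \<longrightarrow> complex_of_real (f z) = poly P z * cnj z ^ n"
  using assms
proof (induction rule: real_polynomial_function.induct)
  case (linear f)
  interpret bounded_linear f by fact
  define P :: "complex poly" where "P = smult (of_real (f 1) / 2) [:1, 0, 1:] - smult (\<i> * of_real (f \<i>) / 2) [:-1, 0, 1:]"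
  have "complex_of_real (f z) = poly P z * cnj z ^ 1" if z: "cmod z = 1" for z
  proof -
    have zz: "z * cnj z = 1" using z by (simp add: complex_norm_square[symmetric])
    have "z = Re z *\<^sub>R 1 + Im z *\<^sub>R \<i>" by (simp add: complex_eq_iff)
    then have "f z = Re z * f 1 + Im z * f \<i>" by (metis add scaleR real_scaleR_def)
    then have "complex_of_real (f z) = of_real (f 1) * of_real (Re z) + of_real (f \<i>) * of_real (Im z)" by simp
    also have "of_real (Re z) = 1 / 2 * (z + cnj z)" by (simp add: complex_eq_iff)
    also have "of_real (Im z) = - (\<i> / 2) * (z - cnj z)" by (simp add: complex_eq_iff)
    also have "z + cnj z = (1 + z * z) * cnj z" using zz by (simp add: distrib_right mult.assoc)
    also have "z - cnj z = (- 1 + z * z) * cnj z"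
      using zz by (simp add: left_diff_distrib distrib_right mult.assoc)
    finally show ?thesis by (simp add: P_def algebra_simps add_divide_distrib diff_divide_distrib)
  qed
  then show ?case by blast
next
  case (const c)
  show ?case by (intro exI[of _ "[:of_real c:]"] exI[of _ 0]) simp
next
  case (add f g)
  then obtain P n Q m where P: "\<And>z. cmod z = 1 \<Longrightarrow> complex_of_real (f z) = poly P z * cnj z ^ n"
    and Q: "\<And>z. cmod z = 1 \<Longrightarrow> complex_of_real (g z) = poly Q z * cnj z ^ m" by blast
  have "complex_of_real (f z + g z) = poly (P * monom 1 m + Q * monom 1 n) z * cnj z ^ (n + m)" if z: "cmod z = 1" for z
  proof -
    have "z * cnj z = 1" using z by (simp add: complex_norm_square[symmetric])
    then have zz: "z ^ k * cnj z ^ k = 1" for k by (metis power_mult_distrib power_one)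
    have "poly (P * monom 1 m + Q * monom 1 n) z * cnj z ^ (n + m) =
      poly P z * cnj z ^ n * (z ^ m * cnj z ^ m) + poly Q z * cnj z ^ m * (z ^ n * cnj z ^ n)"
      by (simp add: poly_monom power_add algebra_simps)
    then show ?thesis using P[OF z] Q[OF z] zz by simp
  qed
  then show ?case by blast
next
  case (mult f g)
  then obtain P n Q m where P: "\<And>z. cmod z = 1 \<Longrightarrow> complex_of_real (f z) = poly P z * cnj z ^ n"
    and Q: "\<And>z. cmod z = 1 \<Longrightarrow> complex_of_real (g z) = poly Q z * cnj z ^ m" by blast
  have "complex_of_real (f z * g z) = poly (P * Q) z * cnj z ^ (n + m)" if z: "cmod z = 1" for z
    using P[OF z] Q[OF z] by (simp add: power_add)
  then show ?case by blast
qed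

text \<open>The indicator of a closed set is the pointwise limit of continuous cutoffs of the
  distance, and the closed sets form an intersection-stable generator of the Borel sets.\<close>

lemma measure_eqI_continuous:
  fixes M N :: "'a::metric_space measure"
  assumes "finite_measure M" "finite_measure N" "sets M = sets borel" "sets N = sets borel"
    and eq: "\<And>f :: 'a \<Rightarrow> real. continuous_on UNIV f \<Longrightarrow> (\<And>x. \<bar>f x\<bar> \<le> 1) \<Longrightarrow> integral\<^sup>L M f = integral\<^sup>L N f"
  shows "M = N"
proof -
  have lim: "(\<lambda>n. LINT x|K. max 0 (1 - real n * infdist x C)) \<longlonglongrightarrow> measure K C"
    if K: "finite_measure K" "sets K = sets borel" and C: "closed C" "C \<noteq> {}" for K :: "'a measure" and C
  proof -
    interpret finite_measure K by fact
    have sp: "space K = UNIV" using sets_eq_imp_space_eq[OF K(2)] by simp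
    have mb: "f \<in> borel_measurable K" if "f \<in> borel_measurable borel" for f :: "'a \<Rightarrow> real"
      using that by (simp add: measurable_cong_sets[OF K(2) refl])
    have "(\<lambda>n. LINT x|K. max 0 (1 - real n * infdist x C)) \<longlonglongrightarrow> (LINT x|K. indicator C x)"
    proof (rule integral_dominated_convergence[where w="\<lambda>x. 1"])
      show "(\<lambda>x. indicator C x :: real) \<in> borel_measurable K"
        by (intro mb borel_measurable_indicator) (simp add: C(1) borel_closed)
      show "(\<lambda>x. max 0 (1 - real n * infdist x C)) \<in> borel_measurable K" for n
        by (intro mb borel_measurable_continuous_onI continuous_on_max continuous_on_diff continuous_on_mult
          continuous_on_const continuous_on_infdist continuous_on_id)
      show "AE x in K. (\<lambda>n. max 0 (1 - real n * infdist x C)) \<longlonglongrightarrow> indicator C x"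
      proof (rule AE_I2)
        fix x
        show "(\<lambda>n. max 0 (1 - real n * infdist x C)) \<longlonglongrightarrow> (indicator C x :: real)"
        proof (cases "x \<in> C")
          case True
          then show ?thesis using in_closed_iff_infdist_zero[OF C, of x] by simp
        next
          case False
          then have pos: "infdist x C > 0"
            using in_closed_iff_infdist_zero[OF C, of x] infdist_nonneg[of x C] by linarith
          obtain n0 where n0: "1 / infdist x C \<le> real n0" using real_arch_simple by blast
          have "max 0 (1 - real n * infdist x C) = 0" if "n \<ge> n0" for n
          proof -
            have "1 / infdist x C \<le> real n" using n0 that by linarith
            then show ?thesis using pos by (simp add: divide_le_eq)
          qed
          then have "\<forall>\<^sub>F n in sequentially. max 0 (1 - real n * infdist x C) = 0"
            unfolding eventually_sequentially by blast
          then show ?thesis using False by (simp add: tendsto_eventually)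
        qed
      qed
      show "AE x in K. norm (max 0 (1 - real n * infdist x C)) \<le> 1" for n
        by (rule AE_I2) (auto simp: max_def infdist_nonneg)
    qed simp
    then show ?thesis using C(1) by (simp add: sp)
  qed
  interpret M: finite_measure M by fact
  interpret N: finite_measure N by fact
  have cl: "emeasure M C = emeasure N C" if C: "closed C" for C
  proof (cases "C = {}")
    case False
    have "(LINT x|M. max 0 (1 - real n * infdist x C)) = (LINT x|N. max 0 (1 - real n * infdist x C))" for n
    proof (rule eq)
      show "continuous_on UNIV (\<lambda>x. max 0 (1 - real n * infdist x C))"
        by (intro continuous_on_max continuous_on_diff continuous_on_mult
          continuous_on_const continuous_on_infdist continuous_on_id)
      show "\<bar>max 0 (1 - real n * infdist x C)\<bar> \<le> 1" for x
        using infdist_nonneg[of x C] by (auto simp: max_def)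
    qed
    then have "measure M C = measure N C"
      using LIMSEQ_unique[OF lim[OF assms(1,3) C False]] lim[OF assms(2,4) C False] by simp
    then show ?thesis by (simp add: M.emeasure_eq_measure N.emeasure_eq_measure)
  qed simp
  have sb: "sets borel = sigma_sets UNIV (Collect (closed :: 'a set \<Rightarrow> bool))"
    by (subst borel_eq_closed) simp
  show ?thesis
  proof (rule measure_eqI_generator_eq[where E="Collect closed" and \<Omega>=UNIV and A="\<lambda>_. UNIV"])
    show "Int_stable (Collect (closed :: 'a set \<Rightarrow> bool))" by (auto simp: Int_stable_def)
  qed (use cl sb assms(3,4) in auto)
qed

text \<open>Both measures sit on the compact circle, where Stone--Weierstrass approximation is
  uniform; the error e is divided by a bound for the sum of the two masses.\<close>

lemma measure_on_circle_eqI: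
  assumes "measure_on_circle M" "measure_on_circle N"
    and eq: "\<And>a b. (LINT z|M. z ^ a * cnj z ^ b) = (LINT z|N. z ^ a * cnj z ^ b)"
  shows "M = N"
proof (rule measure_eqI_continuous)
  interpret M: measure_on_circle M by fact
  interpret N: measure_on_circle N by fact
  have poly_int: "(LINT z|K. poly P z * cnj z ^ n) = (\<Sum>i\<le>degree P. coeff P i * (LINT z|K. z ^ i * cnj z ^ n))"
    if "measure_on_circle K" for K P n
  proof -
    interpret K: measure_on_circle K by fact
    have i: "integrable K (\<lambda>z. z ^ i * cnj z ^ n)" for i
      by (intro K.integrable_cont_UNIV continuous_on_mult continuous_on_power continuous_on_cnj continuous_on_id)
    have "(LINT z|K. poly P z * cnj z ^ n) = (LINT z|K. (\<Sum>i\<le>degree P. coeff P i * (z ^ i * cnj z ^ n)))"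
      by (simp add: poly_altdef sum_distrib_right mult.assoc)
    also have "\<dots> = (\<Sum>i\<le>degree P. (LINT z|K. coeff P i * (z ^ i * cnj z ^ n)))"
      by (rule Bochner_Integration.integral_sum) (use i in simp)
    finally show ?thesis by simp
  qed
  have rp: "integral\<^sup>L M g = integral\<^sup>L N g" if g: "real_polynomial_function g" for g :: "complex \<Rightarrow> real"
  proof -
    obtain P n where P: "\<And>z. cmod z = 1 \<Longrightarrow> complex_of_real (g z) = poly P z * cnj z ^ n"
      using real_polynomial_on_circle[OF g] by blast
    have gc: "continuous_on UNIV g" using g
      by (simp add: real_polynomial_function_eq continuous_on_polymonial_function)
    have [measurable]: "g \<in> borel_measurable borel" by (rule borel_measurable_continuous_onI[OF gc])
    have "complex_of_real (integral\<^sup>L K g) = (LINT z|K. poly P z * cnj z ^ n)"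
      if "measure_on_circle K" for K
    proof -
      interpret K: measure_on_circle K by fact
      have "complex_of_real (integral\<^sup>L K g) = (LINT z|K. complex_of_real (g z))" by simp
      also have "\<dots> = (LINT z|K. poly P z * cnj z ^ n)"
        by (rule K.integral_circle_cong) (use P in auto)
      finally show ?thesis .
    qed
    then have "complex_of_real (integral\<^sup>L M g) = complex_of_real (integral\<^sup>L N g)"
      using poly_int eq assms(1,2) by simp
    then show ?thesis by (simp only: of_real_eq_iff)
  qed
  fix f :: "complex \<Rightarrow> real"
  assume f: "continuous_on UNIV f"
  define K where "K = measure M UNIV + measure N UNIV + 1"
  have K: "K > 0" unfolding K_def by (simp add: add_nonneg_pos)
  have "\<bar>integral\<^sup>L M f - integral\<^sup>L N f\<bar> \<le> e" if e: "e > 0" for e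
  proof -
    have "e / K > 0" using e K by simp
    then obtain g where g: "real_polynomial_function g" and fg: "\<And>z. z \<in> sphere (0::complex) 1 \<Longrightarrow> \<bar>f z - g z\<bar> < e / K"
      using Stone_Weierstrass_real_polynomial_function[of "sphere (0::complex) 1" f "e / K"]
        continuous_on_subset[OF f, of "sphere 0 1"] by auto
    have gc: "continuous_on UNIV g" using g
      by (simp add: real_polynomial_function_eq continuous_on_polymonial_function)
    have d: "\<bar>integral\<^sup>L D f - integral\<^sup>L D g\<bar> \<le> e / K * measure D UNIV" if "measure_on_circle D" for D
    proof -
      interpret D: measure_on_circle D by fact
      have "\<bar>integral\<^sup>L D f - integral\<^sup>L D g\<bar> = \<bar>LINT z|D. f z - g z\<bar>"
        using D.integrable_cont_UNIV[OF f] D.integrable_cont_UNIV[OF gc] by simp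
      also have "\<dots> \<le> (LINT z|D. \<bar>f z - g z\<bar>)" by (rule integral_abs_bound)
      also have "\<dots> \<le> (LINT z|D. e / K)"
      proof (rule integral_mono_AE)
        show "AE z in D. \<bar>f z - g z\<bar> \<le> e / K"
          using D.AE_circle by eventually_elim (use fg in \<open>auto intro: less_imp_le\<close>)
      qed (use D.integrable_cont_UNIV[OF f] D.integrable_cont_UNIV[OF gc] in auto)
      finally show ?thesis by (simp add: mult.commute)
    qed
    have "\<bar>integral\<^sup>L M f - integral\<^sup>L N f\<bar> \<le> \<bar>integral\<^sup>L M f - integral\<^sup>L M g\<bar> + \<bar>integral\<^sup>L N f - integral\<^sup>L N g\<bar>"
      unfolding rp[OF g] by linarith
    also have "\<dots> \<le> e / K * measure M UNIV + e / K * measure N UNIV"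
      by (intro add_mono d assms)
    also have "\<dots> \<le> e / K * K"
      unfolding distrib_left[symmetric] using e K by (intro mult_left_mono) (auto simp: K_def)
    finally show ?thesis using K by simp
  qed
  then have "\<bar>integral\<^sup>L M f - integral\<^sup>L N f\<bar> \<le> 0" by (rule field_le_epsilon) simp
  then show "integral\<^sup>L M f = integral\<^sup>L N f" by simp
qed (use assms in \<open>auto simp: measure_on_circle_def measure_on_circle_axioms_def\<close>)

section \<open>Lacunary coefficients\<close>

lemma summable_contraction:
  fixes x b :: "nat \<Rightarrow> real"
  assumes x: "\<And>k. 0 \<le> x k" and b: "\<And>k. 0 \<le> b k" "summable b" and r: "0 \<le> r" "r < 1"
    and step: "\<And>k. k \<ge> J \<Longrightarrow> x (Suc k) \<le> r * x k + b k"
  shows "summable x"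
proof -
  define y where "y k = x (k + J)" for k
  define S where "S n = (\<Sum>i<n. y i)" for n
  \<comment> \<open>Summing the recursion gives S n <= y 0 + r S n + \<open>suminf b\<close>, and r
    < 1 lets the middle term be absorbed.\<close>
  have bnd: "S n \<le> (y 0 + suminf b) / (1 - r)" for n
  proof -
    have "S n \<le> S (Suc n)" using x by (simp add: S_def y_def)
    also have "S (Suc n) = y 0 + (\<Sum>i<n. y (Suc i))" unfolding S_def by (rule sum.lessThan_Suc_shift)
    also have "(\<Sum>i<n. y (Suc i)) \<le> (\<Sum>i<n. r * y i + b (i + J))"
      unfolding y_def by (intro sum_mono) (use step in auto)
    also have "\<dots> = r * S n + (\<Sum>i<n. b (i + J))"
      by (simp add: S_def sum.distrib sum_distrib_left)
    also have "(\<Sum>i<n. b (i + J)) = (\<Sum>i\<in>{J..<n + J}. b i)"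
      using sum.shift_bounds_nat_ivl[of b 0 J n] by (simp add: atLeast0LessThan)
    also have "\<dots> \<le> suminf b" using b by (intro sum_le_suminf) auto
    finally have "S n * (1 - r) \<le> y 0 + suminf b" by (simp add: algebra_simps)
    then show ?thesis using r by (simp add: le_divide_eq)
  qed
  have "summable y"
    by (rule summableI_nonneg_bounded[where x="(y 0 + suminf b) / (1 - r)"])
       (use bnd x in \<open>auto simp: S_def y_def\<close>)
  then show ?thesis unfolding y_def by (rule summable_iff_shift[THEN iffD1])
qed

lemma logder_bound_eq:
  assumes "\<And>i. a \<le> i \<Longrightarrow> i < b \<Longrightarrow> \<gamma> i = 0" "a \<le> b"
  shows "logder_bound \<gamma> b = logder_bound \<gamma> a"
  using assms(2,1) by (induction rule: dec_induct) auto

text \<open>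
  Along a lacunary sequence the ratio \<open>L / N\<close> of logarithmic derivative to frequency obeys a
  contraction with forcing term \<open>|\<delta>\<^sub>j|\<close>, so it is square summable together with \<open>\<delta>\<close>.
\<close>

lemma smooth_szego_lacunary:
  fixes n :: "nat \<Rightarrow> nat"
  assumes n1: "\<And>j. n j \<ge> 1" and n2: "\<And>j. n (Suc j) \<ge> 2 * n j"
    and le: "\<And>k. cmod (\<gamma> k) \<le> \<kappa>" and less1: "\<kappa> < 1"
    and sq: "summable (\<lambda>j. (cmod (\<gamma> (n j)))\<^sup>2)"
    and zero: "\<And>k. k \<notin> range n \<Longrightarrow> \<gamma> k = 0"
  shows "smooth_szego \<gamma> \<kappa>"
proof -
  have mono: "strict_mono n"
  proof (rule strict_monoI_Suc)
    show "n j < n (Suc j)" for j using n1[of j] n2[of j] by linarith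
  qed
  define d where "d j = cmod (\<gamma> (n j))" for j
  define a where "a j = logder_bound \<gamma> (n j) / real (Suc (n j))" for j
  have dk: "d j \<le> \<kappa>" for j using le d_def by simp
  have d0: "0 \<le> d j" for j by (simp add: d_def)
  have sumd: "summable (\<lambda>j. (d j)\<^sup>2)" using sq by (simp add: d_def)
  have L0: "0 \<le> logder_bound \<gamma> k" for k
  proof (induction k)
    case (Suc k)
    then show ?case using le[of k] less1 by simp
  qed simp
  have a0: "0 \<le> a j" for j using L0 by (simp add: a_def)
  \<comment> \<open>For N >= 1 and N' >= 2N the quotient (N + 1) / (N' + 1) is at most 2/3, attained
    at N = 1, N' = 2.\<close>
  have astep: "a (Suc j) \<le> 2 / 3 * ((a j * (1 + d j) + d j) / (1 - d j))" for j
  proof -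
    have "logder_bound \<gamma> (n (Suc j)) = logder_bound \<gamma> (Suc (n j))"
    proof (rule logder_bound_eq)
      fix i assume i: "Suc (n j) \<le> i" "i < n (Suc j)"
      have "i \<notin> range n"
      proof
        assume "i \<in> range n"
        then obtain k where k: "i = n k" by blast
        then have "n j < n k" "n k < n (Suc j)" using i by auto
        then have "j < k" "k < Suc j" using strict_mono_less[OF mono] by auto
        then show False by simp
      qed
      then show "\<gamma> i = 0" by (rule zero)
    qed (use mono in \<open>simp add: strict_mono_Suc_iff Suc_leI\<close>)
    also have "\<dots> = (a j * (1 + d j) + d j) / (1 - d j) * real (Suc (n j))"
    proof -
      have "(x * S * (1 + y) + y * S) / (1 - y) = (x * (1 + y) + y) / (1 - y) * S" for x y S :: real
        by (simp add: algebra_simps)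
      moreover have "logder_bound \<gamma> (n j) = a j * real (Suc (n j))" by (simp add: a_def)
      ultimately show ?thesis by (simp only: logder_bound.simps d_def)
    qed
    finally have e: "logder_bound \<gamma> (n (Suc j)) = (a j * (1 + d j) + d j) / (1 - d j) * real (Suc (n j))" .
    have q0: "0 \<le> (a j * (1 + d j) + d j) / (1 - d j)"
      using a0[of j] d0[of j] dk[of j] less1 by simp
    have "real (n (Suc j)) \<ge> 2 * real (n j)" "real (n j) \<ge> 1" using n2[of j] n1[of j] by linarith+
    then have "real (Suc (n j)) \<le> 2 / 3 * real (Suc (n (Suc j)))" by simp
    then have "logder_bound \<gamma> (n (Suc j)) \<le> (a j * (1 + d j) + d j) / (1 - d j) * (2 / 3 * real (Suc (n (Suc j))))"
      unfolding e by (rule mult_left_mono[OF _ q0])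
    then have "logder_bound \<gamma> (n (Suc j)) \<le> 2 / 3 * ((a j * (1 + d j) + d j) / (1 - d j)) * real (Suc (n (Suc j)))"
      by (simp only: mult_ac)
    moreover have "real (Suc (n (Suc j))) > 0" by simp
    ultimately show ?thesis unfolding a_def[of "Suc j"] by (simp only: pos_divide_le_eq)
  qed
  have "(\<lambda>j. (d j)\<^sup>2) \<longlonglongrightarrow> 0" by (rule summable_LIMSEQ_zero[OF sumd])
  \<comment> \<open>For d < 1/10 the fraction in \<open>astep\<close> is at most 5/4 a + 3/2 d;
    multiplied by 2/3 this is 5/6 a + d, a genuine contraction.\<close>
  then have "\<forall>\<^sub>F j in sequentially. (d j)\<^sup>2 < (1 / 10)\<^sup>2" by (rule order_tendstoD) simp
  then obtain J where J: "\<And>j. j \<ge> J \<Longrightarrow> (d j)\<^sup>2 < (1 / 10)\<^sup>2" by (auto simp: eventually_sequentially)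
  have suma: "summable (\<lambda>j. (a j)\<^sup>2)"
  proof (rule summable_contraction[where b="\<lambda>j. 6 * (d j)\<^sup>2" and r="5/6" and J=J])
    fix j assume "j \<ge> J"
    then have dj: "d j < 1 / 10" using J power2_less_imp_less by fastforce
    have "(a j * (1 + d j) + d j) / (1 - d j) \<le> 5 / 4 * a j + 3 / 2 * d j"
    proof -
      have "a j * (1 + d j) + d j \<le> (5 / 4 * a j + 3 / 2 * d j) * (1 - d j)"
      proof -
        have "x * (1 + y) + y \<le> (5 / 4 * x + 3 / 2 * y) * (1 - y)"
          if "0 \<le> x" "0 \<le> y" "y < 1 / 10" for x y :: real
        proof -
          have "(5 / 4 * x + 3 / 2 * y) * (1 - y) - (x * (1 + y) + y) =
              9 / 4 * (x * (1 / 10 - y)) + 3 / 2 * (y * (1 / 10 - y)) + x / 40 + 7 / 20 * y"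
            by (simp add: algebra_simps add_divide_distrib diff_divide_distrib)
          moreover have "0 \<le> x * (1 / 10 - y)" "0 \<le> y * (1 / 10 - y)" using that by auto
          ultimately show ?thesis using that by linarith
        qed
        then show ?thesis using a0 d0 dj by simp
      qed
      then show ?thesis using dj by (simp add: divide_le_eq)
    qed
    then have "a (Suc j) \<le> 5 / 6 * a j + d j" using astep[of j] by linarith
    then have "(a (Suc j))\<^sup>2 \<le> (5 / 6 * a j + d j)\<^sup>2" using a0 by (intro power_mono) auto
    \<comment> \<open>Convexity of the square with weights 5/6 and 1/6, applied to a and 6 d; hence
      the 6 in the forcing term.\<close>
    also have "\<dots> = 5 / 6 * (a j)\<^sup>2 + 6 * (d j)\<^sup>2 - 5 * (a j / 6 - d j)\<^sup>2"
      by (simp add: power2_eq_square algebra_simps)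
    also have "\<dots> \<le> 5 / 6 * (a j)\<^sup>2 + 6 * (d j)\<^sup>2" by simp
    finally show "(a (Suc j))\<^sup>2 \<le> 5 / 6 * (a j)\<^sup>2 + 6 * (d j)\<^sup>2" .
  qed (use sumd in \<open>auto intro: summable_mult\<close>)
  have "summable (\<lambda>j. d j * a j)"
  proof (rule summable_comparison_test'[where N=0])
    show "summable (\<lambda>j. (d j)\<^sup>2 + (a j)\<^sup>2)" by (rule summable_add[OF sumd suma])
    fix j
    have "d j * a j \<le> (d j)\<^sup>2 + (a j)\<^sup>2"
      using sum_squares_bound[of "d j" "a j"] a0[of j] d0[of j] mult_nonneg_nonneg[of "d j" "a j"] by linarith
    then show "norm (d j * a j) \<le> (d j)\<^sup>2 + (a j)\<^sup>2" using a0[of j] d0[of j] by simp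
  qed
  then have w: "summable (\<lambda>k. cmod (\<gamma> k) * (logder_bound \<gamma> k / real (Suc k)))"
    using summable_mono_reindex[OF mono, of "\<lambda>k. cmod (\<gamma> k) * (logder_bound \<gamma> k / real (Suc k))"] zero
    by (simp add: d_def a_def)
  have s: "summable (\<lambda>k. (cmod (\<gamma> k))\<^sup>2)"
    using summable_mono_reindex[OF mono, of "\<lambda>k. (cmod (\<gamma> k))\<^sup>2"] zero sq by simp
  show ?thesis by unfold_locales (use le less1 s w in auto)
qed

section \<open>The limit density\<close>

context smooth_szego
begin

abbreviation "S k \<equiv> szego_density \<gamma> k"
text \<open>On the circle this is the Bernstein--Szego probability density 1 / |\<phi>|^2 for the
  normalised polynomial \<phi> of index k.\<close>

abbreviation "W k z \<equiv> szego_energy \<gamma> k * szego_density \<gamma> k z"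

lemma S_powi: "S k z ^ m = cmod (F k z) powi (2 * (- int m))"
proof -
  have "cmod (F k z) powi (2 * (- int m)) = ((cmod (F k z))\<^sup>2) powi (- int m)"
    using power_int_mult[of "cmod (F k z)" 2 "- int m"] by simp
  then show ?thesis by (simp add: szego_density_def power_int_minus power_one_over inverse_eq_divide)
qed

lemma F_powi: "(cmod (F k z))\<^sup>2 ^ m = cmod (F k z) powi (2 * int m)"
  using power_int_mult[of "cmod (F k z)" 2 "int m"] by simp

lemma S_integrable: "integrable circle_measure (\<lambda>z. S k z ^ m)"
  unfolding S_powi by (rule moment_integrable)

lemma S_bound: "\<exists>B. \<forall>k. (LINT z|circle_measure. S k z ^ m) \<le> B"
  unfolding S_powi using moment_bound[of "- int m"] by metis

lemma F_sq_integrable: "integrable circle_measure (\<lambda>z. (cmod (F k z))\<^sup>2 ^ m)"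
  unfolding F_powi by (rule moment_integrable)

lemma F_sq_bound: "\<exists>B. \<forall>k. (LINT z|circle_measure. (cmod (F k z))\<^sup>2 ^ m) \<le> B"
  unfolding F_powi using moment_bound[of "int m"] by metis

lemma F_pow_integrable: "integrable circle_measure (\<lambda>z. cmod (F k z) ^ m)"
  by (intro circ.integrable_cont_UNIV continuous_on_power continuous_on_norm continuous_on_poly continuous_on_id)

lemma F_pow_bound: "\<exists>B. \<forall>k. (LINT z|circle_measure. cmod (F k z) ^ m) \<le> B"
proof -
  obtain B where B: "\<And>k. (LINT z|circle_measure. (cmod (F k z))\<^sup>2 ^ m) \<le> B" using F_sq_bound by blast
  have "(LINT z|circle_measure. cmod (F k z) ^ m) \<le> 1 + B" for k
  proof -
    have "(LINT z|circle_measure. cmod (F k z) ^ m) \<le> (LINT z|circle_measure. 1 + (cmod (F k z))\<^sup>2 ^ m)"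
    proof (rule integral_mono)
      fix z
      have "x \<le> 1 + x\<^sup>2" for x :: real
        using zero_le_power2[of "x - 1 / 2"] by (simp add: power2_eq_square algebra_simps)
      moreover have "(cmod (F k z) ^ m)\<^sup>2 = (cmod (F k z))\<^sup>2 ^ m" by (simp add: power_mult[symmetric] mult.commute)
      ultimately show "cmod (F k z) ^ m \<le> 1 + (cmod (F k z))\<^sup>2 ^ m" by metis
    qed (use F_pow_integrable F_sq_integrable in auto)
    also have "\<dots> \<le> 1 + B" using F_sq_integrable[of k m] B[of k] circ.prob_space by simp
    finally show ?thesis .
  qed
  then show ?thesis by blast
qed

lemma F_L2_Cauchy':
  assumes "e > 0"
  shows "\<exists>N. \<forall>k\<ge>N. \<forall>l\<ge>N. (LINT z|circle_measure. (cmod (F k z - F l z))\<^sup>2) < e"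
proof -
  obtain T where T: "T \<longlonglongrightarrow> 0" and le: "\<And>k l. k \<le> l \<Longrightarrow> (LINT z|circle_measure. (cmod (F l z - F k z))\<^sup>2) \<le> T k"
    using F_L2_Cauchy by blast
  obtain N where N: "\<And>k. k \<ge> N \<Longrightarrow> T k < e"
    using order_tendstoD(2)[OF T assms] by (auto simp: eventually_sequentially)
  have "(LINT z|circle_measure. (cmod (F k z - F l z))\<^sup>2) < e" if "k \<ge> N" "l \<ge> N" for k l
  proof (cases "k \<le> l")
    case True
    then show ?thesis using le[OF True] N[OF that(1)] by (simp add: norm_minus_commute)
  next
    case False
    then show ?thesis using le[of l k] N[OF that(2)] by simp
  qed
  then show ?thesis by blast
qed

lemma F_diff_integrable: "integrable circle_measure (\<lambda>z. (cmod (F k z - F l z))\<^sup>2)"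
  by (intro circ.integrable_cont_UNIV continuous_on_power continuous_on_norm continuous_on_diff continuous_on_poly continuous_on_id)

text \<open>The elementary inequality t <= e/4 + t^2 / e does the work of Cauchy--Schwarz.\<close>

lemma F_L1_Cauchy:
  assumes e: "e > 0"
  shows "\<exists>N. \<forall>k\<ge>N. \<forall>l\<ge>N. (LINT z|circle_measure. cmod (F k z - F l z)) < e"
proof -
  obtain N where N: "\<And>k l. k \<ge> N \<Longrightarrow> l \<ge> N \<Longrightarrow> (LINT z|circle_measure. (cmod (F k z - F l z))\<^sup>2) < e\<^sup>2 / 4"
    using F_L2_Cauchy'[of "e\<^sup>2 / 4"] e by auto
  have "(LINT z|circle_measure. cmod (F k z - F l z)) < e" if "k \<ge> N" "l \<ge> N" for k l
  proof -
    have "(LINT z|circle_measure. cmod (F k z - F l z)) \<le> (LINT z|circle_measure. e / 4 + (cmod (F k z - F l z))\<^sup>2 / e)"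
    proof (rule integral_mono)
      show "integrable circle_measure (\<lambda>z. cmod (F k z - F l z))"
        by (intro circ.integrable_cont_UNIV continuous_on_norm continuous_on_diff continuous_on_poly continuous_on_id)
      show "integrable circle_measure (\<lambda>z. e / 4 + (cmod (F k z - F l z))\<^sup>2 / e)"
        by (intro Bochner_Integration.integrable_add integrable_divide F_diff_integrable) simp
      fix z
      define t where "t = cmod (F k z - F l z)"
      have "0 \<le> (t - e / 2)\<^sup>2" by simp
      then have "t * e \<le> e / 4 * e + t\<^sup>2" by (simp add: power2_eq_square algebra_simps)
      then have "t \<le> (e / 4 * e + t\<^sup>2) / e" using e by (simp add: le_divide_eq)
      then show "t \<le> e / 4 + t\<^sup>2 / e" using e by (simp add: add_divide_distrib)
    qed
    also have "\<dots> = e / 4 + (LINT z|circle_measure. (cmod (F k z - F l z))\<^sup>2) / e"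
      using F_diff_integrable[of k l] circ.prob_space by simp
    also have "\<dots> \<le> e / 4 + (e\<^sup>2 / 4) / e" using N[OF that] e by (intro add_left_mono divide_right_mono) auto
    also have "\<dots> < e" using e by (simp add: power2_eq_square)
    finally show ?thesis .
  qed
  then show ?thesis by blast
qed

text \<open>With f, g the moduli of the two polynomials and s, r the densities, s - r = (g - f) (f +
  g) s r. A weighted inequality of arithmetic and geometric means separates the small factor g - f
  from Y = (f + g) s r, whose square has bounded integral by the positive and negative
  moments.\<close>

lemma S_L1_Cauchy:
  assumes e: "e > 0"
  shows "\<exists>N. \<forall>k\<ge>N. \<forall>l\<ge>N. (LINT z|circle_measure. \<bar>S k z - S l z\<bar>) < e"
proof -
  obtain B where B: "\<And>k. (LINT z|circle_measure. (cmod (F k z))\<^sup>2 ^ 3) \<le> B" using F_sq_bound by blast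
  obtain B' where B': "\<And>k. (LINT z|circle_measure. S k z ^ 6) \<le> B'" using S_bound by blast
  define K where "K = 4 * B + 8 * B' + 1"
  have B0: "0 \<le> B" by (rule order.trans[OF _ B[of 0]]) (auto intro!: integral_nonneg_AE)
  have B0': "0 \<le> B'" by (rule order.trans[OF _ B'[of 0]]) (auto intro!: integral_nonneg_AE simp: szego_density_def)
  have K: "K > 0" using B0 B0' by (simp add: K_def)
  \<comment> \<open>This weight makes the term with Y contribute at most e/8; the L^2 closeness is
    then chosen relative to it and contributes at most e/4.\<close>
  define A where "A = 2 * K / e"
  have A: "A > 0" using K e by (simp add: A_def)
  obtain N where N: "\<And>k l. k \<ge> N \<Longrightarrow> l \<ge> N \<Longrightarrow> (LINT z|circle_measure. (cmod (F k z - F l z))\<^sup>2) < e / (4 * A)"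
    using F_L2_Cauchy'[of "e / (4 * A)"] e A by auto
  have am: "a * b * c \<le> a ^ 3 + b ^ 3 + c ^ 3" if "0 \<le> a" "0 \<le> b" "0 \<le> c" for a b c :: real
  proof -
    define m where "m = max a (max b c)"
    have "a * b * c \<le> m * m * m" unfolding m_def by (intro mult_mono) (use that in auto)
    also have "\<dots> = m ^ 3" by (simp add: power3_eq_cube)
    also have "\<dots> \<le> a ^ 3 + b ^ 3 + c ^ 3" unfolding m_def max_def using that by auto
    finally show ?thesis .
  qed
  have "(LINT z|circle_measure. \<bar>S k z - S l z\<bar>) < e" if "k \<ge> N" "l \<ge> N" for k l
  proof -
    \<comment> \<open>An upper bound for Y^2 in which each summand involves a single function: the
      triple products f^2 s^2 r^2 and g^2 s^2 r^2 are split into cubes by \<open>am\<close>.\<close>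
    define R where "R z = 4 * (cmod (F k z))\<^sup>2 ^ 3 / 2 + 4 * (cmod (F l z))\<^sup>2 ^ 3 / 2 + 4 * S k z ^ 6 + 4 * S l z ^ 6" for z
    have iR: "integrable circle_measure R" unfolding R_def
      by (intro Bochner_Integration.integrable_add integrable_mult_right integrable_divide F_sq_integrable S_integrable)
    have iS: "integrable circle_measure (S k)" for k using S_integrable[of k 1] by simp
    have RK: "integral\<^sup>L circle_measure R \<le> K"
    proof -
      have "integral\<^sup>L circle_measure R = 2 * (LINT z|circle_measure. (cmod (F k z))\<^sup>2 ^ 3) + 2 * (LINT z|circle_measure. (cmod (F l z))\<^sup>2 ^ 3)
        + 4 * (LINT z|circle_measure. S k z ^ 6) + 4 * (LINT z|circle_measure. S l z ^ 6)"
        unfolding R_def using F_pow_integrable S_integrable by simp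
      then show ?thesis using B[of k] B[of l] B'[of k] B'[of l] by (simp add: K_def)
    qed
    have "(LINT z|circle_measure. \<bar>S k z - S l z\<bar>) \<le> (LINT z|circle_measure. A * (cmod (F k z - F l z))\<^sup>2 + R z / (4 * A))"
    proof (rule integral_mono_AE)
      show "AE z in circle_measure. \<bar>S k z - S l z\<bar> \<le> A * (cmod (F k z - F l z))\<^sup>2 + R z / (4 * A)"
        using circ.AE_circle
      proof eventually_elim
        fix z assume z: "cmod z = 1"
        define f where "f = cmod (F k z)"
        define g where "g = cmod (F l z)"
        define s where "s = S k z"
        define r where "r = S l z"
        define t where "t = cmod (F k z - F l z)"
        have fg: "f > 0" "g > 0" using F_nonzero[OF z] by (auto simp: f_def g_def)
        have s: "s = 1 / f\<^sup>2" and r: "r = 1 / g\<^sup>2" by (simp_all add: s_def r_def f_def g_def szego_density_def)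
        have sr: "0 \<le> s" "0 \<le> r" by (simp_all add: s r)
        define Y where "Y = (f + g) * (s * r)"
        have Y0: "Y \<ge> 0" unfolding Y_def using fg sr by simp
        have "s - r = (g - f) * Y" unfolding Y_def s r using fg
          by (simp add: field_simps power2_eq_square)
        then have "\<bar>s - r\<bar> = \<bar>g - f\<bar> * Y" using Y0 by (simp add: abs_mult)
        also have "\<dots> \<le> t * Y" unfolding t_def f_def g_def
          using norm_triangle_ineq3[of "F k z" "F l z"] Y0
          by (intro mult_right_mono) (auto simp: abs_minus_commute)
        also have "t * Y \<le> A * t\<^sup>2 + Y\<^sup>2 / (4 * A)"
        proof -
          have "0 \<le> (2 * A * t - Y)\<^sup>2" by simp
          then have "t * Y * (4 * A) \<le> 4 * A * (A * t\<^sup>2) + Y\<^sup>2" by (simp add: power2_eq_square algebra_simps)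
          then have "t * Y \<le> (4 * A * (A * t\<^sup>2) + Y\<^sup>2) / (4 * A)" using A by (simp add: le_divide_eq)
          then show ?thesis using A by (simp add: add_divide_distrib)
        qed
        also have "\<dots> \<le> A * t\<^sup>2 + R z / (4 * A)"
        proof -
          have "(f + g)\<^sup>2 \<le> 2 * (f\<^sup>2 + g\<^sup>2)"
            using sum_squares_bound[of f g] by (simp add: power2_sum)
          then have "Y\<^sup>2 \<le> 2 * (f\<^sup>2 + g\<^sup>2) * (s * r)\<^sup>2"
            unfolding Y_def power_mult_distrib[of "f + g"] by (rule mult_right_mono) simp
          also have "\<dots> = 2 * (f\<^sup>2 * s\<^sup>2 * r\<^sup>2) + 2 * (g\<^sup>2 * s\<^sup>2 * r\<^sup>2)"
            by (simp add: power_mult_distrib algebra_simps)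
          also have "\<dots> \<le> 2 * ((f\<^sup>2) ^ 3 + (s\<^sup>2) ^ 3 + (r\<^sup>2) ^ 3) + 2 * ((g\<^sup>2) ^ 3 + (s\<^sup>2) ^ 3 + (r\<^sup>2) ^ 3)"
            by (intro add_mono mult_left_mono am) auto
          also have "\<dots> = R z"
            by (simp add: R_def f_def[symmetric] g_def[symmetric] s_def[symmetric] r_def[symmetric] power_mult[symmetric])
          finally show ?thesis using A by (intro add_left_mono divide_right_mono) auto
        qed
        finally show "\<bar>S k z - S l z\<bar> \<le> A * (cmod (F k z - F l z))\<^sup>2 + R z / (4 * A)"
          by (simp add: s_def r_def t_def)
      qed
      show "integrable circle_measure (\<lambda>z. A * (cmod (F k z - F l z))\<^sup>2 + R z / (4 * A))"
        by (intro Bochner_Integration.integrable_add integrable_mult_right integrable_divide F_diff_integrable iR)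
    qed (use iS in auto)
    also have "\<dots> = A * (LINT z|circle_measure. (cmod (F k z - F l z))\<^sup>2) + integral\<^sup>L circle_measure R / (4 * A)"
      using F_diff_integrable[of k l] iR by simp
    also have "\<dots> \<le> A * (e / (4 * A)) + K / (4 * A)"
      using N[OF that] RK A by (intro add_mono mult_left_mono divide_right_mono) auto
    also have "\<dots> < e"
    proof -
      have "A * (e / (4 * A)) = e / 4" using A by simp
      moreover have "K / (4 * A) = e / 8" using K e by (simp add: A_def)
      ultimately show ?thesis using e by linarith
    qed
    finally show ?thesis .
  qed
  then show ?thesis by blast
qed

text \<open>The energy is the reciprocal of the mass of \<open>S k\<close>, and these masses are
  bounded; so the decreasing limit stays positive.\<close>

lemma szego_energy_limit:
  obtains E where "E > 0" "szego_energy \<gamma> \<longlonglongrightarrow> E"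
proof -
  obtain B where B: "\<And>k. (LINT z|circle_measure. S k z ^ 1) \<le> B" using S_bound by blast
  have low: "1 / B \<le> szego_energy \<gamma> k" "B > 0" for k
  proof -
    have p: "szego_energy \<gamma> k > 0" by (rule szego_energy_pos[of \<gamma>, OF \<gamma>_less])
    have 1: "szego_energy \<gamma> k * (LINT z|circle_measure. S k z) = 1"
      by (rule integral_szego_density[of \<gamma>, OF \<gamma>_less])
    have "1 \<le> szego_energy \<gamma> k * B" unfolding 1[symmetric] using p B[of k] by (intro mult_left_mono) auto
    moreover from this show "B > 0" using p by (smt (verit) mult_nonneg_nonpos)
    ultimately show "1 / B \<le> szego_energy \<gamma> k" by (simp add: divide_le_eq)
  qed
  have "\<forall>k. 1 / B \<le> szego_energy \<gamma> k" using low by blast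
  then obtain E where E: "szego_energy \<gamma> \<longlonglongrightarrow> E" 
    using decseq_convergent[OF szego_energy_antimono[of \<gamma>, OF \<gamma>_less]] by blast
  have "1 / B \<le> E" by (rule LIMSEQ_le_const[OF E]) (use low in blast)
  then have "E > 0" using low(2) by (smt (verit) zero_less_divide_1_iff)
  then show ?thesis using E that by blast
qed

lemma F_limit:
  "\<exists>g. \<forall>p\<ge>1. (\<forall>k. in_Lp circle_measure p (F k)) \<and> in_Lp circle_measure p g \<and>
    (\<lambda>k. LINT z|circle_measure. cmod (F k z - g z) powr p) \<longlonglongrightarrow> 0"
proof (rule L1_Cauchy_bounded_moments[of circle_measure F])
  show "F k \<in> borel_measurable circle_measure" for k by measurable
qed (use prob_space_circle_measure F_pow_integrable F_pow_bound F_L1_Cauchy in blast)+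

text \<open>The energies converge and lie between 0 and 1, so the Cauchy property passes from
  \<open>S k\<close> to the normalised densities, which are the ones occurring in
  \<open>bernstein_szego\<close>.\<close>

lemma W_limit:
  "\<exists>w. w \<in> borel_measurable circle_measure \<and> (\<forall>p\<ge>1. in_Lp circle_measure p w) \<and>
    (\<lambda>k. LINT z|circle_measure. \<bar>W k z - w z\<bar>) \<longlonglongrightarrow> 0"
proof -
  let ?E = "szego_energy \<gamma>"
  have E0: "?E k > 0" for k by (rule szego_energy_pos[of \<gamma>, OF \<gamma>_less])
  have E1: "?E k \<le> 1" for k
    using decseqD[OF szego_energy_antimono[of \<gamma>, OF \<gamma>_less], of 0 k] by (simp add: szego_energy_def)
  have S0: "S k z \<ge> 0" for k z by (simp add: szego_density_def)
  have iS: "integrable circle_measure (S k)" for k using S_integrable[of k 1] by simp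
  obtain w where w: "w \<in> borel_measurable circle_measure" "\<And>p. p \<ge> 1 \<Longrightarrow> in_Lp circle_measure p w"
    and lim: "\<And>p. p \<ge> 1 \<Longrightarrow> (\<lambda>k. LINT z|circle_measure. norm (?E k * S k z - w z) powr p) \<longlonglongrightarrow> 0"
  proof (rule L1_Cauchy_bounded_moments[of circle_measure "\<lambda>k z. ?E k * S k z"])
    show "(\<lambda>z. ?E k * S k z) \<in> borel_measurable circle_measure" for k by measurable
    show "integrable circle_measure (\<lambda>z. norm (?E k * S k z) ^ m)" for k m
      using S_integrable[of k m] E0[of k] S0 by (simp add: abs_mult power_mult_distrib)
    show "\<exists>B. \<forall>k. (LINT z|circle_measure. norm (?E k * S k z) ^ m) \<le> B" for m
    proof -
      obtain B where B: "\<And>k. (LINT z|circle_measure. S k z ^ m) \<le> B" using S_bound by blast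
      have "(LINT z|circle_measure. norm (?E k * S k z) ^ m) \<le> B" for k
      proof -
        have "(LINT z|circle_measure. norm (?E k * S k z) ^ m) = ?E k ^ m * (LINT z|circle_measure. S k z ^ m)"
          using E0[of k] S0 by (simp add: abs_mult power_mult_distrib)
        also have "\<dots> \<le> 1 * (LINT z|circle_measure. S k z ^ m)"
          using E0[of k] E1[of k] S0 by (intro mult_right_mono power_le_one integral_nonneg_AE) auto
        finally show ?thesis using B[of k] by simp
      qed
      then show ?thesis by blast
    qed
    fix e :: real assume e: "e > 0"
    obtain N1 where N1: "\<And>k l. k \<ge> N1 \<Longrightarrow> l \<ge> N1 \<Longrightarrow> (LINT z|circle_measure. \<bar>S k z - S l z\<bar>) < e / 2"
      using S_L1_Cauchy[of "e / 2"] e by auto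
    obtain B where B: "\<And>k. (LINT z|circle_measure. S k z ^ 1) \<le> B" using S_bound by blast
    define B1 where "B1 = \<bar>B\<bar> + 1"
    have B1: "B1 > 0" "(LINT z|circle_measure. S k z) \<le> B1" for k using B[of k] by (auto simp: B1_def)
    obtain E where "?E \<longlonglongrightarrow> E" using szego_energy_limit by blast
    then have "Cauchy ?E" by (rule LIMSEQ_imp_Cauchy)
    then obtain N2 where N2: "\<And>k l. k \<ge> N2 \<Longrightarrow> l \<ge> N2 \<Longrightarrow> \<bar>?E k - ?E l\<bar> < e / (2 * B1)"
      using CauchyD[of ?E "e / (2 * B1)"] e B1(1) by auto
    have "(LINT z|circle_measure. norm (?E k * S k z - ?E l * S l z)) < e" if "k \<ge> max N1 N2" "l \<ge> max N1 N2" for k l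
    proof -
      have "(LINT z|circle_measure. norm (?E k * S k z - ?E l * S l z)) \<le>
        (LINT z|circle_measure. \<bar>S k z - S l z\<bar> + \<bar>?E k - ?E l\<bar> * S l z)"
      proof (rule integral_mono)
        fix z
        have "?E k * S k z - ?E l * S l z = ?E k * (S k z - S l z) + (?E k - ?E l) * S l z" by (simp add: algebra_simps)
        then have "norm (?E k * S k z - ?E l * S l z) \<le> ?E k * \<bar>S k z - S l z\<bar> + \<bar>?E k - ?E l\<bar> * S l z"
          using abs_triangle_ineq[of "?E k * (S k z - S l z)" "(?E k - ?E l) * S l z"] E0[of k] S0[of l z]
          by (simp add: abs_mult)
        also have "?E k * \<bar>S k z - S l z\<bar> \<le> 1 * \<bar>S k z - S l z\<bar>" using E1 by (intro mult_right_mono) auto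
        finally show "norm (?E k * S k z - ?E l * S l z) \<le> \<bar>S k z - S l z\<bar> + \<bar>?E k - ?E l\<bar> * S l z" by simp
      qed (use iS in auto)
      also have "\<dots> = (LINT z|circle_measure. \<bar>S k z - S l z\<bar>) + \<bar>?E k - ?E l\<bar> * (LINT z|circle_measure. S l z)"
        using iS by simp
      also have "\<dots> < e / 2 + e / (2 * B1) * B1"
      proof (rule add_less_le_mono)
        show "(LINT z|circle_measure. \<bar>S k z - S l z\<bar>) < e / 2" using N1 that by simp
        show "\<bar>?E k - ?E l\<bar> * (LINT z|circle_measure. S l z) \<le> e / (2 * B1) * B1"
        proof (rule mult_mono)
          show "\<bar>?E k - ?E l\<bar> \<le> e / (2 * B1)" using N2[of k l] that by simp
          show "0 \<le> (LINT z|circle_measure. S l z)" using S0 by (intro integral_nonneg_AE) simp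
        qed (use B1 e in auto)
      qed
      also have "\<dots> = e" using B1(1) by simp
      finally show ?thesis .
    qed
    then show "\<exists>N. \<forall>i\<ge>N. \<forall>j\<ge>N. (LINT z|circle_measure. norm (?E i * S i z - ?E j * S j z)) < e" by blast
  qed (use prob_space_circle_measure in auto)
  show ?thesis using w lim[of 1] by auto
qed

end

text \<open>For fixed a and b the moment under \<open>W k\<close> equals that of \<sigma> as soon as
  k >= max a b, and L^1 convergence carries it to the limit density; equal moments then force equal
  measures.\<close>

lemma smooth_szego_absolutely_continuous:
  assumes \<sigma>: "circle_prob_infinite_support \<sigma>" and sm: "smooth_szego (recurrence_coeff \<sigma>) \<kappa>"
  obtains w where "w \<in> borel_measurable circle_measure" "\<And>z. w z \<ge> 0"
    "\<sigma> = density circle_measure (\<lambda>z. ennreal (w z))" "\<And>p. p \<ge> 1 \<Longrightarrow> in_Lp circle_measure p w"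
proof -
  interpret circle_prob_infinite \<sigma> by unfold_locales fact
  interpret smooth_szego \<gamma> \<kappa> by fact
  have moc: "measure_on_circle \<sigma>" by unfold_locales
  obtain v where v[measurable]: "v \<in> borel_measurable circle_measure" and vp: "\<And>p. p \<ge> 1 \<Longrightarrow> in_Lp circle_measure p v"
    and lim: "(\<lambda>k. LINT z|circle_measure. \<bar>W k z - v z\<bar>) \<longlonglongrightarrow> 0"
    using W_limit by blast
  \<comment> \<open>The L^1 limit need not be nonnegative everywhere. Truncation at 0 repairs this
    and does not increase the distance to the nonnegative \<open>W k\<close>.\<close>
  define w where "w = (\<lambda>z. max 0 (v z))"
  have w0: "w z \<ge> 0" for z by (simp add: w_def)
  have wm[measurable]: "w \<in> borel_measurable circle_measure" unfolding w_def by measurable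
  have wp: "in_Lp circle_measure p w" if p: "p \<ge> 1" for p
  proof -
    have "integrable circle_measure (\<lambda>z. norm (w z) powr p)"
    proof (rule Bochner_Integration.integrable_bound)
      show "integrable circle_measure (\<lambda>z. norm (v z) powr p)" using vp[OF p] by (simp add: in_Lp_def)
      show "AE z in circle_measure. norm (norm (w z) powr p) \<le> norm (norm (v z) powr p)"
        using p by (intro AE_I2) (auto simp: w_def intro!: powr_mono2)
    qed measurable
    then show ?thesis using wm by (simp add: in_Lp_def)
  qed
  have iv: "integrable circle_measure v"
    using vp[of 1] v by (simp add: in_Lp_def integrable_abs_iff)
  have iw: "integrable circle_measure w"
    using wp[of 1] wm by (simp add: in_Lp_def integrable_abs_iff)
  have iW: "integrable circle_measure (W k)" for k
    using S_integrable[of k 1] by simp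
  have wb: "w \<in> borel_measurable borel" using wm by (simp add: measurable_cong_sets[OF sets_circle_measure refl])
  have mw: "measure_on_circle (density circle_measure w)"
    by (rule measure_on_circle_densityI[OF wb iw w0])
  have W0: "W k z \<ge> 0" for k z
    using szego_energy_pos[of \<gamma>, OF \<gamma>_less, of k] by (simp add: szego_density_def)
  have eq: "\<sigma> = density circle_measure w"
  proof (rule measure_on_circle_eqI[OF moc mw])
    fix a b
    let ?f = "\<lambda>z::complex. z ^ a * cnj z ^ b"
    have cf: "continuous_on UNIV ?f"
      by (intro continuous_on_mult continuous_on_power continuous_on_cnj continuous_on_id)
    have fm: "?f \<in> borel_measurable circle_measure"
      using borel_measurable_continuous_onI[OF cf] by (simp only: measurable_cong_sets[OF sets_circle_measure refl])
    have fint: "integrable circle_measure (\<lambda>z. u z *\<^sub>R ?f z)" if u: "integrable circle_measure u" for u :: "complex \<Rightarrow> real"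
    proof (rule Bochner_Integration.integrable_bound[OF u])
      show "(\<lambda>z. u z *\<^sub>R ?f z) \<in> borel_measurable circle_measure"
        by (rule borel_measurable_scaleR[OF borel_measurable_integrable[OF u] fm])
      show "AE z in circle_measure. norm (u z *\<^sub>R ?f z) \<le> norm (u z)"
        using circ.AE_circle by eventually_elim (simp add: norm_mult norm_power)
    qed
    have "(\<lambda>k. (LINT z|circle_measure. W k z *\<^sub>R ?f z) - (LINT z|circle_measure. w z *\<^sub>R ?f z)) \<longlonglongrightarrow> 0"
    proof (rule Lim_null_comparison[OF _ lim])
      have "norm ((LINT z|circle_measure. W k z *\<^sub>R ?f z) - (LINT z|circle_measure. w z *\<^sub>R ?f z)) \<le> (LINT z|circle_measure. \<bar>W k z - v z\<bar>)" for k
      proof -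
        have i1: "integrable circle_measure (\<lambda>z. norm (W k z *\<^sub>R ?f z - w z *\<^sub>R ?f z))"
          using Bochner_Integration.integrable_diff[OF fint[OF iW[of k]] fint[OF iw]] by (rule integrable_norm)
        have i2: "integrable circle_measure (\<lambda>z. \<bar>W k z - v z\<bar>)"
          using Bochner_Integration.integrable_diff[OF iW[of k] iv] by (rule integrable_abs)
        have ae: "AE z in circle_measure. norm (W k z *\<^sub>R ?f z - w z *\<^sub>R ?f z) \<le> \<bar>W k z - v z\<bar>"
          using circ.AE_circle
        proof eventually_elim
          fix z :: complex assume z: "cmod z = 1"
          have "norm ((W k z - w z) *\<^sub>R ?f z) = \<bar>W k z - w z\<bar> * norm (?f z)" by (rule norm_scaleR)
          also have "norm (?f z) = 1" using z by (simp only: norm_mult norm_power complex_mod_cnj) simp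
          finally have "norm (W k z *\<^sub>R ?f z - w z *\<^sub>R ?f z) = \<bar>W k z - w z\<bar>"
            by (simp only: scaleR_diff_left mult_1_right)
          also have "\<dots> \<le> \<bar>W k z - v z\<bar>"
          proof -
            have "\<bar>x - max 0 y\<bar> \<le> \<bar>x - y\<bar>" if "0 \<le> x" for x y :: real using that by linarith
            from this[OF W0[of k z]] show ?thesis by (simp only: w_def)
          qed
          finally show "norm (W k z *\<^sub>R ?f z - w z *\<^sub>R ?f z) \<le> \<bar>W k z - v z\<bar>" .
        qed
        have e: "(LINT z|circle_measure. W k z *\<^sub>R ?f z) - (LINT z|circle_measure. w z *\<^sub>R ?f z) =
          (LINT z|circle_measure. W k z *\<^sub>R ?f z - w z *\<^sub>R ?f z)"
          by (rule Bochner_Integration.integral_diff[symmetric, OF fint[OF iW] fint[OF iw]])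
        show ?thesis unfolding e
          by (rule order.trans[OF integral_norm_bound integral_mono_AE[OF i1 i2 ae]])
      qed
      then show "\<forall>\<^sub>F k in sequentially. norm ((LINT z|circle_measure. W k z *\<^sub>R ?f z) - (LINT z|circle_measure. w z *\<^sub>R ?f z)) \<le> (LINT z|circle_measure. \<bar>W k z - v z\<bar>)"
        by simp
    qed
    then have "(\<lambda>k. LINT z|circle_measure. W k z *\<^sub>R ?f z) \<longlonglongrightarrow> (LINT z|circle_measure. w z *\<^sub>R ?f z)"
      by (rule LIM_zero_cancel)
    moreover have "\<forall>\<^sub>F k in sequentially. (LINT z|circle_measure. W k z *\<^sub>R ?f z) = (LINT z|\<sigma>. ?f z)"
      using eventually_ge_at_top[of "max a b"]
    proof eventually_elim
      fix k assume "k \<ge> max a b"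
      then show "(LINT z|circle_measure. W k z *\<^sub>R ?f z) = (LINT z|\<sigma>. ?f z)"
        using bernstein_szego[of \<gamma> \<sigma> a k b, OF \<gamma>_less moc _ szego_orth] prob_space by simp
    qed
    ultimately have "(\<lambda>k. LINT z|\<sigma>. ?f z) \<longlonglongrightarrow> (LINT z|circle_measure. w z *\<^sub>R ?f z)"
      by (rule Lim_transform_eventually)
    then have "(LINT z|\<sigma>. ?f z) = (LINT z|circle_measure. w z *\<^sub>R ?f z)" by (simp add: LIMSEQ_const_iff)
    also have "\<dots> = (LINT z|density circle_measure w. ?f z)"
      by (rule integral_density[symmetric, OF fm wm]) (simp add: w0)
    finally show "(LINT z|\<sigma>. ?f z) = (LINT z|density circle_measure w. ?f z)" .
  qed
  show ?thesis by (rule that[OF wm w0 eq wp])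
qed

lemma smooth_szego_converges:
  assumes \<sigma>: "circle_prob_infinite_support \<sigma>" and sm: "smooth_szego (recurrence_coeff \<sigma>) \<kappa>" and p: "p \<ge> 1"
  shows "converges_in_Lp circle_measure p (\<lambda>k z. poly (star_poly k (orthonormal_OP \<sigma> k)) z)"
    and "converges_in_Lp circle_measure p (\<lambda>k z. poly (star_poly k (monic_OP \<sigma> k)) z)"
proof -
  interpret circle_prob_infinite \<sigma> by unfold_locales fact
  interpret smooth_szego \<gamma> \<kappa> by fact
  obtain g where g: "\<And>k. in_Lp circle_measure p (F k)" "in_Lp circle_measure p g"
    "(\<lambda>k. LINT z|circle_measure. cmod (F k z - g z) powr p) \<longlonglongrightarrow> 0"
    using F_limit p by blast
  show "converges_in_Lp circle_measure p (\<lambda>k z. poly (star_poly k (monic_OP \<sigma> k)) z)"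
    unfolding star_monic_OP by (rule converges_in_LpI[OF p g])
  obtain E where E: "E > 0" "szego_energy \<gamma> \<longlonglongrightarrow> E" using szego_energy_limit .
  have "(\<lambda>k. complex_of_real (1 / sqrt (szego_energy \<gamma> k))) \<longlonglongrightarrow> complex_of_real (1 / sqrt E)"
    using E by (intro tendsto_of_real tendsto_divide tendsto_const tendsto_real_sqrt) auto
  then show "converges_in_Lp circle_measure p (\<lambda>k z. poly (star_poly k (orthonormal_OP \<sigma> k)) z)"
    unfolding star_orthonormal_OP poly_smult by (rule converges_in_Lp_scale[OF p g])
qed

theorem theorem1p7:
  fixes q :: real and n :: "nat \<Rightarrow> nat" and \<delta> :: "nat \<Rightarrow> complex" and \<sigma> :: "complex measure"
  assumes "q \<ge> 2"
    and "\<And>j. n j \<ge> 1"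
    and "n 0 = 1"
    and "\<And>j. real (n (Suc j)) / real (n j) \<ge> q"
    and "summable (\<lambda>j. (cmod (\<delta> j))\<^sup>2)"
    and "(SUP j. cmod (\<delta> j)) < 1"
    and "circle_prob_infinite_support \<sigma>"
    and "\<And>j. j \<ge> 1 \<Longrightarrow> recurrence_coeff \<sigma> (n j) = \<delta> j"
    and "\<And>k. k \<notin> n ` {1..} \<Longrightarrow> recurrence_coeff \<sigma> k = 0"
  shows "absolutely_continuous circle_measure \<sigma> \<and>
    (\<exists>w :: complex \<Rightarrow> real. w \<in> borel_measurable circle_measure \<and> (\<forall>z. w z \<ge> 0) \<and>
       \<sigma> = density circle_measure (\<lambda>z. ennreal (w z)) \<and>
       (\<forall>p\<ge>2. in_Lp circle_measure p w)) \<and>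
    (\<forall>p\<ge>2.
       converges_in_Lp circle_measure p (\<lambda>k z. poly (star_poly k (orthonormal_OP \<sigma> k)) z) \<and>
       converges_in_Lp circle_measure p (\<lambda>k z. poly (star_poly k (monic_OP \<sigma> k)) z))"
proof -
  define \<kappa> where "\<kappa> = max 0 (SUP j. cmod (\<delta> j))"
  \<comment> \<open>The real supremum bounds the moduli only if their range is bounded above; square
    summability supplies this.\<close>
  have "(\<lambda>j. (cmod (\<delta> j))\<^sup>2) \<longlonglongrightarrow> 0" by (rule summable_LIMSEQ_zero[OF assms(5)])
  then have "(\<lambda>j. cmod (\<delta> j)) \<longlonglongrightarrow> 0" using tendsto_real_sqrt[of "\<lambda>j. (cmod (\<delta> j))\<^sup>2" 0] by simp
  then have "bdd_above (range (\<lambda>j. cmod (\<delta> j)))"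
    by (intro bounded_imp_bdd_above convergent_imp_bounded)
  then have \<delta>: "cmod (\<delta> j) \<le> \<kappa>" for j
    unfolding \<kappa>_def by (intro max.coboundedI2 cSUP_upper) auto
  have n2: "n (Suc j) \<ge> 2 * n j" for j
  proof -
    have "2 \<le> real (n (Suc j)) / real (n j)" using assms(1) assms(4)[of j] by linarith
    then have "2 * real (n j) \<le> real (n (Suc j))" using assms(2)[of j] by (simp add: le_divide_eq)
    then show ?thesis by linarith
  qed
  have sm: "smooth_szego (recurrence_coeff \<sigma>) \<kappa>"
  \<comment> \<open>The index is shifted because \<delta> is prescribed from j = 1 on and the
    coefficient at n_0 is zero.\<close>
  proof (rule smooth_szego_lacunary[where n="\<lambda>j. n (Suc j)"])
    have im: "n ` {1..} = range (\<lambda>j. n (Suc j))"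
    proof -
      have "{1..} = range Suc" by (auto simp: image_iff Suc_le_eq gr0_conv_Suc)
      then show ?thesis by (simp add: image_image)
    qed
    show "recurrence_coeff \<sigma> k = 0" if "k \<notin> range (\<lambda>j. n (Suc j))" for k
      using assms(9)[of k] that im by simp
    show "cmod (recurrence_coeff \<sigma> k) \<le> \<kappa>" for k
    proof (cases "k \<in> n ` {1..}")
      case True
      then show ?thesis using assms(8) \<delta> by auto
    next
      case False
      then show ?thesis using assms(9) by (simp add: \<kappa>_def)
    qed
    show "summable (\<lambda>j. (cmod (recurrence_coeff \<sigma> (n (Suc j))))\<^sup>2)"
      using assms(5) by (simp add: assms(8) summable_Suc_iff[of "\<lambda>j. (cmod (\<delta> j))\<^sup>2"])
  qed (use assms n2 in \<open>auto simp: \<kappa>_def\<close>)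
  obtain w where w: "w \<in> borel_measurable circle_measure" "\<And>z. w z \<ge> 0"
    "\<sigma> = density circle_measure (\<lambda>z. ennreal (w z))" "\<And>p. p \<ge> 1 \<Longrightarrow> in_Lp circle_measure p w"
    by (rule smooth_szego_absolutely_continuous[OF assms(7) sm]) (rule that; blast)
  have "absolutely_continuous circle_measure \<sigma>"
    unfolding w(3) by (rule absolutely_continuousI_density) (use w(1) in measurable)
  moreover have "\<forall>p\<ge>2. in_Lp circle_measure p w" using w(4) by simp
  moreover have "\<forall>p\<ge>2.
       converges_in_Lp circle_measure p (\<lambda>k z. poly (star_poly k (orthonormal_OP \<sigma> k)) z) \<and>
       converges_in_Lp circle_measure p (\<lambda>k z. poly (star_poly k (monic_OP \<sigma> k)) z)"
    using smooth_szego_converges[OF assms(7) sm] by simp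
  ultimately show ?thesis using w(1-3) by blast
qed

end
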